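(* Let $N=\max\{1.27\times 10^7,\ 6.5025\times 2^{tl},\ (5.08\lfloor \tfrac{l-2}{2}\rfloor)^2+1\}$ and let $n\ge N+\tfrac{3}{2}+3\sqrt{N-\tfrac{7}{4}}$. \begin{description} \item[(i)] If $t=1$ and $l\ge 4$, then the extremal graph to $\mathrm{spex}_{\mathcal{OP}}(n,tP_l)$ is $K_1\vee H_{\mathcal{OP}}(\lceil \tfrac{l-2}{2}\rceil,\lfloor \tfrac{l-2}{2}\rfloor)$. \item[(ii)] If $t\ge 2$ and $l\ge 3$, then the extremal graph to $\mathrm{spex}_{\mathcal{OP}}(n,tP_l)$ is $K_1\vee H_{\mathcal{OP}}(tl-l-1,\,l-1)$. \end{description} Here "the extremal graph to $\mathrm{spex}_{\mathcal{OP}}(n,F)$ is $X$" means that $X$ is an $n$-vertex $F$-free outerplanar graph and every $n$-vertex $F$-free outerplanar graph of maximum spectral radius is isomorphic to $X$.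
   Context: All graphs are finite and simple. The spectral radius of a graph is the largest eigenvalue of its adjacency matrix. A graph is outerplanar if it can be embedded in the plane with all vertices on the boundary of the outer face. A graph is $F$-free if it contains no subgraph isomorphic to $F$. $\mathrm{spex}_{\mathcal{OP}}(n,F)$ denotes the maximum spectral radius over all $n$-vertex $F$-free outerplanar graphs. $P_l$ denotes the path on $l$ vertices, $tP_l$ the disjoint union of $t$ vertex-disjoint copies of $P_l$, $K_1$ a single vertex, and $G_1\vee G_2$ the join (disjoint union plus all edges between $G_1$ and $G_2$). For positive integers $n,n_1,n_2$ with $n\ge n_1\ge n_2\ge 1$, $H_{\mathcal{OP}}(n_1,n_2)$ (depending on $n$) is the disjoint union of paths on $n-1$ vertices defined by: $H_{\mathcal{OP}}(n_1,n_2)=P_{n_1}\cup \frac{n-1-n_1}{n_2}P_{n_2}$ if $n_2\mid (n-1-n_1)$, and otherwise $H_{\mathcal{OP}}(n_1,n_2)=P_{n_1}\cup \lfloor \frac{n-1-n_1}{n_2}\rfloor P_{n_2}\cup P_{\,n-1-n_1-\lfloor \frac{n-1-n_1}{n_2}\rfloor n_2}$, where $kP_m$ denotes $k$ vertex-disjoint copies of $P_m$. *)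

theory Defs
  imports "HOL-Analysis.Analysis" "Jordan_Normal_Form.Char_Poly"
begin

text \<open>A (finite, simple) graph with n vertices is represented with vertex set {..<n}
  and a symmetric irreflexive adjacency predicate supported on {..<n}.
  Since all notions below are invariant under isomorphism, this loses no generality.\<close>

definition simple_graph :: "nat \<Rightarrow> (nat \<Rightarrow> nat \<Rightarrow> bool) \<Rightarrow> bool" where
  "simple_graph n E \<longleftrightarrow>
     (\<forall>i j. E i j \<longrightarrow> i < n \<and> j < n \<and> i \<noteq> j \<and> E j i)"

definition adj_mat :: "nat \<Rightarrow> (nat \<Rightarrow> nat \<Rightarrow> bool) \<Rightarrow> real mat" where
  "adj_mat n E = mat n n (\<lambda>(i, j). if E i j then 1 else 0)"

definition spectral_radius_graph :: "nat \<Rightarrow> (nat \<Rightarrow> nat \<Rightarrow> bool) \<Rightarrow> real" where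
  "spectral_radius_graph n E = Max {\<mu>. eigenvalue (adj_mat n E) \<mu>}"

definition graph_iso :: "nat \<Rightarrow> (nat \<Rightarrow> nat \<Rightarrow> bool) \<Rightarrow> (nat \<Rightarrow> nat \<Rightarrow> bool) \<Rightarrow> bool" where
  "graph_iso n E E' \<longleftrightarrow>
     (\<exists>f. bij_betw f {..<n} {..<n} \<and> (\<forall>i<n. \<forall>j<n. E i j \<longleftrightarrow> E' (f i) (f j)))"

definition contains_subgraph ::
  "nat \<Rightarrow> (nat \<Rightarrow> nat \<Rightarrow> bool) \<Rightarrow> nat \<Rightarrow> (nat \<Rightarrow> nat \<Rightarrow> bool) \<Rightarrow> bool" where
  "contains_subgraph n G m F \<longleftrightarrow>
     (\<exists>f. inj_on f {..<m} \<and> f ` {..<m} \<subseteq> {..<n} \<and>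
          (\<forall>i<m. \<forall>j<m. F i j \<longrightarrow> G (f i) (f j)))"

text \<open>Outerplanarity, following the topological definition: there is a drawing in the plane
  (vertices as distinct points, edges as arcs between their end vertices, avoiding other vertices,
  two distinct edges meeting only in common end vertices) such that every vertex lies on the
  boundary of the outer face, i.e. the unbounded connected component of the complement of the drawing.
  The plane is taken to be the complex plane (i.e. R^2).\<close>

definition outerplanar :: "nat \<Rightarrow> (nat \<Rightarrow> nat \<Rightarrow> bool) \<Rightarrow> bool" where
  "outerplanar n E \<longleftrightarrow>
     (\<exists>(p :: nat \<Rightarrow> complex) (\<gamma> :: nat \<Rightarrow> nat \<Rightarrow> real \<Rightarrow> complex).
        inj_on p {..<n} \<and>
        (\<forall>i j. E i j \<and> i < j \<longrightarrow>
            arc (\<gamma> i j) \<and> pathstart (\<gamma> i j) = p i \<and> pathfinish (\<gamma> i j) = p j \<and>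
            (\<forall>k<n. p k \<in> path_image (\<gamma> i j) \<longrightarrow> k = i \<or> k = j)) \<and>
        (\<forall>i j k l. E i j \<and> i < j \<and> E k l \<and> k < l \<and> (i, j) \<noteq> (k, l) \<longrightarrow>
            path_image (\<gamma> i j) \<inter> path_image (\<gamma> k l) \<subseteq> p ` ({i, j} \<inter> {k, l})) \<and>
        (let D = p ` {..<n} \<union> (\<Union>{path_image (\<gamma> i j) | i j. E i j \<and> i < j})
         in \<exists>C \<in> components (- D). \<not> bounded C \<and> (\<forall>k<n. p k \<in> frontier C)))"

text \<open>Disjoint union of paths P_{ls!0}, P_{ls!1}, ...: vertices {..<sum_list ls}, consecutive blocks
  of the given sizes, consecutive vertices in the same block adjacent.\<close>

definition block_starts :: "nat list \<Rightarrow> nat set" where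
  "block_starts ls = {sum_list (take k ls) | k. True}"

definition paths_union :: "nat list \<Rightarrow> nat \<Rightarrow> nat \<Rightarrow> bool" where
  "paths_union ls i j \<longleftrightarrow> i < sum_list ls \<and> j < sum_list ls \<and>
     ((j = Suc i \<and> j \<notin> block_starts ls) \<or> (i = Suc j \<and> i \<notin> block_starts ls))"

definition K1_join_paths :: "nat list \<Rightarrow> nat \<Rightarrow> nat \<Rightarrow> bool" where
  "K1_join_paths ls i j \<longleftrightarrow> i < Suc (sum_list ls) \<and> j < Suc (sum_list ls) \<and> i \<noteq> j \<and>
     (i = 0 \<or> j = 0 \<or> paths_union ls (i - 1) (j - 1))"

text \<open>Path sizes of H_OP(n1,n2) (on n-1 vertices): P_{n1}, then q copies of P_{n2} with
  q = floor((n-1-n1)/n2), then P_r with r = n-1-n1-q*n2 if r > 0.\<close>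

definition H_OP_sizes :: "nat \<Rightarrow> nat \<Rightarrow> nat \<Rightarrow> nat list" where
  "H_OP_sizes n n1 n2 =
     (let q = (n - 1 - n1) div n2; r = n - 1 - n1 - q * n2
      in [n1] @ replicate q n2 @ (if r = 0 then [] else [r]))"

definition OP_free :: "nat \<Rightarrow> nat \<Rightarrow> (nat \<Rightarrow> nat \<Rightarrow> bool) \<Rightarrow> (nat \<Rightarrow> nat \<Rightarrow> bool) \<Rightarrow> bool" where
  "OP_free n m F G \<longleftrightarrow> simple_graph n G \<and> outerplanar n G \<and> \<not> contains_subgraph n G m F"

definition extremal_OP ::
  "nat \<Rightarrow> nat \<Rightarrow> (nat \<Rightarrow> nat \<Rightarrow> bool) \<Rightarrow> (nat \<Rightarrow> nat \<Rightarrow> bool) \<Rightarrow> bool" where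
  "extremal_OP n m F X \<longleftrightarrow> OP_free n m F X \<and>
     (\<forall>G. OP_free n m F G \<and>
          (\<forall>H. OP_free n m F H \<longrightarrow> spectral_radius_graph n H \<le> spectral_radius_graph n G)
          \<longrightarrow> graph_iso n G X)"

end

theory Submission
  imports Defs "HOL-Complex_Analysis.Winding_Numbers"
begin

text \<open>Let G be a graph of maximal spectral radius \<open>\<lambda>\<close>; as the claimed optimum contains a spanning star,
  \<open>\<lambda>\<^sup>2 \<ge> n - 1\<close>. Outerplanarity of G enters only through the absence of
  subdivisions of K(2,3) (theta subgraphs) and of K(4), which follows from the Jordan curve theorem and
  a winding number count. Without theta subgraphs, subgraphs have linearly many edges and two
  vertices have at most two common neighbours. Hence a vertex u of maximal Perron weight is adjacent
  to all but \<open>O(\<lambda>)\<close> vertices, and the others have so little weight around them that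
  turning each of them into a pendant neighbour of u would increase the spectral radius.
  So u is adjacent to every vertex, and the rest of G is a union of paths. With
  \<open>\<lambda> = q + 1/q\<close> the eigenvalue equation on the paths can be solved explicitly, and maximality of G
  becomes minimality of the sum of \<open>g m = (1 - q^m) / (1 + q^(m + 1))\<close> over the path sizes m.
  As g is strictly concave, this is decided by majorisation, except for path systems with far too many
  components, which lose because g is close to 1.\<close>

subsection \<open>Theta graphs in the plane\<close>

text \<open>Spectral radii of fans are compared without being computed: both fans are tested at the
  \<open>q\<close> of the maximiser, with vectors that solve every eigenvalue equation except the
  one at the hub. Excluding \<open>t\<close> paths on \<open>l\<close> vertices constrains the path
  sizes \<open>x\<close> in two ways: the sum of the \<open>x div l\<close> is below
  \<open>t\<close>, and if it equals \<open>t - 1\<close>, then two remainders joined through the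
  hub must not give a further path. Majorisation applies when these constraints bound, for every
  \<open>k\<close> from the standard size \<open>n2\<close> on, the total excess of the sizes over
  \<open>k\<close> by \<open>n1 - k\<close>. Otherwise nearly all paths are shorter than
  \<open>n2\<close>: by one for \<open>t = 1\<close>, by about half for \<open>t >= 2\<close>. The
  constants 5.08 and 6.5025 in the hypothesis make the surplus of components outweigh all error
  terms.\<close>

lemma connected_subset_inside:
  fixes S T :: "'a::real_normed_vector set"
  assumes "connected S" "S \<inter> T = {}" "S \<inter> inside T \<noteq> {}"
  shows "S \<subseteq> inside T"
proof -
  obtain x where x: "x \<in> S" "x \<in> inside T" using assms by blast
  have "S \<subseteq> connected_component_set (- T) x"
    using assms x by (intro connected_component_maximal) auto
  then show ?thesis
    using x inside_same_component by (metis mem_Collect_eq subset_iff)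
qed

definition theta_arcs :: "complex \<Rightarrow> complex \<Rightarrow> (real \<Rightarrow> complex) \<Rightarrow> (real \<Rightarrow> complex) \<Rightarrow> (real \<Rightarrow> complex) \<Rightarrow> bool" where
  "theta_arcs a b c1 c2 c3 \<longleftrightarrow> (\<forall>c \<in> {c1, c2, c3}. arc c \<and> pathstart c = a \<and> pathfinish c = b) \<and>
     path_image c1 \<inter> path_image c2 = {a, b} \<and> path_image c2 \<inter> path_image c3 = {a, b} \<and>
     path_image c3 \<inter> path_image c1 = {a, b}"

lemma theta_arcs_rotate: "theta_arcs a b c1 c2 c3 \<Longrightarrow> theta_arcs a b c2 c3 c1"
  by (auto simp: theta_arcs_def)

lemma theta_arcs_loop:
  assumes "theta_arcs a b c1 c2 c3"
  shows "simple_path (c1 +++ reversepath c2)" "pathfinish (c1 +++ reversepath c2) = pathstart (c1 +++ reversepath c2)"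
    "path_image (c1 +++ reversepath c2) = path_image c1 \<union> path_image c2"
  using assms unfolding theta_arcs_def
  by (auto intro!: simple_path_join_loop simp: arc_reversepath path_image_join)

lemma theta_inside_connected:
  assumes "theta_arcs a b c1 c2 c3"
    and "(path_image c3 - {a, b}) \<inter> inside (path_image c1 \<union> path_image c2) \<noteq> {}"
  shows "path_image c3 - {a, b} \<subseteq> inside (path_image c1 \<union> path_image c2)"
proof (rule connected_subset_inside[OF _ _ assms(2)])
  show "connected (path_image c3 - {a, b})"
    using assms(1) connected_simple_path_endless[of c3] arc_imp_simple_path
    by (auto simp: theta_arcs_def)
  show "(path_image c3 - {a, b}) \<inter> (path_image c1 \<union> path_image c2) = {}"
    using assms(1) by (auto simp: theta_arcs_def)
qed

text \<open>If the insides met, each of them, being connected and off the other loop, would be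
  contained in the other. Equal insides have equal frontiers, so the two loops would coincide and
  \<open>c1\<close> would consist of its ends only, while an arc is an infinite set.\<close>

lemma theta_loops_distinct:
  assumes \<theta>: "theta_arcs a b c1 c2 c3"
    and out3: "(path_image c3 - {a, b}) \<inter> inside (path_image c1 \<union> path_image c2) = {}"
    and out1: "(path_image c1 - {a, b}) \<inter> inside (path_image c2 \<union> path_image c3) = {}"
  shows "inside (path_image c1 \<union> path_image c2) \<inter> inside (path_image c2 \<union> path_image c3) = {}"
proof (rule ccontr)
  let ?J = "path_image c1 \<union> path_image c2" and ?K = "path_image c2 \<union> path_image c3"
  assume ne: "inside ?J \<inter> inside ?K \<noteq> {}"
  have J: "connected (inside ?J)" "frontier (inside ?J) = ?J"
    using Jordan_inside_outside[OF theta_arcs_loop(1,2)[OF \<theta>]] theta_arcs_loop(3)[OF \<theta>] by auto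
  have K: "connected (inside ?K)" "frontier (inside ?K) = ?K"
    using Jordan_inside_outside[OF theta_arcs_loop(1,2)[OF theta_arcs_rotate[OF \<theta>]]]
      theta_arcs_loop(3)[OF theta_arcs_rotate[OF \<theta>]] by auto
  have ab: "{a, b} \<subseteq> path_image c1" "{a, b} \<subseteq> path_image c2" "{a, b} \<subseteq> path_image c3"
    using \<theta> by (auto simp: theta_arcs_def)
  have "inside ?J \<inter> ?K = {}"
    using out3 inside_no_overlap[of ?J] ab by blast
  then have 1: "inside ?J \<subseteq> inside ?K"
    using connected_subset_inside[OF J(1)] ne by blast
  have "inside ?K \<inter> ?J = {}"
    using out1 inside_no_overlap[of ?K] ab by blast
  then have 2: "inside ?K \<subseteq> inside ?J"
    using connected_subset_inside[OF K(1)] ne by blast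
  have "?J = ?K" using 1 2 J(2) K(2) by (metis subset_antisym)
  then have "path_image c1 = {a, b}"
    using \<theta> by (auto simp: theta_arcs_def)
  moreover have "infinite (path_image c1)"
  proof -
    have "inj_on c1 {0..1}" using \<theta> by (auto simp: theta_arcs_def arc_def)
    then show ?thesis unfolding path_image_def by (subst finite_image_iff) auto
  qed
  ultimately show False by (metis finite.emptyI finite_insert)
qed

text \<open>The three loops have winding numbers adding up to zero around any point off the
  arcs, so a point inside one of the loops is inside a second one.\<close>
lemma theta_inside_cases:
  assumes \<theta>: "theta_arcs a b c1 c2 c3"
  shows "path_image c1 - {a, b} \<subseteq> inside (path_image c2 \<union> path_image c3) \<or>
         path_image c2 - {a, b} \<subseteq> inside (path_image c3 \<union> path_image c1) \<or>
         path_image c3 - {a, b} \<subseteq> inside (path_image c1 \<union> path_image c2)"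
proof (rule ccontr)
  note \<theta>2 = theta_arcs_rotate[OF \<theta>]
  note \<theta>3 = theta_arcs_rotate[OF \<theta>2]
  assume "\<not> ?thesis"
  then have out: "(path_image c1 - {a, b}) \<inter> inside (path_image c2 \<union> path_image c3) = {}"
    "(path_image c2 - {a, b}) \<inter> inside (path_image c3 \<union> path_image c1) = {}"
    "(path_image c3 - {a, b}) \<inter> inside (path_image c1 \<union> path_image c2) = {}"
    using theta_inside_connected \<theta> \<theta>2 \<theta>3 by blast+
  have d: "inside (path_image c1 \<union> path_image c2) \<inter> inside (path_image c2 \<union> path_image c3) = {}"
    "inside (path_image c3 \<union> path_image c1) \<inter> inside (path_image c1 \<union> path_image c2) = {}"
    using theta_loops_distinct \<theta> \<theta>2 \<theta>3 out by blast+
  have "inside (path_image c1 \<union> path_image c2) \<noteq> {}"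
    using Jordan_inside_outside[OF theta_arcs_loop(1,2)[OF \<theta>]] theta_arcs_loop(3)[OF \<theta>] by auto
  then obtain z where z: "z \<in> inside (path_image c1 \<union> path_image c2)" by blast
  have ab: "{a, b} \<subseteq> path_image c1" using \<theta> by (auto simp: theta_arcs_def)
  have z12: "z \<notin> path_image c1" "z \<notin> path_image c2"
    using z inside_no_overlap[of "path_image c1 \<union> path_image c2"] by blast+
  then have z3: "z \<notin> path_image c3" using out(3) z ab by blast
  have w: "winding_number (c +++ reversepath d) z = winding_number c z - winding_number d z"
    if "c \<in> {c1, c2, c3}" "d \<in> {c1, c2, c3}" for c d
  proof -
    have "\<forall>c \<in> {c1, c2, c3}. path c \<and> pathfinish c = b \<and> z \<notin> path_image c"
      using \<theta> z12 z3 by (simp add: theta_arcs_def arc_imp_path)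
    then have "path c" "path d" "z \<notin> path_image c" "z \<notin> path_image d" "pathfinish c = pathfinish d"
      using that by metis+
    then show ?thesis
      by (simp add: winding_number_join winding_number_reversepath)
  qed
  have "z \<in> outside (path_image (c2 +++ reversepath c3))" "z \<in> outside (path_image (c3 +++ reversepath c1))"
    unfolding theta_arcs_loop(3)[OF \<theta>2] theta_arcs_loop(3)[OF \<theta>3] outside_inside
    using d z z12 z3 by blast+
  then have "winding_number (c2 +++ reversepath c3) z = 0" "winding_number (c3 +++ reversepath c1) z = 0"
    using winding_number_zero_in_outside simple_path_imp_path theta_arcs_loop(1,2) \<theta>2 \<theta>3 by metis+
  then have "winding_number (c1 +++ reversepath c2) z = 0"
    by (simp add: w)
  moreover have "winding_number (c1 +++ reversepath c2) z \<in> {1, -1}"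
    using simple_closed_path_winding_number_inside[OF theta_arcs_loop(1)[OF \<theta>]] z theta_arcs_loop(3)[OF \<theta>]
    by (metis insertCI)
  ultimately show False by auto
qed

text \<open>\<open>C\<close> will be the outer face. Being connected and unbounded, it cannot enter
  the bounded set \<open>inside J\<close>, and as this set is open, the closure of \<open>C\<close>
  misses it too.\<close>

lemma frontier_component_outside:
  fixes C J :: "complex set"
  assumes "connected C" "\<not> bounded C" "C \<inter> J = {}" "open (inside J)" "bounded (inside J)"
  shows "frontier C \<inter> inside J = {}"
proof -
  have "C \<inter> inside J = {}"
    using connected_subset_inside[OF assms(1,3)] assms(2,5) bounded_subset by blast
  then have "closure C \<inter> inside J = {}"
    using assms(4) by (metis open_Int_closure_eq_empty inf_commute)
  then show ?thesis by (auto simp: frontier_def)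
qed


text \<open>The lists hold the inner vertices only. That all three are non-empty distinguishes a
  subdivided K(2,3) from a cycle with a chord, which is outerplanar.\<close>

definition has_theta :: "('a \<Rightarrow> 'a \<Rightarrow> bool) \<Rightarrow> bool" where
  "has_theta E \<longleftrightarrow> (\<exists>a b xs ys zs. xs \<noteq> [] \<and> ys \<noteq> [] \<and> zs \<noteq> [] \<and> distinct (a # b # xs @ ys @ zs) \<and>
     (\<forall>ws \<in> {xs, ys, zs}. successively E (a # ws @ [b])))"

definition has_K4 :: "('a \<Rightarrow> 'a \<Rightarrow> bool) \<Rightarrow> bool" where
  "has_K4 E \<longleftrightarrow> (\<exists>a b c d. distinct [a, b, c, d] \<and> E a b \<and> E a c \<and> E a d \<and> E b c \<and> E b d \<and> E c d)"

section \<open>Walks, cycles and chords in an outerplanar drawing\<close>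

locale outerplanar_drawing =
  fixes n :: nat and E :: "nat \<Rightarrow> nat \<Rightarrow> bool" and p :: "nat \<Rightarrow> complex"
    and \<gamma> :: "nat \<Rightarrow> nat \<Rightarrow> real \<Rightarrow> complex" and C :: "complex set"
  assumes simple: "simple_graph n E"
    and inj: "inj_on p {..<n}"
    and edge: "\<And>i j. E i j \<Longrightarrow> i < j \<Longrightarrow> arc (\<gamma> i j) \<and> pathstart (\<gamma> i j) = p i \<and> pathfinish (\<gamma> i j) = p j \<and>
            (\<forall>k<n. p k \<in> path_image (\<gamma> i j) \<longrightarrow> k = i \<or> k = j)"
    and cross: "\<And>i j k l. E i j \<Longrightarrow> i < j \<Longrightarrow> E k l \<Longrightarrow> k < l \<Longrightarrow> (i, j) \<noteq> (k, l) \<Longrightarrow>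
            path_image (\<gamma> i j) \<inter> path_image (\<gamma> k l) \<subseteq> p ` ({i, j} \<inter> {k, l})"
    and C: "connected C" "\<not> bounded C" "\<And>i j. E i j \<Longrightarrow> i < j \<Longrightarrow> C \<inter> path_image (\<gamma> i j) = {}"
    and fr: "\<And>k. k < n \<Longrightarrow> p k \<in> frontier C"
begin

text \<open>A drawing supplies \<open>\<gamma> i j\<close> for \<open>i < j\<close> only; sorting
  the ends makes the image of an edge symmetric.\<close>

definition edge_image :: "nat \<Rightarrow> nat \<Rightarrow> complex set" where
  "edge_image i j = path_image (\<gamma> (min i j) (max i j))"

fun walk_image :: "nat list \<Rightarrow> complex set" where
  "walk_image (x # y # xs) = edge_image x y \<union> walk_image (y # xs)"
| "walk_image _ = {}"

lemma E_sym: "E i j \<Longrightarrow> E j i" and E_less: "E i j \<Longrightarrow> i < n \<and> j < n" and E_irrefl: "E i j \<Longrightarrow> i \<noteq> j"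
  using simple by (auto simp: simple_graph_def)

lemma edge_image_sym: "edge_image i j = edge_image j i"
  by (simp add: edge_image_def min.commute max.commute)

lemma edge_arc:
  assumes "E i j"
  obtains g where "arc g" "pathstart g = p i" "pathfinish g = p j" "path_image g = edge_image i j"
proof (cases "i < j")
  case True
  then show ?thesis using edge[OF assms] that by (auto simp: edge_image_def min_def max_def)
next
  case False
  then have "j < i" using E_irrefl[OF assms] by auto
  then show ?thesis using edge[OF E_sym[OF assms]] that[of "reversepath (\<gamma> j i)"]
    by (auto simp: edge_image_def min_def max_def arc_reversepath)
qed

lemma edge_vertex:
  assumes "E i j" "k < n"
  shows "p k \<in> edge_image i j \<longleftrightarrow> k = i \<or> k = j"
proof
  show "p k \<in> edge_image i j \<Longrightarrow> k = i \<or> k = j"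
    using edge[of i j] edge[of j i] E_sym E_irrefl assms
    by (cases i j rule: linorder_cases) (auto simp: edge_image_def min_def max_def)
  show "k = i \<or> k = j \<Longrightarrow> p k \<in> edge_image i j"
    using edge_arc[OF assms(1)] by (metis pathfinish_in_path_image pathstart_in_path_image)
qed

lemma edge_cross:
  assumes "E i j" "E k l" "{i, j} \<noteq> {k, l}"
  shows "edge_image i j \<inter> edge_image k l \<subseteq> p ` ({i, j} \<inter> {k, l})"
proof -
  have 1: "E (min i j) (max i j)" "min i j < max i j" "E (min k l) (max k l)" "min k l < max k l"
    using assms E_sym E_irrefl by (auto simp: min_def max_def not_le order_less_le)
  have s: "{min i j, max i j} = {i, j}" "{min k l, max k l} = {k, l}"
    by (auto simp: min_def max_def)
  have "(min i j, max i j) \<noteq> (min k l, max k l)"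
    using s assms(3) by (metis prod.inject)
  from cross[OF 1 this] show ?thesis unfolding edge_image_def s .
qed

lemma walk_image_mem: "z \<in> walk_image xs \<longleftrightarrow> (\<exists>us x y vs. xs = us @ x # y # vs \<and> z \<in> edge_image x y)"
proof
  show "z \<in> walk_image xs \<Longrightarrow> \<exists>us x y vs. xs = us @ x # y # vs \<and> z \<in> edge_image x y"
  proof (induction xs rule: walk_image.induct)
    case (1 x y xs)
    then consider "z \<in> edge_image x y" | "z \<in> walk_image (y # xs)" by auto
    then show ?case
    proof cases
      case 1 then show ?thesis by (metis append_Nil)
    next
      case 2 then show ?thesis using "1.IH" by (metis append_Cons)
    qed
  qed auto
  have "edge_image x y \<subseteq> walk_image (us @ x # y # vs)" for us x y vs
    by (induction us rule: walk_image.induct) (auto simp: neq_Nil_conv)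
  then show "\<exists>us x y vs. xs = us @ x # y # vs \<and> z \<in> edge_image x y \<Longrightarrow> z \<in> walk_image xs"
    by blast
qed

lemma walk_vertex:
  assumes "successively E xs" "2 \<le> length xs" "k < n"
  shows "p k \<in> walk_image xs \<longleftrightarrow> k \<in> set xs"
  using assms
proof (induction xs rule: walk_image.induct)
  case (1 x y xs)
  then show ?case
    by (cases xs) (auto simp: edge_vertex)
qed auto

lemma walk_cross:
  assumes "successively E xs" "successively E ys"
    and "\<And>us x y vs us' x' y' vs'. xs = us @ x # y # vs \<Longrightarrow> ys = us' @ x' # y' # vs' \<Longrightarrow> {x, y} \<noteq> {x', y'}"
  shows "walk_image xs \<inter> walk_image ys \<subseteq> p ` (set xs \<inter> set ys)"
proof
  fix z assume "z \<in> walk_image xs \<inter> walk_image ys"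
  then obtain us x y vs us' x' y' vs' where
    *: "xs = us @ x # y # vs" "z \<in> edge_image x y" "ys = us' @ x' # y' # vs'" "z \<in> edge_image x' y'"
    by (auto simp: walk_image_mem)
  have "E x y" "E x' y'" using assms(1,2) * by (auto simp: successively_append_iff)
  then have "z \<in> p ` ({x, y} \<inter> {x', y'})" using edge_cross assms(3) * by blast
  then show "z \<in> p ` (set xs \<inter> set ys)" using * by auto
qed

lemma walk_arc:
  assumes "successively E xs" "distinct xs" "2 \<le> length xs"
  shows "\<exists>g. arc g \<and> pathstart g = p (hd xs) \<and> pathfinish g = p (last xs) \<and> path_image g = walk_image xs"
  using assms
proof (induction xs rule: walk_image.induct)
  case (1 x y xs)
  obtain g where g: "arc g" "pathstart g = p x" "pathfinish g = p y" "path_image g = edge_image x y"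
    using edge_arc[of x y] "1.prems"(1) by auto
  show ?case
  proof (cases "xs = []")
    case True
    then show ?thesis using g by auto
  next
    case False
    then obtain h where h: "arc h" "pathstart h = p y" "pathfinish h = p (last (y # xs))"
      "path_image h = walk_image (y # xs)"
      using 1 by (cases xs) auto
    have "walk_image [x, y] \<inter> walk_image (y # xs) \<subseteq> p ` (set [x, y] \<inter> set (y # xs))"
    proof (rule walk_cross)
      fix us x' y' vs us' x'' y'' vs'
      assume "[x, y] = us @ x' # y' # vs" "y # xs = us' @ x'' # y'' # vs'"
      moreover from this(1) have "us = []" "x' = x" by (cases us; auto)+
      moreover have "x \<notin> set (y # xs)" using 1 by auto
      moreover from calculation(2) have "{x'', y''} \<subseteq> set (y # xs)" by simp
      ultimately show "{x', y'} \<noteq> {x'', y''}" by blast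
    qed (use 1 in auto)
    also have "\<dots> \<subseteq> {p y}" using 1 by auto
    finally have "arc (g +++ h)" using g h by (intro arc_join) auto
    then show ?thesis using g h by (intro exI[of _ "g +++ h"]) (auto simp: path_image_join)
  qed
qed auto

lemma distinct_ends_not_consecutive:
  assumes "distinct (a # xs @ [b])" "xs \<noteq> []" "a # xs @ [b] = us @ x # y # vs"
  shows "{x, y} \<noteq> {a, b}"
proof
  assume "{x, y} = {a, b}"
  then consider "x = a" "y = b" | "x = b" "y = a" by (auto simp: doubleton_eq_iff)
  then show False
  proof cases
    case 1 then show ?thesis using assms by (cases us) (auto simp: neq_Nil_conv)
  next
    case 2
    then obtain us' where "us = a # us'" using assms by (cases us) auto
    then have "xs @ [b] = us' @ b # a # vs" using assms(3) 2 by simp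
    then have "a \<in> set (xs @ [b])" by simp
    then show ?thesis using assms(1) by simp
  qed
qed

text \<open>As \<open>a\<close> and \<open>b\<close> are the only common vertices, a common edge
  could only join \<open>a\<close> and \<open>b\<close>. A path with inner vertices does not use
  that edge, and at least one of the two paths has inner vertices.\<close>

lemma theta_cross:
  assumes "distinct (a # b # xs @ ys)" "xs \<noteq> [] \<or> ys \<noteq> []"
    and "successively E (a # xs @ [b])" "successively E (a # ys @ [b])"
  shows "walk_image (a # xs @ [b]) \<inter> walk_image (a # ys @ [b]) = {p a, p b}"
proof
  have ab: "set (a # xs @ [b]) \<inter> set (a # ys @ [b]) = {a, b}" using assms(1) by auto
  have "walk_image (a # xs @ [b]) \<inter> walk_image (a # ys @ [b]) \<subseteq> p ` (set (a # xs @ [b]) \<inter> set (a # ys @ [b]))"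
  proof (rule walk_cross)
    fix us x y vs us' x' y' vs'
    assume *: "a # xs @ [b] = us @ x # y # vs" "a # ys @ [b] = us' @ x' # y' # vs'"
    show "{x, y} \<noteq> {x', y'}"
    proof
      assume eq: "{x, y} = {x', y'}"
      have "{x, y} \<subseteq> set (a # xs @ [b])" "{x', y'} \<subseteq> set (a # ys @ [b])" by (simp_all add: *)
      then have sub: "{x, y} \<subseteq> {a, b}" using eq ab by blast
      have "x \<noteq> y" using assms(3) E_irrefl unfolding * by (auto simp: successively_append_iff)
      then have "{x, y} = {a, b}" using sub by auto
      then show False
        using distinct_ends_not_consecutive[OF _ _ *(1)] distinct_ends_not_consecutive[OF _ _ *(2)]
          assms(1,2) eq by auto
    qed
  qed (use assms in auto)
  then show "walk_image (a # xs @ [b]) \<inter> walk_image (a # ys @ [b]) \<subseteq> {p a, p b}" unfolding ab by simp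
  have "a < n" "b < n" using assms E_less by (auto simp: successively_Cons successively_append_iff hd_append split: if_splits)
  then show "{p a, p b} \<subseteq> walk_image (a # xs @ [b]) \<inter> walk_image (a # ys @ [b])"
    using assms by (simp add: walk_vertex)
qed

lemma walk_image_outer: "successively E xs \<Longrightarrow> C \<inter> walk_image xs = {}"
proof (induction xs rule: walk_image.induct)
  case (1 x y xs)
  then have "E (min x y) (max x y)" "min x y < max x y"
    using E_sym E_irrefl by (auto simp: min_def max_def not_le order_less_le)
  then have "C \<inter> edge_image x y = {}" unfolding edge_image_def by (rule C(3))
  then show ?case using 1 by auto
qed auto

text \<open>The two walks form a Jordan curve that the outer face avoids. All vertices lie on the
  frontier of that face, which does not reach inside the curve.\<close>

lemma no_vertex_inside:
  assumes "distinct (a # b # xs @ ys)" "xs \<noteq> [] \<or> ys \<noteq> []"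
    and "successively E (a # xs @ [b])" "successively E (a # ys @ [b])" "v < n"
  shows "open (inside (walk_image (a # xs @ [b]) \<union> walk_image (a # ys @ [b])))"
    "frontier (inside (walk_image (a # xs @ [b]) \<union> walk_image (a # ys @ [b]))) = walk_image (a # xs @ [b]) \<union> walk_image (a # ys @ [b])"
    "p v \<notin> inside (walk_image (a # xs @ [b]) \<union> walk_image (a # ys @ [b]))"
proof -
  obtain c where c: "arc c" "pathstart c = p a" "pathfinish c = p b" "path_image c = walk_image (a # xs @ [b])"
    using walk_arc[of "a # xs @ [b]"] assms by auto
  obtain d where d: "arc d" "pathstart d = p a" "pathfinish d = p b" "path_image d = walk_image (a # ys @ [b])"
    using walk_arc[of "a # ys @ [b]"] assms by auto
  have s: "simple_path (c +++ reversepath d)"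
    using c d theta_cross[OF assms(1-4)] by (intro simple_path_join_loop) (auto simp: arc_reversepath)
  have i: "path_image (c +++ reversepath d) = walk_image (a # xs @ [b]) \<union> walk_image (a # ys @ [b])" (is "_ = ?J")
    using c d by (simp add: path_image_join)
  note J = Jordan_inside_outside[OF s, unfolded i]
  show "open (inside ?J)" "frontier (inside ?J) = ?J" using J c d by simp_all
  have "frontier C \<inter> inside ?J = {}"
    using J c d walk_image_outer assms by (intro frontier_component_outside C) auto
  then show "p v \<notin> inside ?J" using fr assms(5) by blast
qed

text \<open>One of the three walks runs inside the loop of the other two, and it cannot contain an
  inner vertex, since no vertex lies inside a cycle. Hence it is the third walk, reduced to the edge
  between \<open>a\<close> and \<open>b\<close>. Both conclusions are used: \<open>zs = []\<close>
  excludes theta subgraphs, the position of the chord excludes K(4).\<close>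

lemma theta_chord:
  assumes dist: "distinct (a # b # xs @ ys @ zs)" and ne: "xs \<noteq> []" "ys \<noteq> []"
    and walks: "successively E (a # xs @ [b])" "successively E (a # ys @ [b])" "successively E (a # zs @ [b])"
  shows "zs = [] \<and> walk_image (a # zs @ [b]) - {p a, p b} \<subseteq> inside (walk_image (a # xs @ [b]) \<union> walk_image (a # ys @ [b]))"
proof -
  obtain c1 where c1: "arc c1" "pathstart c1 = p a" "pathfinish c1 = p b" "path_image c1 = walk_image (a # xs @ [b])"
    using walk_arc[of "a # xs @ [b]"] assms by auto
  obtain c2 where c2: "arc c2" "pathstart c2 = p a" "pathfinish c2 = p b" "path_image c2 = walk_image (a # ys @ [b])"
    using walk_arc[of "a # ys @ [b]"] assms by auto
  obtain c3 where c3: "arc c3" "pathstart c3 = p a" "pathfinish c3 = p b" "path_image c3 = walk_image (a # zs @ [b])"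
    using walk_arc[of "a # zs @ [b]"] assms by auto
  have d: "distinct (a # b # xs @ ys)" "distinct (a # b # ys @ zs)" "distinct (a # b # zs @ xs)" using dist by auto
  have "theta_arcs (p a) (p b) c1 c2 c3"
    unfolding theta_arcs_def using c1 c2 c3 theta_cross[OF d(1)] theta_cross[OF d(2)] theta_cross[OF d(3)] walks ne by simp
  note cases = theta_inside_cases[OF this, unfolded c1 c2 c3]
  have lt: "set (a # b # xs @ ys @ zs) \<subseteq> {..<n}"
  proof -
    have "set ws \<subseteq> {..<n}" if "successively E ws" "2 \<le> length ws" for ws
      using that
    proof (induction ws rule: walk_image.induct)
      case (1 x y ws)
      then show ?case using E_less by (cases ws) auto
    qed auto
    from this[OF walks(1)] this[OF walks(2)] this[OF walks(3)] show ?thesis by auto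
  qed
  have mem: "p v \<in> walk_image (a # ws @ [b]) - {p a, p b}"
    if "v \<in> set ws" "ws \<in> {xs, ys, zs}" for v ws
  proof -
    have "v < n" "v \<noteq> a" "v \<noteq> b" "a < n" "b < n" using that dist lt by auto
    then have "p v \<noteq> p a" "p v \<noteq> p b" using inj by (auto simp: inj_on_def)
    then show ?thesis using that walks \<open>v < n\<close> by (auto simp: walk_vertex)
  qed
  have "\<not> (walk_image (a # xs @ [b]) - {p a, p b} \<subseteq> inside (walk_image (a # ys @ [b]) \<union> walk_image (a # zs @ [b])))"
    using no_vertex_inside(3)[OF d(2) _ walks(2,3), of "hd xs"] mem[of "hd xs" xs] ne lt hd_in_set[OF ne(1)]
    by (auto simp: subset_iff)
  moreover have "\<not> (walk_image (a # ys @ [b]) - {p a, p b} \<subseteq> inside (walk_image (a # zs @ [b]) \<union> walk_image (a # xs @ [b])))"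
    using no_vertex_inside(3)[OF d(3) _ walks(3,1), of "hd ys"] mem[of "hd ys" ys] ne lt hd_in_set[OF ne(2)]
    by (auto simp: subset_iff)
  ultimately have *: "walk_image (a # zs @ [b]) - {p a, p b} \<subseteq> inside (walk_image (a # xs @ [b]) \<union> walk_image (a # ys @ [b]))"
    using cases by blast
  moreover have "zs = []"
  proof (rule ccontr)
    assume "zs \<noteq> []"
    then show False
      using * no_vertex_inside(3)[OF d(1) _ walks(1,2), of "hd zs"] mem[of "hd zs" zs] ne lt hd_in_set[OF \<open>zs \<noteq> []\<close>]
      by (auto simp: subset_iff)
  qed
  ultimately show ?thesis by blast
qed

lemma no_theta: "\<not> has_theta E"
proof
  assume "has_theta E"
  then obtain a b xs ys zs where "xs \<noteq> []" "ys \<noteq> []" "zs \<noteq> []" "distinct (a # b # xs @ ys @ zs)"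
    "successively E (a # xs @ [b])" "successively E (a # ys @ [b])" "successively E (a # zs @ [b])"
    unfolding has_theta_def by blast
  then show False using theta_chord[of a b xs ys zs] by blast
qed

text \<open>The image of the edge from \<open>c\<close> to \<open>d\<close> would be covered by two
  disjoint closed sets that both meet it: the closed inside of the triangle, and the point
  \<open>p d\<close>, which lies neither on the triangle nor inside it. But an arc is
  connected.\<close>

lemma chord_leaves_inside:
  assumes "E c d" and ab: "distinct [a, b, c]" "E a c" "E c b" "E a b" "d \<notin> {a, b, c}"
    and sub: "edge_image c d - {p c, p d} \<subseteq> inside (walk_image [a, c, b] \<union> walk_image [a, b])"
  shows False
proof -
  let ?J = "walk_image [a, c, b] \<union> walk_image [a, b]"
  have lt: "a < n" "b < n" "c < n" "d < n" using assms E_less by auto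
  have walks: "successively E (a # [c] @ [b])" "successively E (a # [] @ [b])" using ab by auto
  have fr: "closure (inside ?J) = inside ?J \<union> ?J"
    using no_vertex_inside(2)[OF _ _ walks lt(1)] ab by (simp add: closure_Un_frontier)
  have "p d \<notin> ?J" using walk_vertex[OF walks(1), of d] walk_vertex[OF walks(2), of d] ab lt by auto
  moreover have "p d \<notin> inside ?J" using no_vertex_inside(3)[OF _ _ walks lt(4)] ab by simp
  ultimately have d: "p d \<notin> closure (inside ?J)" using fr by simp
  obtain g where g: "arc g" "path_image g = edge_image c d" using edge_arc[OF assms(1)] by metis
  have con: "connected (edge_image c d)" using g by (metis connected_arc_image)
  have "p c \<in> ?J" using walk_vertex[OF walks(1), of c] lt by auto
  then have 1: "edge_image c d \<subseteq> closure (inside ?J) \<union> {p d}"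
    using sub fr by blast
  have 2: "p c \<in> closure (inside ?J)" "p c \<in> edge_image c d" "p d \<in> edge_image c d"
    using \<open>p c \<in> ?J\<close> fr edge_vertex[OF assms(1)] lt by auto
  have "closure (inside ?J) \<inter> edge_image c d = {} \<or> {p d} \<inter> edge_image c d = {}"
    using connected_closedD[OF con _ 1] d by blast
  then show False using 2 by blast
qed

text \<open>In the 4-cycle \<open>a c b d\<close> both chords run inside. The chord from
  \<open>a\<close> to \<open>b\<close> cuts the inside into the insides of two triangles, and the
  other chord, disjoint from it, stays within one of them. Yet one of its ends, \<open>d\<close> or
  \<open>c\<close>, is not a vertex of that triangle.\<close>

lemma no_K4: "\<not> has_K4 E"
proof
  assume "has_K4 E"
  then obtain a b c d where dist: "distinct [a, b, c, d]"
    and e: "E a b" "E a c" "E a d" "E b c" "E b d" "E c d" by (auto simp: has_K4_def)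
  have e': "E b a" "E c a" "E d a" "E c b" "E d b" "E d c" using e E_sym by auto
  have lt: "a < n" "b < n" "c < n" "d < n" using e E_less by auto
  let ?J = "walk_image [a, c, b] \<union> walk_image [a, d, b]"
  have ab: "edge_image a b - {p a, p b} \<subseteq> inside ?J"
    using theta_chord[of a b "[c]" "[d]" "[]"] dist e e' by simp
  have "walk_image [c, a, d] \<union> walk_image [c, b, d] = ?J"
    by (auto simp: edge_image_sym)
  then have cd: "edge_image c d - {p c, p d} \<subseteq> inside ?J"
    using theta_chord[of c d "[a]" "[b]" "[]"] dist e e' by simp
  have disj: "edge_image a b \<inter> edge_image c d = {}"
    using edge_cross[of a b c d] e dist by auto
  obtain c1 where c1: "simple_path c1" "pathstart c1 = p a" "pathfinish c1 = p b" "path_image c1 = walk_image [a, c, b]"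
    using walk_arc[of "[a, c, b]"] dist e e' arc_imp_simple_path by auto
  obtain c2 where c2: "simple_path c2" "pathstart c2 = p a" "pathfinish c2 = p b" "path_image c2 = walk_image [a, d, b]"
    using walk_arc[of "[a, d, b]"] dist e e' arc_imp_simple_path by auto
  obtain g where g: "simple_path g" "pathstart g = p a" "pathfinish g = p b" "path_image g = walk_image [a, b]"
    using walk_arc[of "[a, b]"] dist e e' arc_imp_simple_path by auto
  have pab: "p a \<noteq> p b" using inj dist lt by (auto simp: inj_on_def)
  have inter: "path_image c1 \<inter> path_image c2 = {p a, p b}" "path_image c1 \<inter> path_image g = {p a, p b}"
    "path_image c2 \<inter> path_image g = {p a, p b}"
    using theta_cross[of a b "[c]" "[d]"] theta_cross[of a b "[c]" "[]"] theta_cross[of a b "[d]" "[]"] dist e e'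
    by (simp_all add: c1 c2 g)
  have int_ne: "path_image g - {p a, p b} \<noteq> {}"
    using simple_path_endless[OF g(1)] g(2,3) by auto
  then have ne: "path_image g \<inter> inside (path_image c1 \<union> path_image c2) \<noteq> {}"
    using ab by (auto simp: c1 c2 g)
  obtain h where h: "simple_path h" "pathstart h = p c" "pathfinish h = p d" "path_image h = edge_image c d"
    using edge_arc[OF e(6)] by (metis arc_imp_simple_path)
  let ?I = "path_image h - {p c, p d}"
  have hcon: "connected ?I" "?I \<noteq> {}"
    using simple_path_endless[OF h(1)] connected_simple_path_endless[OF h(1)] h(2,3) by auto
  have "inside (path_image c1 \<union> path_image g) \<union> inside (path_image c2 \<union> path_image g) \<union>
           (path_image g - {p a,p b}) = inside (path_image c1 \<union> path_image c2)"
    using split_inside_simple_closed_curve[OF c1(1-3) c2(1-3) g(1-3) pab inter ne] by metis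
  then have "?I \<subseteq> inside (path_image c1 \<union> path_image g) \<union> inside (path_image c2 \<union> path_image g)"
    using cd disj by (auto simp: c1 c2 g h)
  then consider "?I \<inter> inside (path_image c1 \<union> path_image g) \<noteq> {}" | "?I \<inter> inside (path_image c2 \<union> path_image g) \<noteq> {}"
    using hcon(2) by blast
  then show False
  proof cases
    case 1
    have "?I \<inter> (path_image c1 \<union> path_image g) = {}"
      using disj edge_cross[of a c c d] edge_cross[of c b c d] e e' dist by (auto simp: c1 g h)
    then have "?I \<subseteq> inside (path_image c1 \<union> path_image g)"
      by (rule connected_subset_inside[OF hcon(1) _ 1])
    then show False using chord_leaves_inside[of c d a b] e e' dist by (auto simp: c1 g h)
  next
    case 2
    have "?I \<inter> (path_image c2 \<union> path_image g) = {}"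
      using disj edge_cross[of a d c d] edge_cross[of d b c d] e e' dist by (auto simp: c2 g h)
    then have "?I \<subseteq> inside (path_image c2 \<union> path_image g)"
      by (rule connected_subset_inside[OF hcon(1) _ 2])
    then show False using chord_leaves_inside[of d c a b] e e' dist
      by (auto simp: c2 g h edge_image_sym insert_commute)
  qed
qed

end

lemma outerplanar_no_theta_K4:
  assumes "simple_graph n E" "outerplanar n E"
  shows "\<not> has_theta E \<and> \<not> has_K4 E"
  using assms(2)[unfolded outerplanar_def Let_def]
proof (elim exE conjE bexE, goal_cases)
  case D: (1 p \<gamma> C)
  have sub: "C \<subseteq> - (p ` {..<n} \<union> (\<Union>{path_image (\<gamma> i j) | i j. E i j \<and> i < j}))"
    using D(4) in_components_subset by blast
  interpret outerplanar_drawing n E p \<gamma> C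
  proof
    show "connected C" using D(4) in_components_connected by blast
    show "C \<inter> path_image (\<gamma> i j) = {}" if "E i j" "i < j" for i j
      using sub that by blast
  qed (use assms(1) D(1,2,3,5,6) in simp_all)
  show ?case using no_theta no_K4 by blast
qed

subsection \<open>Drawing a fan\<close>

lemma in_segment_Im_one:
  assumes "z \<in> closed_segment (Complex (real k) 1) (Complex (real k + 1) 1)"
  shows "Im z = 1" "real k \<le> Re z" "Re z \<le> real k + 1"
proof -
  obtain u where u: "0 \<le> u" "u \<le> 1" and z: "z = (1 - u) *\<^sub>R Complex (real k) 1 + u *\<^sub>R Complex (real k + 1) 1"
    using assms by (auto simp: in_segment)
  show "Im z = 1" "real k \<le> Re z" "Re z \<le> real k + 1" unfolding z using u by (simp_all add: algebra_simps)
qed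

lemma in_segment_hub:
  assumes "z \<in> closed_segment 0 (Complex (real k) 1)"
  shows "0 \<le> Im z" "Im z \<le> 1" "Re z = Im z * real k"
  using assms by (auto simp: in_segment)

text \<open>The hub is drawn at the origin, all other vertices at integer points of the line
  with imaginary part 1.\<close>
lemma outerplanar_fan:
  assumes E: "simple_graph n E" and u: "u < n"
    and inj: "inj_on pos ({..<n} - {u})"
    and fan: "\<And>i j. E i j \<Longrightarrow> i = u \<or> j = u \<or> pos j = Suc (pos i) \<or> pos i = Suc (pos j)"
  shows "outerplanar n E"
proof -
  define p where "p i = (if i = u then 0 else Complex (real (pos i)) 1)" for i
  define \<gamma> where "\<gamma> i j = linepath (p i) (p j)" for i j
  have p_eq: "p i = p j \<longleftrightarrow> i = j" if "i < n" "j < n" for i j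
    using that inj by (auto simp: p_def inj_on_def complex_eq_iff)
  have img: "path_image (\<gamma> i j) = closed_segment (p i) (p j)" for i j by (simp add: \<gamma>_def)
  have spoke: "closed_segment (p i) (p j) = closed_segment 0 (Complex (real (pos k)) 1)"
    if "{i, j} = {u, k}" "k \<noteq> u" for i j k
    using that by (auto simp: p_def doubleton_eq_iff closed_segment_commute)
  have rim: "closed_segment (p i) (p j) = closed_segment (Complex (real (pos k)) 1) (Complex (real (pos k) + 1) 1)"
    if "{i, j} = {k, k'}" "k \<noteq> u" "k' \<noteq> u" "pos k' = Suc (pos k)" for i j k k'
    using that by (auto simp: p_def doubleton_eq_iff closed_segment_commute add.commute)
  have cases: "(\<exists>k. {i, j} = {u, k} \<and> k \<noteq> u \<and> k < n) \<or>
      (\<exists>k k'. {i, j} = {k, k'} \<and> k \<noteq> u \<and> k' \<noteq> u \<and> k < n \<and> k' < n \<and> pos k' = Suc (pos k))" if "E i j" for i j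
  proof -
    have "i < n" "j < n" "i \<noteq> j" using E that by (auto simp: simple_graph_def)
    then show ?thesis using fan[OF that] by (metis insert_commute)
  qed
  have pos_inj: "k = k'" if "pos k = pos k'" "k < n" "k' < n" "k \<noteq> u" "k' \<noteq> u" for k k'
    using inj that by (auto simp: inj_on_def)
  have vertex: "k = i \<or> k = j" if "E i j" "k < n" "p k \<in> closed_segment (p i) (p j)" for i j k
    using cases[OF that(1)]
  proof (elim disjE exE conjE)
    fix l assume l: "{i, j} = {u, l}" "l \<noteq> u" "l < n"
    show ?thesis
    proof (cases "k = u")
      case False
      then have "pos k = pos l" using that(3)[unfolded spoke[OF l(1,2)]] in_segment_hub[of "p k" "pos l"]
        by (auto simp: p_def)
      then show ?thesis using pos_inj that l False by (metis insert_iff singletonD)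
    qed (use l in blast)
  next
    fix l l' assume l: "{i, j} = {l, l'}" "l \<noteq> u" "l' \<noteq> u" "l < n" "l' < n" "pos l' = Suc (pos l)"
    note s = in_segment_Im_one[OF that(3)[unfolded rim[OF l(1,2,3,6)]]]
    have "k \<noteq> u" using s by (auto simp: p_def)
    then have "pos k = pos l \<or> pos k = pos l'" using s l by (auto simp: p_def)
    then show ?thesis using pos_inj that l \<open>k \<noteq> u\<close> by (metis insert_iff singletonD)
  qed
  have cross: "closed_segment (p i) (p j) \<inter> closed_segment (p k) (p l) \<subseteq> p ` ({i, j} \<inter> {k, l})"
    if "E i j" "E k l" "{i, j} \<noteq> {k, l}" for i j k l
  proof
    fix z assume z: "z \<in> closed_segment (p i) (p j) \<inter> closed_segment (p k) (p l)"
    have rim_spoke: "z \<in> p ` ({a, a'} \<inter> {u, b})"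
      if "a \<noteq> u" "a' \<noteq> u" "a < n" "a' < n" "pos a' = Suc (pos a)" "b \<noteq> u" "b < n"
        "z \<in> closed_segment (Complex (real (pos a)) 1) (Complex (real (pos a) + 1) 1)"
        "z \<in> closed_segment 0 (Complex (real (pos b)) 1)" for a a' b
    proof -
      note s = in_segment_Im_one[OF that(8)] in_segment_hub[OF that(9)]
      then have "pos b = pos a \<or> pos b = pos a'" using that(5) by auto
      then have "b = a \<or> b = a'" using pos_inj that by blast
      moreover have "z = p b" using s that by (simp add: p_def complex_eq_iff)
      ultimately show ?thesis by blast
    qed
    show "z \<in> p ` ({i, j} \<inter> {k, l})"
      using cases[OF that(1)] cases[OF that(2)]
    proof (elim disjE exE conjE)
      fix a b assume a: "{i, j} = {u, a}" "a \<noteq> u" "a < n" and b: "{k, l} = {u, b}" "b \<noteq> u" "b < n"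
      have "a \<noteq> b" using a b that(3) by auto
      then have "pos a \<noteq> pos b" using pos_inj a b by blast
      moreover have "Re z = Im z * real (pos a)" "Re z = Im z * real (pos b)"
        using z in_segment_hub(3) spoke[OF a(1,2)] spoke[OF b(1,2)] by blast+
      ultimately have "z = 0" by (auto simp: complex_eq_iff)
      then have "z = p u" by (simp add: p_def)
      then show ?thesis unfolding a b by blast
    next
      fix a b b' assume a: "{i, j} = {u, a}" "a \<noteq> u" "a < n"
        and b: "{k, l} = {b, b'}" "b \<noteq> u" "b' \<noteq> u" "b < n" "b' < n" "pos b' = Suc (pos b)"
      show ?thesis using rim_spoke[of b b' a] z spoke[OF a(1,2)] rim[OF b(1,2,3,6)] a b
        by (simp add: inf_commute)
    next
      fix b a a' assume b: "{k, l} = {u, b}" "b \<noteq> u" "b < n"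
        and a: "{i, j} = {a, a'}" "a \<noteq> u" "a' \<noteq> u" "a < n" "a' < n" "pos a' = Suc (pos a)"
      show ?thesis using rim_spoke[of a a' b] z spoke[OF b(1,2)] rim[OF a(1,2,3,6)] a b
        by simp
    next
      fix a a' b b'
      assume a: "{i, j} = {a, a'}" "a \<noteq> u" "a' \<noteq> u" "a < n" "a' < n" "pos a' = Suc (pos a)"
        and b: "{k, l} = {b, b'}" "b \<noteq> u" "b' \<noteq> u" "b < n" "b' < n" "pos b' = Suc (pos b)"
      note s = in_segment_Im_one[of z "pos a"] in_segment_Im_one[of z "pos b"]
      have s: "Im z = 1" "real (pos a) \<le> Re z" "Re z \<le> real (pos a) + 1"
         "real (pos b) \<le> Re z" "Re z \<le> real (pos b) + 1"
        using z s unfolding rim[OF a(1,2,3,6)] rim[OF b(1,2,3,6)] by auto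
      have "pos a \<noteq> pos b" using a b pos_inj that(3) by metis
      then consider "pos b = pos a'" "Re z = real (pos b)" | "pos a = pos b'" "Re z = real (pos a)"
        using s a b by linarith
      then show ?thesis
      proof cases
        case 1
        then have "b = a'" using pos_inj a b by blast
        moreover have "z = p b" using 1 s b by (simp add: p_def complex_eq_iff)
        ultimately show ?thesis unfolding a b by blast
      next
        case 2
        then have "a = b'" using pos_inj a b by blast
        moreover have "z = p a" using 2 s a by (simp add: p_def complex_eq_iff)
        ultimately show ?thesis unfolding a b by blast
      qed
    qed
  qed
  define D where "D = p ` {..<n} \<union> (\<Union>{path_image (\<gamma> i j) | i j. E i j \<and> i < j})"
  \<comment> \<open>The whole drawing lies in the box \<open>K\<close>. The complement of a bounded
    convex set in the plane is connected, so it is contained in a single face, and that face is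
    unbounded.\<close>
  define m where "m = Max (insert 0 (pos ` {..<n}))"
  define K where "K = cbox 0 (Complex (real m) 1)"
  have mem_K: "z \<in> K \<longleftrightarrow> 0 \<le> Re z \<and> Re z \<le> real m \<and> 0 \<le> Im z \<and> Im z \<le> 1" for z
    by (auto simp: K_def in_cbox_complex_iff)
  have pos_m: "pos i \<le> m" if "i < n" for i
    unfolding m_def using that by (intro Max_ge) auto
  have p_K: "p i \<in> K" if "i < n" for i
    using pos_m[OF that] by (auto simp: mem_K p_def)
  have "convex K" "bounded K" by (simp_all add: K_def)
  have D_K: "D \<subseteq> K"
  proof -
    have "closed_segment (p i) (p j) \<subseteq> K" if "E i j" for i j
      using p_K E that \<open>convex K\<close> by (intro closed_segment_subset) (auto simp: simple_graph_def)
    then show ?thesis using p_K by (auto simp: D_def img)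
  qed
  have con: "connected (- K)"
    using \<open>convex K\<close> \<open>bounded K\<close> by (intro connected_complement_bounded_convex) auto
  have ne: "- K \<noteq> {}" using \<open>bounded K\<close> not_bounded_UNIV by (metis Compl_empty_eq double_complement)
  obtain C where C: "C \<in> components (- D)" "- K \<subseteq> C"
    using exists_component_superset[OF _ _ con, of "- D"] D_K ne by blast
  have unb: "\<not> bounded C"
  proof
    assume "bounded C"
    then have "bounded (- K)" using C(2) bounded_subset by blast
    then show False using \<open>bounded K\<close> by (metis Compl_partition bounded_Un not_bounded_UNIV)
  qed
  have fr: "p k \<in> frontier C" if "k < n" for k
  proof -
    have "p k \<notin> C" using C(1) in_components_subset that by (fastforce simp: D_def)
    moreover have "p k \<in> closure C"
    proof -
      \<comment> \<open>Every vertex is on the boundary of the box, the hub on the lower side and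
        the others on the upper one; \<open>d\<close> points out of the box.\<close>
      define d where "d = (if k = u then - \<i> else \<i>)"
      have "p k \<in> closure (- K)"
        unfolding closure_approachable
      proof (intro allI impI)
        fix e :: real assume "0 < e"
        have "p k + of_real (e / 2) * d \<in> - K" using \<open>0 < e\<close> by (auto simp: mem_K p_def d_def)
        moreover have "dist (p k + of_real (e / 2) * d) (p k) < e"
          using \<open>0 < e\<close> by (simp add: dist_norm norm_mult d_def)
        ultimately show "\<exists>y\<in>- K. dist y (p k) < e" by blast
      qed
      then show ?thesis using C(2) closure_mono by blast
    qed
    ultimately show ?thesis using interior_subset by (auto simp: frontier_def)
  qed
  show ?thesis
    unfolding outerplanar_def Let_def
  proof (intro exI conjI)
    show "inj_on p {..<n}" using p_eq by (auto simp: inj_on_def)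
    show "\<forall>i j. E i j \<and> i < j \<longrightarrow> arc (\<gamma> i j) \<and> pathstart (\<gamma> i j) = p i \<and> pathfinish (\<gamma> i j) = p j \<and>
            (\<forall>k<n. p k \<in> path_image (\<gamma> i j) \<longrightarrow> k = i \<or> k = j)"
    proof (intro allI impI)
      fix i j assume ij: "E i j \<and> i < j"
      then have "p i \<noteq> p j" using p_eq E by (auto simp: simple_graph_def)
      then show "arc (\<gamma> i j) \<and> pathstart (\<gamma> i j) = p i \<and> pathfinish (\<gamma> i j) = p j \<and>
            (\<forall>k<n. p k \<in> path_image (\<gamma> i j) \<longrightarrow> k = i \<or> k = j)"
        using vertex ij by (auto simp: \<gamma>_def)
    qed
    show "\<forall>i j k l. E i j \<and> i < j \<and> E k l \<and> k < l \<and> (i, j) \<noteq> (k, l) \<longrightarrow>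
            path_image (\<gamma> i j) \<inter> path_image (\<gamma> k l) \<subseteq> p ` ({i, j} \<inter> {k, l})"
    proof (intro allI impI)
      fix i j k l assume a: "E i j \<and> i < j \<and> E k l \<and> k < l \<and> (i, j) \<noteq> (k, l)"
      then have "{i, j} \<noteq> {k, l}" by (auto simp: doubleton_eq_iff)
      then show "path_image (\<gamma> i j) \<inter> path_image (\<gamma> k l) \<subseteq> p ` ({i, j} \<inter> {k, l})"
        unfolding img using cross a by blast
    qed
    show "\<exists>C\<in>components (- (p ` {..<n} \<union> (\<Union>{path_image (\<gamma> i j) | i j. E i j \<and> i < j}))).
        \<not> bounded C \<and> (\<forall>k<n. p k \<in> frontier C)"
      using C(1) unb fr unfolding D_def by blast
  qed
qed

subsection \<open>Fans over unions of paths\<close>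

definition links :: "'a list list \<Rightarrow> 'a \<Rightarrow> 'a \<Rightarrow> bool" where
  "links pss x y \<longleftrightarrow> (\<exists>us vs. us @ x # y # vs \<in> set pss)"

definition fan :: "'a \<Rightarrow> 'a list list \<Rightarrow> 'a \<Rightarrow> 'a \<Rightarrow> bool" where
  "fan u pss x y \<longleftrightarrow> (x = u \<and> y \<in> set (concat pss)) \<or> (y = u \<and> x \<in> set (concat pss)) \<or>
     links pss x y \<or> links pss y x"

text \<open>Empty paths are excluded because sizes are later compared as multisets of positive
  numbers: truncated sums do not see an entry 0.\<close>

definition fan_layout :: "nat \<Rightarrow> nat \<Rightarrow> nat list list \<Rightarrow> bool" where
  "fan_layout n u pss \<longleftrightarrow> distinct (u # concat pss) \<and> set (u # concat pss) = {..<n} \<and> [] \<notin> set pss"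

lemma successively_iff_links: "successively P xs \<longleftrightarrow> (\<forall>x y. links [xs] x y \<longrightarrow> P x y)"
proof
  show "successively P xs \<Longrightarrow> \<forall>x y. links [xs] x y \<longrightarrow> P x y"
    by (auto simp: links_def successively_append_iff)
  show "\<forall>x y. links [xs] x y \<longrightarrow> P x y \<Longrightarrow> successively P xs"
  proof (induction P xs rule: successively.induct)
    case (3 P x y xs)
    have "links [x # y # xs] x y" unfolding links_def by (rule exI[of _ "[]"]) simp
    then have "P x y" using 3(2) by blast
    moreover have "successively P (y # xs)"
    proof (intro 3(1) allI impI)
      fix a b assume "links [y # xs] a b"
      then obtain us vs where "us @ a # b # vs = y # xs" by (auto simp: links_def)
      then have "(x # us) @ a # b # vs = x # y # xs" by simp
      then have "links [x # y # xs] a b" unfolding links_def by (metis list.set_intros(1))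
      then show "P a b" using 3(2) by blast
    qed
    ultimately show ?case by simp
  qed auto
qed

lemma links_Cons: "links (ps # pss) x y \<longleftrightarrow> links [ps] x y \<or> links pss x y"
  by (auto simp: links_def)

lemma links_nth: "links pss x y \<longleftrightarrow> (\<exists>ps\<in>set pss. \<exists>i. Suc i < length ps \<and> ps ! i = x \<and> ps ! Suc i = y)"
proof
  assume "links pss x y"
  then obtain us vs where "us @ x # y # vs \<in> set pss" by (auto simp: links_def)
  then show "\<exists>ps\<in>set pss. \<exists>i. Suc i < length ps \<and> ps ! i = x \<and> ps ! Suc i = y"
    by (intro bexI[of _ "us @ x # y # vs"] exI[of _ "length us"]) (auto simp: nth_append)
next
  assume "\<exists>ps\<in>set pss. \<exists>i. Suc i < length ps \<and> ps ! i = x \<and> ps ! Suc i = y"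
  then obtain ps i where i: "ps \<in> set pss" "Suc i < length ps" "ps ! i = x" "ps ! Suc i = y" by blast
  then have "ps = take i ps @ x # y # drop (Suc (Suc i)) ps"
    by (metis Cons_nth_drop_Suc Suc_lessD append_take_drop_id)
  then show "links pss x y" using i(1) unfolding links_def by metis
qed

lemma links_in: "links pss x y \<Longrightarrow> x \<in> set (concat pss) \<and> y \<in> set (concat pss)"
  by (force simp: links_def)

lemma links_concat:
  assumes "links pss x y"
  obtains us vs where "concat pss = us @ x # y # vs"
proof -
  obtain us vs where "us @ x # y # vs \<in> set pss" using assms by (auto simp: links_def)
  then obtain as bs where "pss = as @ (us @ x # y # vs) # bs" by (meson split_list)
  then have "concat pss = (concat as @ us) @ x # y # (vs @ concat bs)" by simp
  then show ?thesis using that by blast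
qed

lemma links_neq: "distinct (concat pss) \<Longrightarrow> links pss x y \<Longrightarrow> x \<noteq> y"
  by (auto elim!: links_concat)

lemma fan_simple_graph:
  assumes "fan_layout n u pss"
  shows "simple_graph n (fan u pss)"
  using assms links_in[of pss] links_neq[of pss] unfolding simple_graph_def fan_layout_def fan_def
  by (auto simp del: set_concat)

lemma fan_outerplanar:
  assumes "fan_layout n u pss"
  shows "outerplanar n (fan u pss)"
proof (rule outerplanar_fan)
  \<comment> \<open>Writing all paths one after the other on the rim line puts linked vertices at
    consecutive integers.\<close>
  let ?pos = "\<lambda>v. length (takeWhile (\<lambda>x. x \<noteq> v) (concat pss))"
  have d: "distinct (concat pss)" "set (concat pss) = {..<n} - {u}"
    using assms by (auto simp: fan_layout_def simp del: set_concat)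
  show "simple_graph n (fan u pss)" using fan_simple_graph[OF assms] .
  show "u < n" using assms by (auto simp: fan_layout_def)
  have "concat pss ! ?pos v = v" if "v \<in> set (concat pss)" for v
  proof -
    obtain us vs where c: "concat pss = us @ v # vs" "v \<notin> set us" using split_list_first[OF \<open>v \<in> _\<close>] by blast
    then have "takeWhile (\<lambda>x. x \<noteq> v) (concat pss) = us"
      by (auto simp: takeWhile_append takeWhile_eq_all_conv)
    then show ?thesis by (simp add: c(1))
  qed
  then show "inj_on ?pos ({..<n} - {u})" unfolding d(2)[symmetric]
    by (rule inj_on_inverseI[of _ "(!) (concat pss)"])
  have "?pos y = Suc (?pos x)" if xy: "links pss x y" for x y
  proof -
    obtain us vs where c: "concat pss = us @ x # y # vs" using xy by (rule links_concat)
    have "x \<notin> set us" "y \<notin> set us" "x \<noteq> y" using d(1) unfolding c by auto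
    then have "takeWhile (\<lambda>z. z \<noteq> x) (concat pss) = us" "takeWhile (\<lambda>z. z \<noteq> y) (concat pss) = us @ [x]"
      unfolding c by (auto simp: takeWhile_append takeWhile_eq_all_conv)
    then show ?thesis by simp
  qed
  then show "i = u \<or> j = u \<or> ?pos j = Suc (?pos i) \<or> ?pos i = Suc (?pos j)" if "fan u pss i j" for i j
    using that unfolding fan_def by blast
qed

lemma mset_concat_cong: "mset pss = mset qss \<Longrightarrow> mset (concat pss) = mset (concat qss)"
  by (simp add: mset_concat flip: sum_mset_sum_list)

lemma fan_mset_cong:
  assumes "mset pss = mset qss"
  shows "fan u pss = fan u qss" "fan_layout n u pss = fan_layout n u qss"
proof -
  have s: "set pss = set qss" using assms by (rule mset_eq_setD)
  then show "fan u pss = fan u qss" by (intro ext) (simp add: fan_def links_def)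
  have "distinct (u # concat pss) = distinct (u # concat qss)"
    using mset_concat_cong[OF assms] by (intro mset_eq_imp_distinct_iff) simp
  then show "fan_layout n u pss = fan_layout n u qss"
    using s by (simp only: fan_layout_def set_simps set_concat)
qed

text \<open>Used to reorder the paths of a fan until their lengths come in a prescribed order, which
  does not change the fan.\<close>

lemma permute_to_map_eq:
  assumes "mset (map f xs) = mset ys"
  obtains zs where "mset zs = mset xs" "map f zs = ys"
proof -
  have "\<exists>zs. mset zs = mset xs \<and> map f zs = ys"
    using assms
  proof (induction ys arbitrary: xs)
    case (Cons y ys)
    then have "y \<in> set (map f xs)" by (metis list.set_intros(1) mset_eq_setD)
    then obtain x where x: "x \<in> set xs" "f x = y" by auto
    have "mset (map f (remove1 x xs)) = mset ys"
      using Cons.prems x by (simp add: image_mset_Diff)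
    then obtain zs where "mset zs = mset (remove1 x xs)" "map f zs = ys" using Cons.IH by blast
    then show ?case using x by (intro exI[of _ "x # zs"]) simp
  qed auto
  then show ?thesis using that by blast
qed

lemma relabelling_exists:
  assumes "distinct xs" "length xs = length ys"
  shows "\<exists>f. map f xs = ys"
  using assms(2,1)
proof (induction xs ys rule: list_induct2)
  case (Cons x xs y ys)
  then obtain f where "map f xs = ys" by auto
  then have "map (f(x := y)) (x # xs) = y # ys" using Cons.prems by auto
  then show ?case by (rule exI[of _ "f(x := y)"])
qed auto

lemma map_map_eq_if_concat_eq:
  assumes "map f (concat pss) = concat qss" "map length pss = map length qss"
  shows "map (map f) pss = qss"
proof (rule concat_injective)
  show "concat (map (map f) pss) = concat qss" using assms(1) by (simp add: map_concat)
  show "length (map (map f) pss) = length qss" using assms(2) by (metis length_map)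
  have "map length (map (map f) pss) = map length qss" using assms(2) by (simp add: comp_def)
  then have "length (map f (pss ! i)) = length (qss ! i)" if "i < length pss" "i < length qss" for i
    using that by (metis length_map nth_map)
  then show "\<forall>(x, y)\<in>set (zip (map (map f) pss) qss). length x = length y"
    by (auto simp: set_zip)
qed

lemma links_map:
  assumes "inj_on f (set (concat pss))" "x \<in> set (concat pss)" "y \<in> set (concat pss)"
  shows "links (map (map f) pss) (f x) (f y) \<longleftrightarrow> links pss x y"
proof
  assume "links pss x y"
  then obtain us vs where "us @ x # y # vs \<in> set pss" by (auto simp: links_def)
  then have "map f us @ f x # f y # map f vs \<in> set (map (map f) pss)"
    by (metis (no_types, lifting) image_eqI list.map(2) list.set_map map_append)
  then show "links (map (map f) pss) (f x) (f y)" by (auto simp: links_def)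
next
  assume "links (map (map f) pss) (f x) (f y)"
  then obtain us vs where "us @ f x # f y # vs \<in> map f ` set pss" by (auto simp: links_def)
  then obtain ps where *: "ps \<in> set pss" "map f ps = us @ f x # f y # vs" by (metis imageE)
  then obtain us' x' y' vs' where ps: "ps = us' @ x' # y' # vs'" "f x' = f x" "f y' = f y"
    by (auto simp: map_eq_append_conv map_eq_Cons_conv)
  then have "x' \<in> set (concat pss)" "y' \<in> set (concat pss)" using *(1) by force+
  then have "x' = x" "y' = y" using ps assms by (auto simp: inj_on_def simp del: set_concat)
  then show "links pss x y" using * ps by (auto simp: links_def)
qed

text \<open>List the hub first and then the paths one after the other. Since the path lengths agree,
  matching the two lists entry by entry carries each path to the corresponding path.\<close>

lemma fan_iso:
  assumes p: "fan_layout n u pss" and q: "fan_layout n v qss" and len: "map length pss = map length qss"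
  shows "graph_iso n (fan u pss) (fan v qss)"
proof -
  have "length (concat pss) = length (concat qss)" using len by (simp add: length_concat)
  then obtain f where f: "map f (u # concat pss) = v # concat qss"
    using relabelling_exists[of "u # concat pss" "v # concat qss"] p by (auto simp: fan_layout_def)
  then have fu: "f u = v" and fc: "map f (concat pss) = concat qss" by auto
  have qss: "map (map f) pss = qss" by (rule map_map_eq_if_concat_eq[OF fc len])
  have V: "set (u # concat pss) = {..<n}" "set (v # concat qss) = {..<n}"
    "distinct (u # concat pss)" "distinct (v # concat qss)"
    using p q by (auto simp: fan_layout_def)
  have inj: "inj_on f {..<n}" using V f by (metis distinct_map)
  have img: "f ` {..<n} = {..<n}" using V(1,2) f by (metis set_map)
  have "fan u pss i j \<longleftrightarrow> fan v qss (f i) (f j)" if "i < n" "j < n" for i j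
  proof -
    let ?S = "set (concat pss)"
    have S: "?S = {..<n} - {u}" using V(1,3) by (auto simp del: set_concat)
    have S': "set (concat qss) = {..<n} - {v}" using V(2,4) by (auto simp del: set_concat)
    have fS: "f x \<in> set (concat qss) \<longleftrightarrow> x \<in> ?S" if "x < n" for x
    proof (cases "x = u")
      case True
      then show ?thesis using V(3,4) fu by (simp del: set_concat)
    next
      case False
      then have "x \<in> ?S" using that unfolding S by simp
      moreover from this have "f x \<in> set (concat qss)" unfolding fc[symmetric] by (simp del: set_concat)
      ultimately show ?thesis by blast
    qed
    have eq: "f x = v \<longleftrightarrow> x = u" if "x < n" for x
      using that inj fu V(1) by (auto simp: inj_on_def simp del: set_concat)
    have "inj_on f ?S" using inj S by (auto intro: inj_on_subset)
    then have link: "links qss (f x) (f y) \<longleftrightarrow> links pss x y" if "x < n" "y < n" for x y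
    proof (cases "x \<in> ?S \<and> y \<in> ?S")
      case True
      then show ?thesis using links_map[OF \<open>inj_on f ?S\<close>, of x y] qss by simp
    next
      case False
      then show ?thesis using links_in[of pss x y] links_in[of qss "f x" "f y"] fS that by blast
    qed
    show ?thesis unfolding fan_def using eq link fS that by metis
  qed
  then show ?thesis unfolding graph_iso_def bij_betw_def using inj img by blast
qed

lemma fan_iso_mset:
  assumes "fan_layout n u pss" "fan_layout n v qss" "mset (map length pss) = mset (map length qss)"
  shows "graph_iso n (fan u pss) (fan v qss)"
proof -
  obtain pss' where "mset pss' = mset pss" "map length pss' = map length qss"
    using permute_to_map_eq[OF assms(3)] by blast
  then show ?thesis using fan_iso[of n u pss' v qss] fan_mset_cong[of pss' pss] assms by metis
qed

section \<open>The graphs of the statement as fans\<close>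

fun blocks :: "nat \<Rightarrow> nat list \<Rightarrow> nat list list" where
  "blocks s [] = []"
| "blocks s (a # ls) = [s..<s + a] # blocks (s + a) ls"

lemma concat_blocks: "concat (blocks s ls) = [s..<s + sum_list ls]"
proof (induction s ls rule: blocks.induct)
  case (2 s a ls)
  then show ?case using upt_add_eq_append[of s "s + a" "sum_list ls"] by (simp add: add.assoc)
qed simp

lemma length_blocks: "map length (blocks s ls) = ls"
  by (induction s ls rule: blocks.induct) auto

lemma block_starts_Nil: "block_starts [] = {0}"
  by (auto simp: block_starts_def)

lemma block_starts_range: "block_starts ls = range (\<lambda>k. sum_list (take k ls))"
  by (auto simp: block_starts_def)

lemma block_starts_Cons: "block_starts (a # ls) = insert 0 ((+) a ` block_starts ls)"
  unfolding block_starts_range by (subst UNIV_nat_eq) (simp add: image_image)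

lemma links_upt: "links [[m..<n]] i j \<longleftrightarrow> j = Suc i \<and> m \<le> i \<and> j < n"
proof
  show "links [[m..<n]] i j \<Longrightarrow> j = Suc i \<and> m \<le> i \<and> j < n" unfolding links_nth by auto
  assume "j = Suc i \<and> m \<le> i \<and> j < n"
  moreover from this have "Suc (i - m) < n - m" by linarith
  ultimately have "Suc (i - m) < length [m..<n] \<and> [m..<n] ! (i - m) = i \<and> [m..<n] ! Suc (i - m) = j" by simp
  then show "links [[m..<n]] i j" unfolding links_nth by (metis list.set_intros(1))
qed

lemma links_blocks:
  "links (blocks s ls) i j \<longleftrightarrow> j = Suc i \<and> s \<le> i \<and> j < s + sum_list ls \<and> j - s \<notin> block_starts ls"
proof (induction s ls rule: blocks.induct)
  case (1 s)
  then show ?case by (auto simp: links_def)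
next
  case (2 s a ls)
  have 0: "0 \<in> block_starts ls" by (cases ls) (auto simp: block_starts_Nil block_starts_Cons)
  have "links (blocks s (a # ls)) i j \<longleftrightarrow> (j = Suc i \<and> s \<le> i \<and> j < s + a) \<or> links (blocks (s + a) ls) i j"
    by (simp add: links_Cons[of "[s..<s + a]"] links_upt)
  also have "\<dots> \<longleftrightarrow> j = Suc i \<and> s \<le> i \<and> j < s + sum_list (a # ls) \<and> j - s \<notin> block_starts (a # ls)"
  proof (cases "j < s + a")
    case True
    then show ?thesis unfolding 2 block_starts_Cons by auto
  next
    case False
    have "j - s \<in> (+) a ` block_starts ls \<longleftrightarrow> j - (s + a) \<in> block_starts ls"
    proof -
      have "j - s = a + (j - (s + a))" using False by simp
      then show ?thesis by (auto simp: image_iff)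
    qed
    then show ?thesis unfolding 2 block_starts_Cons using False 0
      by (cases "j = s + a") auto
  qed
  finally show ?case .
qed

lemma paths_union_links: "paths_union ls i j \<longleftrightarrow> links (blocks 0 ls) i j \<or> links (blocks 0 ls) j i"
  by (auto simp: paths_union_def links_blocks)

lemma K1_join_paths_fan: "K1_join_paths ls = fan 0 (blocks 1 ls)"
proof (intro ext)
  fix i j
  show "K1_join_paths ls i j = fan 0 (blocks 1 ls) i j"
    unfolding K1_join_paths_def fan_def paths_union_links links_blocks concat_blocks by auto
qed

lemma K1_join_paths_layout: "0 \<notin> set ls \<Longrightarrow> fan_layout (Suc (sum_list ls)) 0 (blocks 1 ls)"
proof -
  assume "0 \<notin> set ls"
  then have "[] \<notin> set (blocks 1 ls)" by (metis length_blocks list.size(3) image_eqI set_map)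
  moreover have "set (0 # [1..<1 + sum_list ls]) = {..<Suc (sum_list ls)}" by auto
  moreover have "distinct (0 # [1..<1 + sum_list ls])" by (simp del: upt_Suc)
  ultimately show ?thesis unfolding fan_layout_def concat_blocks by blast
qed

text \<open>An embedding of the union of paths, read off block by block, is a list of disjoint
  paths; conversely, indexing into the concatenation of such a list gives back an embedding.\<close>

lemma contains_paths_iff:
  assumes sym: "symp G"
  shows "contains_subgraph n G (t * l) (paths_union (replicate t l)) \<longleftrightarrow>
    (\<exists>qss. length qss = t \<and> (\<forall>q\<in>set qss. length q = l \<and> successively G q) \<and> distinct (concat qss) \<and> set (concat qss) \<subseteq> {..<n})"
proof
  let ?B = "blocks 0 (replicate t l)"
  have sum: "sum_list (replicate t l) = t * l" by (simp add: sum_list_replicate)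
  have cB: "concat ?B = [0..<t * l]" unfolding concat_blocks sum by simp
  have lB: "map length ?B = replicate t l" by (rule length_blocks)
  {
    assume "contains_subgraph n G (t * l) (paths_union (replicate t l))"
    then obtain f where f: "inj_on f {..<t * l}" "f ` {..<t * l} \<subseteq> {..<n}"
      "\<And>i j. i < t * l \<Longrightarrow> j < t * l \<Longrightarrow> paths_union (replicate t l) i j \<Longrightarrow> G (f i) (f j)"
      unfolding contains_subgraph_def by blast
    have c: "concat (map (map f) ?B) = map f [0..<t * l]" by (simp add: cB flip: map_concat)
    show "\<exists>qss. length qss = t \<and> (\<forall>q\<in>set qss. length q = l \<and> successively G q) \<and> distinct (concat qss) \<and> set (concat qss) \<subseteq> {..<n}"
    proof (intro exI[of _ "map (map f) ?B"] conjI ballI)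
      show "length (map (map f) ?B) = t" using lB by (metis length_map length_replicate)
      show "distinct (concat (map (map f) ?B))" unfolding c using f(1)
        by (simp add: distinct_map atLeast0LessThan)
      show "set (concat (map (map f) ?B)) \<subseteq> {..<n}" unfolding c using f(2) by (auto simp: image_subset_iff)
      fix q assume "q \<in> set (map (map f) ?B)"
      then obtain b where b: "b \<in> set ?B" "q = map f b" by auto
      have "length b \<in> set (map length ?B)" using b(1) by simp
      then have "length b \<in> set (replicate t l)" unfolding lB .
      then show "length q = l" using b(2) by auto
      have "successively (\<lambda>x y. G (f x) (f y)) b"
        unfolding successively_iff_links
      proof (intro allI impI)
        fix x y assume "links [b] x y"
        then have "links ?B x y" using b(1) by (auto simp: links_def)
        then show "G (f x) (f y)" using links_in[of ?B x y] f(3)[of x y] unfolding cB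
          by (auto simp: paths_union_links)
      qed
      then show "successively G q" by (simp add: b(2) successively_map)
    qed
  }
  {
    assume "\<exists>qss. length qss = t \<and> (\<forall>q\<in>set qss. length q = l \<and> successively G q) \<and> distinct (concat qss) \<and> set (concat qss) \<subseteq> {..<n}"
    then obtain qss where q: "length qss = t" "\<And>q. q \<in> set qss \<Longrightarrow> length q = l" "\<And>q. q \<in> set qss \<Longrightarrow> successively G q"
      "distinct (concat qss)" "set (concat qss) \<subseteq> {..<n}" by blast
    have lq: "map length qss = replicate t l" using q(1,2) by (intro nth_equalityI) auto
    have len: "length (concat qss) = t * l" by (simp add: length_concat lq sum)
    define f where "f i = concat qss ! i" for i
    have mf: "map f [0..<t * l] = concat qss" unfolding f_def len[symmetric] by (rule map_nth)
    have B: "map (map f) ?B = qss"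
      by (rule map_map_eq_if_concat_eq) (simp_all add: cB mf lB lq)
    have inj: "inj_on f {..<t * l}" using q(4) len unfolding f_def by (auto intro!: inj_on_nth)
    have "G (f i) (f j)" if "paths_union (replicate t l) i j" for i j
    proof -
      have "G (f x) (f y)" if "links ?B x y" for x y
      proof -
        have "links qss (f x) (f y)"
          unfolding B[symmetric] by (subst links_map) (use that links_in[OF that] inj in \<open>auto simp: cB atLeast0LessThan\<close>)
        then obtain us vs where "us @ f x # f y # vs \<in> set qss" by (auto simp: links_def)
        from q(3)[OF this] show ?thesis by (simp add: successively_append_iff)
      qed
      then show ?thesis using that sym by (auto simp: paths_union_links dest: sympD)
    qed
    moreover have "f i < n" if "i < t * l" for i
    proof -
      have "concat qss ! i \<in> set (concat qss)" using len that by (intro nth_mem) simp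
      then show ?thesis using q(5) unfolding f_def by blast
    qed
    then have "f ` {..<t * l} \<subseteq> {..<n}" by blast
    ultimately show "contains_subgraph n G (t * l) (paths_union (replicate t l))"
      unfolding contains_subgraph_def using inj by blast
  }
qed

subsection \<open>Graphs without a theta subgraph\<close>

lemma three_elements:
  assumes "finite A" "3 \<le> card A"
  obtains x y z where "x \<in> A" "y \<in> A" "z \<in> A" "x \<noteq> y" "x \<noteq> z" "y \<noteq> z"
proof -
  obtain B where "B \<subseteq> A" "card B = 3" using obtain_subset_with_card_n[OF assms(2)] by metis
  then show ?thesis using that unfolding card_3_iff by (metis insert_subset)
qed

text \<open>Three common neighbours of two vertices already form a K(2,3).\<close>

lemma theta_common_neighbours:
  assumes "\<not> has_theta E" "symp E" "irreflp E" "a \<noteq> b" "finite A" "\<And>c. c \<in> A \<Longrightarrow> E a c \<and> E b c"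
  shows "card A \<le> 2"
proof (rule ccontr)
  assume "\<not> card A \<le> 2"
  then obtain x y z where *: "x \<in> A" "y \<in> A" "z \<in> A" "x \<noteq> y" "x \<noteq> z" "y \<noteq> z"
    using three_elements[OF assms(5)] by (metis not_less_eq_eq numeral_2_eq_2 numeral_3_eq_3)
  have e: "E a c" "E c b" "c \<noteq> a" "c \<noteq> b" if "c \<in> A" for c
    using assms that by (auto dest: sympD irreflpD)
  have "has_theta E"
    unfolding has_theta_def
    by (rule exI[of _ a], rule exI[of _ b], rule exI[of _ "[x]"], rule exI[of _ "[y]"], rule exI[of _ "[z]"])
      (use * e assms(4) in auto)
  then show False using assms(1) by blast
qed

text \<open>A triangle together with \<open>u\<close> is a K(4). On a longer cycle, two vertices
  \<open>a\<close> and \<open>c\<close> at distance two are joined by three disjoint paths: through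
  \<open>b\<close>, through \<open>u\<close>, and along the rest of the cycle.\<close>

lemma cycle_in_neighbourhood:
  assumes "symp E" "irreflp E"
    and cyc: "distinct xs" "3 \<le> length xs" "successively E xs" "E (last xs) (hd xs)"
    and u: "\<And>x. x \<in> set xs \<Longrightarrow> E u x"
  shows "has_theta E \<or> has_K4 E"
proof -
  have sym: "E y x" if "E x y" for x y using assms(1) that by (auto dest: sympD)
  have "u \<notin> set xs" using u assms(2) by (auto dest: irreflpD)
  obtain a b c rest where xs: "xs = a # b # c # rest"
    using cyc(2) by (cases xs rule: remdups_adj.cases; cases "tl (tl xs)"; auto simp: Suc_le_eq)
  show ?thesis
  proof (cases rest)
    case Nil
    then have "has_K4 E"
      unfolding has_K4_def using cyc u \<open>u \<notin> set xs\<close> sym xs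
      by (intro exI[of _ u] exI[of _ a] exI[of _ b] exI[of _ c]) auto
    then show ?thesis ..
  next
    case (Cons d rest')
    have flip: "(\<lambda>x y. E y x) = E" using sym by (auto intro!: ext)
    have "successively E ((c # rest) @ [a])"
      using cyc unfolding xs successively_append_iff by (simp add: Cons)
    then have "successively E (rev (c # rest @ [a]))"
      unfolding successively_rev flip by simp
    then have 1: "successively E (a # rev rest @ [c])" by simp
    have "has_theta E"
      unfolding has_theta_def
      by (rule exI[of _ a], rule exI[of _ c], rule exI[of _ "[b]"], rule exI[of _ "[u]"], rule exI[of _ "rev rest"])
        (use 1 cyc(1,3) u \<open>u \<notin> set xs\<close> sym xs Cons in auto)
    then show ?thesis ..
  qed
qed

section \<open>Connected sets, breadth-first layers and degeneracy\<close>

inductive grown :: "('a \<Rightarrow> 'a \<Rightarrow> bool) \<Rightarrow> 'a set \<Rightarrow> bool" for E where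
  single: "grown E {r}"
| insert: "grown E A \<Longrightarrow> a \<in> A \<Longrightarrow> E a x \<Longrightarrow> x \<notin> A \<Longrightarrow> grown E (insert x A)"

lemma grown_path:
  assumes "grown E A" "symp E" "a \<in> A" "b \<in> A"
  shows "\<exists>xs. xs \<noteq> [] \<and> distinct xs \<and> successively E xs \<and> hd xs = a \<and> last xs = b \<and> set xs \<subseteq> A"
  using assms(1,3,4)
proof (induction arbitrary: a b)
  case (single r)
  then show ?case by (intro exI[of _ "[r]"]) auto
next
  case (insert A c x)
  consider "a = x" "b = x" | "a = x" "b \<in> A" | "a \<in> A" "b = x" | "a \<in> A" "b \<in> A"
    using insert.prems by blast
  then show ?case
  proof cases
    case 1 then show ?thesis by (intro exI[of _ "[x]"]) auto
  next
    case 2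
    obtain xs where "xs \<noteq> []" "distinct xs" "successively E xs" "hd xs = c" "last xs = b" "set xs \<subseteq> A"
      using insert.IH[OF insert.hyps(2) 2(2)] by blast
    then show ?thesis using 2 insert.hyps(3,4) assms(2)
      by (intro exI[of _ "x # xs"]) (auto simp: successively_Cons dest: sympD)
  next
    case 3
    obtain xs where "xs \<noteq> []" "distinct xs" "successively E xs" "hd xs = a" "last xs = c" "set xs \<subseteq> A"
      using insert.IH[OF 3(1) insert.hyps(2)] by blast
    then show ?thesis using 3 insert.hyps(3,4)
      by (intro exI[of _ "xs @ [x]"]) (auto simp: successively_append_iff)
  next
    case 4
    then show ?thesis using insert.IH by blast
  qed
qed

text \<open>Take a path from \<open>a\<close> to \<open>b\<close> and go from \<open>c\<close>
  towards \<open>a\<close> until it is first met. The meeting vertex \<open>r\<close> splits the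
  path into the two other branches. The branches are listed without \<open>r\<close> and may be
  empty, as \<open>r\<close> may be one of the three vertices.\<close>

lemma grown_median:
  assumes "grown E A" "symp E" "a \<in> A" "b \<in> A" "c \<in> A"
  obtains r xs ys zs where "distinct (r # xs @ ys @ zs)" "set (r # xs @ ys @ zs) \<subseteq> A"
    "successively E (xs @ [r])" "hd (xs @ [r]) = a" "successively E (ys @ [r])" "hd (ys @ [r]) = b"
    "successively E (zs @ [r])" "hd (zs @ [r]) = c"
proof -
  have sym: "(\<lambda>x y. E y x) = E" using assms(2) by (auto dest: sympD intro!: ext)
  obtain P where P: "P \<noteq> []" "distinct P" "successively E P" "hd P = a" "last P = b" "set P \<subseteq> A"
    using grown_path[OF assms(1,2,3,4)] by blast
  obtain Q where Q: "Q \<noteq> []" "distinct Q" "successively E Q" "hd Q = c" "last Q = a" "set Q \<subseteq> A"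
    using grown_path[OF assms(1,2,5,3)] by blast
  have "\<exists>x\<in>set Q. x \<in> set P" using P Q by (metis hd_in_set last_in_set)
  then obtain zs r zs' where Q': "Q = zs @ r # zs'" "r \<in> set P" "\<forall>x\<in>set zs. x \<notin> set P"
    using split_list_first_prop[of Q "\<lambda>x. x \<in> set P"] by blast
  obtain xs ys where P': "P = xs @ r # ys" using Q'(2) by (meson split_list)
  have "successively E (rev (r # ys))" using P(3) unfolding P' successively_rev sym by (auto simp: successively_append_iff)
  then have "successively E (rev ys @ [r])" by simp
  moreover have "hd (rev ys @ [r]) = b" using P(5) unfolding P' by (cases ys) (auto simp: hd_append hd_rev)
  moreover have "successively E (xs @ [r])" "hd (xs @ [r]) = a"
    using P(3,4) unfolding P' by (auto simp: successively_append_iff hd_append)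
  moreover have "successively E (zs @ [r])" "hd (zs @ [r]) = c"
    using Q(3,4) unfolding Q' by (auto simp: successively_append_iff hd_append)
  moreover have "distinct (r # xs @ rev ys @ zs)" "set (r # xs @ rev ys @ zs) \<subseteq> A"
    using P(2,6) Q(2,6) Q'(3) unfolding P' Q'(1) by auto
  ultimately show ?thesis using that by blast
qed

text \<open>If the connected set \<open>A\<close> were contracted to a point, the elements of
  \<open>Y\<close> would be common neighbours of that point and \<open>v\<close>. Without
  contraction, a median of three attachment vertices in \<open>A\<close> takes the role of the
  point, and the elements of \<open>Y\<close> keep the three paths non-trivial.\<close>

lemma theta_layer:
  assumes "\<not> has_theta E" "symp E" "grown E A" "v \<notin> A" "finite Y" "Y \<inter> A = {}" "v \<notin> Y"
    and Y: "\<And>y. y \<in> Y \<Longrightarrow> E v y \<and> (\<exists>a\<in>A. E a y)"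
  shows "card Y \<le> 2"
proof (rule ccontr)
  assume "\<not> card Y \<le> 2"
  then obtain x y z where *: "x \<in> Y" "y \<in> Y" "z \<in> Y" "x \<noteq> y" "x \<noteq> z" "y \<noteq> z"
    using three_elements[OF assms(5)] by (metis not_less_eq_eq numeral_2_eq_2 numeral_3_eq_3)
  obtain a b c where abc: "a \<in> A" "b \<in> A" "c \<in> A" "E x a" "E y b" "E z c"
    using Y * assms(2) by (metis sympD)
  obtain r xs ys zs where m: "distinct (r # xs @ ys @ zs)" "set (r # xs @ ys @ zs) \<subseteq> A"
    "successively E (xs @ [r])" "hd (xs @ [r]) = a" "successively E (ys @ [r])" "hd (ys @ [r]) = b"
    "successively E (zs @ [r])" "hd (zs @ [r]) = c"
    using grown_median[OF assms(3,2) abc(1-3)] by blast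
  have "has_theta E"
    unfolding has_theta_def
  proof (intro exI conjI)
    show "distinct (v # r # (x # xs) @ (y # ys) @ (z # zs))" using m(1,2) * assms(4,6,7) by auto
    show "\<forall>ws\<in>{x # xs, y # ys, z # zs}. successively E (v # ws @ [r])"
      using m * abc Y by (auto simp: successively_Cons)
  qed auto
  then show False using assms(1) by blast
qed

lemma grown_Un:
  assumes "finite Y" "grown E A" "\<And>y. y \<in> Y \<Longrightarrow> \<exists>a\<in>A. E a y"
  shows "grown E (A \<union> Y)"
  using assms(1,3)
proof (induction Y)
  case empty then show ?case using assms(2) by simp
next
  case (insert y Y)
  then have "grown E (A \<union> Y)" by simp
  obtain a where "a \<in> A" "E a y" using insert.prems by blast
  then show ?case using grown.insert[OF \<open>grown E (A \<union> Y)\<close>, of a y] \<open>grown E (A \<union> Y)\<close>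
    by (cases "y \<in> A") (auto simp: insert_absorb insert.hyps)
qed

fun reach :: "('a \<Rightarrow> 'a \<Rightarrow> bool) \<Rightarrow> 'a set \<Rightarrow> 'a \<Rightarrow> nat \<Rightarrow> 'a set" where
  "reach E S r 0 = {r}"
| "reach E S r (Suc k) = reach E S r k \<union> {y \<in> S. \<exists>x \<in> reach E S r k. E x y}"

lemma reach_subset: "r \<in> S \<Longrightarrow> reach E S r k \<subseteq> S"
  by (induction k) auto

lemma grown_reach: "finite S \<Longrightarrow> grown E (reach E S r k)"
  by (induction k) (auto intro: grown.single intro!: grown_Un)

text \<open>A vertex of the last breadth-first layer has at most two neighbours in each of the
  last two layers.\<close>
lemma theta_degenerate:
  assumes "\<not> has_theta E" "symp E" "irreflp E" "finite S" "S \<noteq> {}"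
  obtains v where "v \<in> S" "card {y \<in> S. E v y} \<le> 4"
proof -
  obtain r where r: "r \<in> S" using assms(5) by blast
  let ?B = "reach E S r"
  have sub: "?B k \<subseteq> S" for k using reach_subset[OF r] .
  have fin: "finite (?B k)" for k using sub assms(4) by (meson finite_subset)
  have "\<exists>k. ?B (Suc k) = ?B k"
  proof (rule ccontr)
    assume "\<not> ?thesis"
    then have lt: "card (?B k) < card (?B (Suc k))" for k
      using fin[of "Suc k"] by (intro psubset_card_mono) auto
    have "k \<le> card (?B k)" for k 
    proof (induction k)
      case (Suc k)
      then show ?case using lt[of k] by linarith
    qed simp
    then have "Suc (card S) \<le> card (?B (Suc (card S)))" .
    also have "\<dots> \<le> card S" using sub assms(4) by (rule card_mono[rotated])
    finally show False by simp
  qed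
  define k where "k = (LEAST k. ?B (Suc k) = ?B k)"
  have k: "?B (Suc k) = ?B k" using LeastI_ex[OF \<open>\<exists>k. _\<close>] by (simp only: k_def)
  have min: "?B (Suc j) \<noteq> ?B j" if "j < k" for j using not_less_Least that unfolding k_def by blast
  have nb: "y \<in> ?B k" if "v \<in> ?B k" "y \<in> S" "E v y" for v y using k that by auto
  show ?thesis
  proof (cases k)
    case 0
    have "{y \<in> S. E r y} = {}" using nb[of r] assms(3) 0 by (auto dest: irreflpD)
    then show ?thesis using that[OF r] by (metis card.empty zero_le)
  next
    case (Suc m)
    obtain v where v: "v \<in> ?B k" "v \<notin> ?B m" using min[of m] Suc by auto
    have vS: "v \<in> S" using v sub by blast
    have sym: "E y x" if "E x y" for x y using that assms(2) by (auto dest: sympD)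
    have irr: "\<not> E x x" for x using assms(3) by (auto dest: irreflpD)
    let ?Y = "{y \<in> S. E v y} - ?B m" and ?Z = "{y \<in> S. E v y} \<inter> ?B m"
    have "card ?Y \<le> 2"
    proof (rule theta_layer[OF assms(1,2) grown_reach[OF assms(4)] v(2)])
      show "E v y \<and> (\<exists>a\<in>?B m. E a y)" if "y \<in> ?Y" for y
      proof -
        have "y \<in> ?B k" using nb[OF v(1)] that by blast
        then show ?thesis using that by (auto simp: Suc)
      qed
    qed (use assms(4) irr in auto)
    moreover have "card ?Z \<le> 2"
    proof (cases m)
      case 0
      then have "?Z \<subseteq> {r}" by auto
      then have "card ?Z \<le> card {r}" by (intro card_mono) auto
      then show ?thesis by simp
    next
      case (Suc m')
      \<comment> \<open>A neighbour of \<open>v\<close> in the ball of radius \<open>m'\<close>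
        would put \<open>v\<close> into the next ball. So these neighbours form a layer on top of
        that ball.\<close>
      have "y \<notin> ?B m'" if "y \<in> ?Z" for y
        using v(2) that sym vS Suc by auto
      moreover have "v \<notin> ?B m'" using v(2) Suc by auto
      ultimately show ?thesis
        by (intro theta_layer[OF assms(1,2) grown_reach[OF assms(4), of E r m']]) (use assms(4) irr Suc in auto)
    qed
    moreover have "card {y \<in> S. E v y} \<le> card ?Y + card ?Z"
      by (rule order_trans[OF _ card_Un_le]) (use assms(4) in \<open>auto intro!: card_mono\<close>)
    ultimately show ?thesis using that[OF vS] by linarith
  qed
qed

text \<open>Deleting a vertex with at most 4 neighbours lowers the degree sum by at most 8, since
  each lost edge is counted at both ends.\<close>

lemma theta_degree_sum:
  assumes "\<not> has_theta E" "symp E" "irreflp E" "finite S"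
  shows "(\<Sum>v\<in>S. card {y \<in> S. E v y}) \<le> 8 * card S"
  using assms(4)
proof (induction "card S" arbitrary: S)
  case 0
  then show ?case by simp
next
  case (Suc n)
  then have "S \<noteq> {}" by auto
  then obtain v where v: "v \<in> S" "card {y \<in> S. E v y} \<le> 4"
    using theta_degenerate[OF assms(1-3) \<open>finite S\<close>] by metis
  define T where "T = S - {v}"
  have T: "finite T" "v \<notin> T" "S = insert v T" using v Suc by (auto simp: T_def)
  have "card T = n" using Suc.hyps(2) T by simp
  then have IH: "(\<Sum>x\<in>T. card {y \<in> T. E x y}) \<le> 8 * card T" using Suc.hyps(1)[of T] T(1) by simp
  have "card {y \<in> S. E x y} = card {y \<in> T. E x y} + (if E x v then 1 else 0)" for x
  proof -
    have "{y \<in> S. E x y} = {y \<in> T. E x y} \<union> (if E x v then {v} else {})" using T by auto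
    then show ?thesis using T by (simp add: card_insert_disjoint)
  qed
  then have "(\<Sum>x\<in>T. card {y \<in> S. E x y}) = (\<Sum>x\<in>T. card {y \<in> T. E x y}) + (\<Sum>x\<in>T. if E x v then 1 else 0)"
    by (simp add: sum.distrib)
  also have "(\<Sum>x\<in>T. if E x v then 1 else 0) = card {x \<in> T. E x v}"
    using T by (simp flip: sum.inter_filter)
  also have "{x \<in> T. E x v} \<subseteq> {y \<in> S. E v y}" using T assms(2) by (auto dest: sympD)
  then have "card {x \<in> T. E x v} \<le> card {y \<in> S. E v y}" using Suc.prems by (intro card_mono) auto
  then have "card {x \<in> T. E x v} \<le> 4" using v(2) by linarith
  finally have "(\<Sum>x\<in>T. card {y \<in> S. E x y}) \<le> 8 * card T + 4" using IH by linarith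
  then show ?case using T v(2) by simp
qed

subsection \<open>The spectral radius as a maximal Rayleigh quotient\<close>

lemma finite_nbrs: "simple_graph n E \<Longrightarrow> finite {j. E i j}"
  by (rule finite_subset[of _ "{..<n}"]) (auto simp: simple_graph_def)

text \<open>An entry of the product of the adjacency matrix with \<open>x\<close>; accordingly
  \<open>adj_form\<close> is the quadratic form of the adjacency matrix.\<close>

definition nbr_sum :: "('a \<Rightarrow> 'a \<Rightarrow> bool) \<Rightarrow> ('a \<Rightarrow> real) \<Rightarrow> 'a \<Rightarrow> real" where
  "nbr_sum E x i = (\<Sum>j | E i j. x j)"

definition adj_form :: "nat \<Rightarrow> (nat \<Rightarrow> nat \<Rightarrow> bool) \<Rightarrow> (nat \<Rightarrow> real) \<Rightarrow> real" where
  "adj_form n E x = (\<Sum>i<n. x i * nbr_sum E x i)"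

lemma nbr_sum_eq:
  assumes "simple_graph n E"
  shows "nbr_sum E x i = (\<Sum>j<n. if E i j then x j else 0)"
proof -
  have "{j. E i j} = {j\<in>{..<n}. E i j}" using assms by (auto simp: simple_graph_def)
  then show ?thesis unfolding nbr_sum_def by (simp only: sum.inter_filter finite_lessThan)
qed

lemma adj_bilinear_sym:
  assumes "simple_graph n E"
  shows "(\<Sum>i<n. x i * nbr_sum E y i) = (\<Sum>i<n. y i * nbr_sum E x i)"
proof -
  have "(\<Sum>i<n. x i * nbr_sum E y i) = (\<Sum>i<n. \<Sum>j<n. if E i j then x i * y j else 0)"
    unfolding nbr_sum_eq[OF assms] sum_distrib_left by (intro sum.cong) auto
  also have "\<dots> = (\<Sum>j<n. \<Sum>i<n. if E i j then x i * y j else 0)" by (rule sum.swap)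
  also have "\<dots> = (\<Sum>j<n. \<Sum>i<n. if E j i then y j * x i else 0)"
    using assms by (intro sum.cong) (auto simp: simple_graph_def)
  also have "\<dots> = (\<Sum>i<n. y i * nbr_sum E x i)"
    unfolding nbr_sum_eq[OF assms] sum_distrib_left by (intro sum.cong) auto
  finally show ?thesis .
qed

lemma nbr_sum_cong: "simple_graph n E \<Longrightarrow> (\<And>j. j < n \<Longrightarrow> x j = y j) \<Longrightarrow> nbr_sum E x i = nbr_sum E y i"
  by (auto simp: nbr_sum_eq intro!: sum.cong)

lemma adj_form_mono:
  assumes "simple_graph n E"
  shows "adj_form n E x \<le> adj_form n E (\<lambda>i. \<bar>x i\<bar>)"
proof -
  have "x i * nbr_sum E x i \<le> \<bar>x i\<bar> * nbr_sum E (\<lambda>i. \<bar>x i\<bar>) i" for i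
  proof -
    have "x i * nbr_sum E x i \<le> \<bar>x i\<bar> * \<bar>nbr_sum E x i\<bar>" by (metis abs_ge_self abs_mult)
    also have "\<dots> \<le> \<bar>x i\<bar> * nbr_sum E (\<lambda>i. \<bar>x i\<bar>) i"
      unfolding nbr_sum_def by (intro mult_left_mono sum_abs) auto
    finally show ?thesis .
  qed
  then show ?thesis unfolding adj_form_def by (rule sum_mono)
qed

text \<open>First-order condition: vary a single coordinate of the maximiser.\<close>
lemma rayleigh_maximiser:
  assumes E: "simple_graph n E" and le: "\<And>y. adj_form n E y \<le> \<mu> * (\<Sum>i<n. (y i)\<^sup>2)"
    and eq: "adj_form n E x = \<mu> * (\<Sum>i<n. (x i)\<^sup>2)" and "k < n"
  shows "nbr_sum E x k = \<mu> * x k"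
proof -
  define e :: "nat \<Rightarrow> real" where "e i = (if i = k then 1 else 0)" for i
  have nbr: "nbr_sum E (\<lambda>i. x i + t * e i) i = nbr_sum E x i + t * nbr_sum E e i" for t i
    unfolding nbr_sum_def by (simp add: sum.distrib sum_distrib_left)
  have e_sum: "(\<Sum>i<n. e i * f i) = f k" for f
    using \<open>k < n\<close> by (simp add: e_def if_distrib[of "\<lambda>a. a * _"] cong: if_cong)
  have ekk: "nbr_sum E e k = 0"
    unfolding nbr_sum_def e_def using E by (intro sum.neutral) (auto simp: simple_graph_def)
  have form: "adj_form n E (\<lambda>i. x i + t * e i) = adj_form n E x + 2 * t * nbr_sum E x k" for t
  proof -
    have "adj_form n E (\<lambda>i. x i + t * e i) = (\<Sum>i<n. x i * nbr_sum E x i) + t * (\<Sum>i<n. x i * nbr_sum E e i)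
      + t * (\<Sum>i<n. e i * nbr_sum E x i) + t\<^sup>2 * (\<Sum>i<n. e i * nbr_sum E e i)"
      unfolding adj_form_def nbr sum_distrib_left sum.distrib[symmetric]
      by (intro sum.cong) (auto simp: algebra_simps power2_eq_square)
    also have "(\<Sum>i<n. x i * nbr_sum E e i) = nbr_sum E x k"
      using adj_bilinear_sym[OF E, of x e] e_sum by simp
    finally show ?thesis by (simp add: adj_form_def e_sum ekk)
  qed
  have norm: "(\<Sum>i<n. (x i + t * e i)\<^sup>2) = (\<Sum>i<n. (x i)\<^sup>2) + 2 * t * x k + t\<^sup>2" for t
  proof -
    have "(\<Sum>i<n. (x i + t * e i)\<^sup>2) = (\<Sum>i<n. (x i)\<^sup>2) + 2 * t * (\<Sum>i<n. e i * x i) + t\<^sup>2 * (\<Sum>i<n. e i * e i)"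
      unfolding sum_distrib_left sum.distrib[symmetric]
      by (intro sum.cong) (auto simp: algebra_simps power2_eq_square)
    then show ?thesis by (simp add: e_sum) (simp add: e_def)
  qed
  define d where "d = nbr_sum E x k - \<mu> * x k"
  have *: "2 * t * d \<le> \<mu> * t\<^sup>2" for t
    using le[of "\<lambda>i. x i + t * e i"] unfolding form norm eq d_def by (simp add: algebra_simps)
  have "d = 0"
  proof (rule ccontr)
    assume "d \<noteq> 0"
    \<comment> \<open>With this \<open>t\<close> the first-order gain is twice the bound on the
      second-order term, which leaves only \<open>d = 0\<close>.\<close>
    define t where "t = d / (\<bar>\<mu>\<bar> + 1)"
    have "2 * t * d = 2 * d\<^sup>2 / (\<bar>\<mu>\<bar> + 1)" by (simp add: t_def power2_eq_square)
    moreover have "\<mu> * t\<^sup>2 \<le> (\<bar>\<mu>\<bar> + 1) * t\<^sup>2" by (intro mult_right_mono) auto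
    moreover have "(\<bar>\<mu>\<bar> + 1) * t\<^sup>2 = d\<^sup>2 / (\<bar>\<mu>\<bar> + 1)" by (simp add: t_def power2_eq_square)
    ultimately have "2 * d\<^sup>2 / (\<bar>\<mu>\<bar> + 1) \<le> d\<^sup>2 / (\<bar>\<mu>\<bar> + 1)" using *[of t] by linarith
    then have "d\<^sup>2 \<le> 0" by (simp add: divide_le_cancel)
    then show False using \<open>d \<noteq> 0\<close> by simp
  qed
  then show ?thesis by (simp add: d_def)
qed

text \<open>Vectors are functions on all naturals, so compactness comes from Tychonoff's theorem for
  an infinite cube. The coordinates from \<open>n\<close> on do not influence the form; setting them
  to 0 and rescaling moves any \<open>y\<close> with non-zero norm into the compact set
  \<open>K\<close>.\<close>

lemma rayleigh_attained:
  assumes E: "simple_graph n E" and "0 < n"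
  obtains \<mu> x where "\<And>y. adj_form n E y \<le> \<mu> * (\<Sum>i<n. (y i)\<^sup>2)"
    "adj_form n E x = \<mu> * (\<Sum>i<n. (x i)\<^sup>2)" "(\<Sum>i<n. (x i)\<^sup>2) = 1"
proof -
  define B :: "(nat \<Rightarrow> real) set" where "B = (\<Pi>\<^sub>E i\<in>UNIV. {-1..1})"
  define K where "K = B \<inter> {x. (\<Sum>i<n. (x i)\<^sup>2) = 1}"
  have cont: "continuous_on UNIV (\<lambda>x. x i)" for i :: nat
    by (intro continuous_on_product_coordinates)
  have "compact B"
  proof -
    have "compactin (product_topology (\<lambda>i::nat. euclidean) UNIV) (PiE UNIV (\<lambda>i. {-1..1::real}))"
      unfolding compactin_PiE by auto
    then show ?thesis by (simp add: B_def euclidean_product_topology compactin_euclidean_iff)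
  qed
  moreover have "closed {x :: nat \<Rightarrow> real. (\<Sum>i<n. (x i)\<^sup>2) = 1}"
    by (intro closed_Collect_eq continuous_intros cont)
  ultimately have "compact K" unfolding K_def by (rule compact_Int_closed)
  moreover have "(\<lambda>i. if i = 0 then 1 else 0) \<in> K"
    using \<open>0 < n\<close> by (auto simp: K_def B_def PiE_def if_distrib[of "\<lambda>a. a\<^sup>2"] cong: if_cong)
  then have "K \<noteq> {}" by blast
  moreover have "continuous_on K (adj_form n E)"
    unfolding adj_form_def nbr_sum_def
    by (rule continuous_on_subset[of UNIV]) (intro continuous_intros cont, simp)
  ultimately obtain x where x: "x \<in> K" "\<And>y. y \<in> K \<Longrightarrow> adj_form n E y \<le> adj_form n E x"
    using continuous_attains_sup by metis
  have le: "adj_form n E y \<le> adj_form n E x * (\<Sum>i<n. (y i)\<^sup>2)" for y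
  proof (cases "(\<Sum>i<n. (y i)\<^sup>2) = 0")
    case True
    then have "y i = 0" if "i < n" for i using that by (simp add: sum_nonneg_eq_0_iff)
    then show ?thesis using True by (simp add: adj_form_def)
  next
    case False
    define s where "s = sqrt (\<Sum>i<n. (y i)\<^sup>2)"
    have "0 \<le> (\<Sum>i<n. (y i)\<^sup>2)" by (intro sum_nonneg) auto
    then have s: "s\<^sup>2 = (\<Sum>i<n. (y i)\<^sup>2)" "0 < s" using False by (auto simp: s_def)
    define z where "z i = (if i < n then y i / s else 0)" for i
    have zs: "(\<Sum>i<n. (z i)\<^sup>2) = 1"
    proof -
      have "(\<Sum>i<n. (z i)\<^sup>2) = (\<Sum>i<n. (y i)\<^sup>2) / s\<^sup>2"
        unfolding sum_divide_distrib by (intro sum.cong) (auto simp: z_def power_divide)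
      then show ?thesis using s False by simp
    qed
    have "\<bar>z i\<bar> \<le> 1" for i
    proof (cases "i < n")
      case True
      then have "(z i)\<^sup>2 \<le> (\<Sum>i<n. (z i)\<^sup>2)" by (intro member_le_sum) auto
      then show ?thesis unfolding zs by (simp add: abs_square_le_1)
    qed (simp add: z_def)
    then have "z \<in> K" using zs by (auto simp: K_def B_def PiE_def abs_le_iff minus_le_iff)
    then have "adj_form n E z \<le> adj_form n E x" by (rule x(2))
    moreover have "adj_form n E z = adj_form n E y / s\<^sup>2"
    proof -
      have "nbr_sum E z i = nbr_sum E (\<lambda>j. y j / s) i" for i
        by (rule nbr_sum_cong[OF E]) (simp add: z_def)
      then have "nbr_sum E z i = nbr_sum E y i / s" for i by (simp add: nbr_sum_def sum_divide_distrib)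
      then show ?thesis unfolding adj_form_def sum_divide_distrib
        by (intro sum.cong) (auto simp: z_def power2_eq_square)
    qed
    ultimately have "adj_form n E y \<le> adj_form n E x * s\<^sup>2" using s(2) by (simp add: pos_divide_le_eq)
    then show ?thesis unfolding s(1) .
  qed
  have "(\<Sum>i<n. (x i)\<^sup>2) = 1" using x(1) by (simp add: K_def)
  then show ?thesis using that[OF le, of x] by simp
qed

lemma adj_mat_mult:
  assumes "simple_graph n E" "v \<in> carrier_vec n" "i < n"
  shows "(adj_mat n E *\<^sub>v v) $ i = nbr_sum E (\<lambda>j. v $ j) i"
proof -
  have "(adj_mat n E *\<^sub>v v) $ i = (\<Sum>j = 0..<n. (if E i j then 1 else 0) * v $ j)"
    using assms by (simp add: adj_mat_def scalar_prod_def row_def)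
  also have "\<dots> = nbr_sum E (\<lambda>j. v $ j) i"
    unfolding nbr_sum_eq[OF assms(1)] atLeast0LessThan by (intro sum.cong) auto
  finally show ?thesis .
qed

lemma eigenvalue_adj_mat:
  assumes E: "simple_graph n E"
  shows "eigenvalue (adj_mat n E) \<mu> \<longleftrightarrow>
    (\<exists>x. (\<exists>i<n. x i \<noteq> 0) \<and> (\<forall>i<n. nbr_sum E x i = \<mu> * x i))"
proof
  have dim: "dim_row (adj_mat n E) = n" by (simp add: adj_mat_def)
  {
    assume "eigenvalue (adj_mat n E) \<mu>"
    then obtain v where v: "v \<in> carrier_vec n" "v \<noteq> 0\<^sub>v n" "adj_mat n E *\<^sub>v v = \<mu> \<cdot>\<^sub>v v"
      unfolding eigenvalue_def eigenvector_def dim by blast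
    have "\<exists>i<n. v $ i \<noteq> 0" using v(1,2) by (metis carrier_vecD eq_vecI index_zero_vec)
    moreover have "nbr_sum E (\<lambda>j. v $ j) i = \<mu> * v $ i" if "i < n" for i
      using adj_mat_mult[OF E v(1) that] v that by simp
    ultimately show "\<exists>x. (\<exists>i<n. x i \<noteq> 0) \<and> (\<forall>i<n. nbr_sum E x i = \<mu> * x i)" by blast
  }
  assume "\<exists>x. (\<exists>i<n. x i \<noteq> 0) \<and> (\<forall>i<n. nbr_sum E x i = \<mu> * x i)"
  then obtain x k where x: "k < n" "x k \<noteq> 0" "\<And>i. i < n \<Longrightarrow> nbr_sum E x i = \<mu> * x i" by blast
  let ?v = "vec n x"
  have "nbr_sum E (\<lambda>j. ?v $ j) i = nbr_sum E x i" for i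
    by (rule nbr_sum_cong[OF E]) simp
  then have "adj_mat n E *\<^sub>v ?v = \<mu> \<cdot>\<^sub>v ?v"
    using adj_mat_mult[OF E, of ?v] x(3) by (intro eq_vecI) (simp_all add: dim)
  moreover have "?v \<noteq> 0\<^sub>v n" using x(1,2) by (metis index_vec index_zero_vec(1))
  ultimately show "eigenvalue (adj_mat n E) \<mu>"
    unfolding eigenvalue_def eigenvector_def dim by (metis vec_carrier)
qed

lemma eigenvalue_le:
  assumes E: "simple_graph n E" and le: "\<And>y. adj_form n E y \<le> \<mu> * (\<Sum>i<n. (y i)\<^sup>2)"
    and "eigenvalue (adj_mat n E) \<nu>"
  shows "\<nu> \<le> \<mu>"
proof -
  obtain x k where x: "k < n" "x k \<noteq> 0" "\<And>i. i < n \<Longrightarrow> nbr_sum E x i = \<nu> * x i"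
    using assms(3) unfolding eigenvalue_adj_mat[OF E] by blast
  have "adj_form n E x = (\<Sum>i<n. \<nu> * (x i)\<^sup>2)"
    unfolding adj_form_def by (intro sum.cong) (auto simp: x(3) power2_eq_square)
  also have "\<dots> = \<nu> * (\<Sum>i<n. (x i)\<^sup>2)" by (simp add: sum_distrib_left)
  finally have "\<nu> * (\<Sum>i<n. (x i)\<^sup>2) \<le> \<mu> * (\<Sum>i<n. (x i)\<^sup>2)" using le[of x] by simp
  moreover have "0 < (\<Sum>i<n. (x i)\<^sup>2)" using x(1,2) by (intro sum_pos2[of _ k]) auto
  ultimately show ?thesis by (simp add: mult_le_cancel_right)
qed

text \<open>Taking absolute values does not decrease the form, so some maximiser is non-negative,
  and the first-order condition makes it an eigenvector. No eigenvalue exceeds the maximal quotient,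
  and the spectrum is finite, being the root set of the characteristic polynomial, so the
  \<open>Max\<close> in the definition is that quotient.\<close>

lemma spectral_radius_rayleigh:
  assumes E: "simple_graph n E" and "0 < n"
  shows "adj_form n E y \<le> spectral_radius_graph n E * (\<Sum>i<n. (y i)\<^sup>2)"
    and "\<exists>x. (\<Sum>i<n. (x i)\<^sup>2) = 1 \<and> (\<forall>i. 0 \<le> x i) \<and> (\<forall>i<n. nbr_sum E x i = spectral_radius_graph n E * x i)"
proof -
  obtain \<mu> x where le: "\<And>y. adj_form n E y \<le> \<mu> * (\<Sum>i<n. (y i)\<^sup>2)"
    and x: "adj_form n E x = \<mu> * (\<Sum>i<n. (x i)\<^sup>2)" "(\<Sum>i<n. (x i)\<^sup>2) = 1"
    using rayleigh_attained[OF assms] by metis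
  define z where "z = (\<lambda>i. \<bar>x i\<bar>)"
  have z1: "(\<Sum>i<n. (z i)\<^sup>2) = 1" using x(2) by (simp add: z_def)
  have "\<mu> \<le> adj_form n E z" using adj_form_mono[OF E, of x] x by (simp add: z_def)
  then have "adj_form n E z = \<mu> * (\<Sum>i<n. (z i)\<^sup>2)" using le[of z] z1 by simp
  then have eig: "nbr_sum E z i = \<mu> * z i" if "i < n" for i
    by (rule rayleigh_maximiser[OF E le _ that])
  have "\<exists>i<n. z i \<noteq> 0" using z1 by (metis (mono_tags, lifting) lessThan_iff power2_eq_square mult_zero_left sum.neutral zero_neq_one)
  then have "eigenvalue (adj_mat n E) \<mu>" unfolding eigenvalue_adj_mat[OF E] using eig by blast
  moreover have "finite {\<nu>. eigenvalue (adj_mat n E) \<nu>}"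
  proof -
    have c: "adj_mat n E \<in> carrier_mat n n" by (simp add: adj_mat_def)
    have "char_poly (adj_mat n E) \<noteq> 0" using degree_monic_char_poly[OF c] by auto
    then show ?thesis unfolding eigenvalue_root_char_poly[OF c] by (rule poly_roots_finite)
  qed
  ultimately have "spectral_radius_graph n E = \<mu>"
    unfolding spectral_radius_graph_def using eigenvalue_le[OF E le] by (intro Max_eqI) auto
  moreover have "\<forall>i. 0 \<le> z i" by (simp add: z_def)
  ultimately show "adj_form n E y \<le> spectral_radius_graph n E * (\<Sum>i<n. (y i)\<^sup>2)"
    "\<exists>x. (\<Sum>i<n. (x i)\<^sup>2) = 1 \<and> (\<forall>i. 0 \<le> x i) \<and> (\<forall>i<n. nbr_sum E x i = spectral_radius_graph n E * x i)"
    using le z1 eig by blast+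
qed

subsection \<open>The concave gap function of a path\<close>

text \<open>The deficit of a path on \<open>m\<close> vertices. For hub weight 1 and eigenvalue
  \<open>q + 1 / q\<close>, its vertices would weigh \<open>1 / (q + 1 / q - 2)\<close> each if the
  path had no ends; the two ends lower the total by a multiple of \<open>path_gap q m\<close> whose
  factor does not depend on \<open>m\<close>, as computed in \<open>path_vec_sum\<close>.\<close>

definition path_gap :: "real \<Rightarrow> nat \<Rightarrow> real" where
  "path_gap q m = (1 - q ^ m) / (1 + q ^ Suc m)"

definition path_gap_step :: "real \<Rightarrow> nat \<Rightarrow> real" where
  "path_gap_step q k = (1 - q\<^sup>2) * q ^ k / ((1 + q ^ Suc k) * (1 + q ^ Suc (Suc k)))"

lemma path_gap_Suc:
  assumes "0 < q"
  shows "path_gap q (Suc m) = path_gap q m + path_gap_step q m"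
proof -
  have "0 < q ^ m" using assms by simp
  then have *: "1 + q * q ^ m \<noteq> 0" "1 + q * (q * q ^ m) \<noteq> 0" using assms
    by (smt (verit) mult_pos_pos)+
  define p where "p = q ^ m"
  define A where "A = 1 + q * p"
  define B where "B = 1 + q * (q * p)"
  have AB: "A \<noteq> 0" "B \<noteq> 0" using * by (simp_all add: A_def B_def p_def)
  have "(1 - p) * B + (1 - q\<^sup>2) * p = (1 - q * p) * A"
    by (simp add: A_def B_def algebra_simps power2_eq_square)
  moreover have "(1 - p) / A + (1 - q\<^sup>2) * p / (A * B) = ((1 - p) * B + (1 - q\<^sup>2) * p) / (A * B)"
    using AB by (simp add: add_divide_distrib)
  ultimately have "(1 - p) / A + (1 - q\<^sup>2) * p / (A * B) = (1 - q * p) / B" using AB by simp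
  then show ?thesis using AB by (simp add: path_gap_def path_gap_step_def A_def B_def p_def)
qed

lemma path_gap_step_pos: "0 < q \<Longrightarrow> q < 1 \<Longrightarrow> 0 < path_gap_step q k"
  unfolding path_gap_step_def by (intro divide_pos_pos mult_pos_pos add_pos_pos) (auto simp: power_less_one_iff)

text \<open>This is strict concavity. With \<open>p = q ^ k\<close> and common factors removed, the
  claim is \<open>q * (1 + q * p) < 1 + q ^ 3 * p\<close>, that is,
  \<open>0 < (1 - q) * (1 - q\<^sup>2 * p)\<close>.\<close>

lemma path_gap_step_decreasing:
  assumes "0 < q" "q < 1"
  shows "path_gap_step q (Suc k) < path_gap_step q k"
proof -
  define p where "p = q ^ k"
  have p: "0 < p" "p \<le> 1" using assms by (auto simp: p_def power_le_one)
  have pos: "0 < 1 + q * p" "0 < 1 + q * (q * p)" "0 < 1 + q * (q * (q * p))"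
    using assms p by (auto intro!: add_pos_pos)
  have "q\<^sup>2 < 1" using assms by (simp add: power_less_one_iff)
  moreover have "q\<^sup>2 * p \<le> q\<^sup>2 * 1" using p by (intro mult_left_mono) auto
  ultimately have "q\<^sup>2 * p < 1" by simp
  then have "0 < (1 - q) * (1 - q\<^sup>2 * p)" using assms by simp
  then have "q * (1 + q * p) < 1 + q * (q * (q * p))" by (simp add: algebra_simps power2_eq_square)
  then have "q / (1 + q * (q * (q * p))) < 1 / (1 + q * p)"
    using pos by (simp add: field_simps)
  then have "(1 - q\<^sup>2) * p / (1 + q * (q * p)) * (q / (1 + q * (q * (q * p)))) < (1 - q\<^sup>2) * p / (1 + q * (q * p)) * (1 / (1 + q * p))"
    using assms p pos by (intro mult_strict_left_mono) (auto simp: power_less_one_iff)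
  then show ?thesis by (simp add: path_gap_step_def p_def mult.commute mult.left_commute)
qed

lemma path_gap_mono: "0 < q \<Longrightarrow> q < 1 \<Longrightarrow> m \<le> k \<Longrightarrow> path_gap q m \<le> path_gap q k"
  by (rule lift_Suc_mono_le) (use path_gap_Suc[of q] path_gap_step_pos[of q] in \<open>auto simp: less_imp_le\<close>)

lemma path_gap_0: "path_gap q 0 = 0"
  by (simp add: path_gap_def)

lemma path_gap_nonneg: "0 < q \<Longrightarrow> q < 1 \<Longrightarrow> 0 \<le> path_gap q m"
  using path_gap_mono[of q 0 m] by (simp add: path_gap_0)

lemma path_gap_le_1: "0 < q \<Longrightarrow> path_gap q m \<le> 1"
proof -
  assume "0 < q"
  then have "0 < q ^ m" "0 < q ^ Suc m" by simp_all
  then have "1 - q ^ m \<le> 1 + q ^ Suc m" "0 < 1 + q ^ Suc m" by linarith+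
  then show ?thesis by (simp add: path_gap_def)
qed

text \<open>The number of boxes in the first \<open>k\<close> columns of the Young diagram with rows
  \<open>a\<close>. For lists of equal sum, \<open>trunc_sum b k \<le> trunc_sum a k\<close> for all
  \<open>k\<close> says that \<open>b\<close> majorises \<open>a\<close>. No sorting is involved,
  and lists of different lengths can be compared.\<close>

definition trunc_sum :: "nat list \<Rightarrow> nat \<Rightarrow> nat" where
  "trunc_sum a k = (\<Sum>x\<leftarrow>a. min x k)"

text \<open>Summation by parts, applied twice: a function vanishing at 0 is a combination of the
  truncations at \<open>Suc k\<close>, weighted with the negatives of its second differences, plus a
  last truncation weighted with the slope at \<open>M\<close>. By concavity the weights are
  positive.\<close>

lemma path_gap_layers:
  assumes "0 < q"
  shows "(\<Sum>k<M. (path_gap_step q k - path_gap_step q (Suc k)) * real (min m (Suc k)))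
    + path_gap_step q M * real (min m M) = path_gap q (min m M)"
proof (induction M)
  case 0
  then show ?case by (simp add: path_gap_0)
next
  case (Suc M)
  show ?case
  proof (cases "m \<le> M")
    case True
    then show ?thesis using Suc by (simp add: algebra_simps)
  next
    case False
    then show ?thesis using Suc path_gap_Suc[OF assms, of M] by (simp add: algebra_simps)
  qed
qed

lemma sum_path_gap:
  assumes "0 < q" "\<And>x. x \<in> set a \<Longrightarrow> x \<le> M"
  shows "(\<Sum>x\<leftarrow>a. path_gap q x) = (\<Sum>k<M. (path_gap_step q k - path_gap_step q (Suc k)) * real (trunc_sum a (Suc k)))
    + path_gap_step q M * real (sum_list a)"
  using assms(2)
proof (induction a)
  case Nil
  then show ?case by (simp add: trunc_sum_def)
next
  case (Cons x a)
  then have IH: "(\<Sum>x\<leftarrow>a. path_gap q x) = (\<Sum>k<M. (path_gap_step q k - path_gap_step q (Suc k)) * real (trunc_sum a (Suc k)))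
    + path_gap_step q M * real (sum_list a)" by simp
  have "path_gap q x = (\<Sum>k<M. (path_gap_step q k - path_gap_step q (Suc k)) * real (min x (Suc k))) + path_gap_step q M * real x"
    using path_gap_layers[OF assms(1), where M = M and m = x] Cons.prems[of x] by (simp add: min_def)
  then show ?case using IH by (simp add: trunc_sum_def distrib_left sum.distrib del: of_nat_min)
qed

lemma trunc_sum_Suc: "trunc_sum a (Suc k) = trunc_sum a k + length (filter (\<lambda>x. k < x) a)"
  by (induction a) (auto simp: trunc_sum_def min_def)

lemma trunc_sum_0: "trunc_sum a 0 = 0"
  by (induction a) (auto simp: trunc_sum_def)

lemma trunc_sum_large: "(\<And>x. x \<in> set a \<Longrightarrow> x \<le> k) \<Longrightarrow> trunc_sum a k = sum_list a"
  by (induction a) (auto simp: trunc_sum_def min_def)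

text \<open>First differences of \<open>trunc_sum\<close> in \<open>k\<close> count the entries
  above \<open>k\<close>, and second differences count the entries of one given positive
  size.\<close>

lemma mset_eq_if_trunc_sum_eq:
  assumes "0 \<notin> set a" "0 \<notin> set b" "\<And>k. trunc_sum a k = trunc_sum b k"
  shows "mset a = mset b"
proof (rule multiset_eqI)
  fix x
  have "length (filter (\<lambda>y. k < y) a) = length (filter (\<lambda>y. k < y) b)" for k
    using trunc_sum_Suc[of a k] trunc_sum_Suc[of b k] assms(3) by simp
  moreover have "length (filter (\<lambda>y. z < y) c) = count (mset c) (Suc z) + length (filter (\<lambda>y. Suc z < y) c)" for z c
    by (induction c) auto
  ultimately have "count (mset a) (Suc z) = count (mset b) (Suc z)" for z by (metis add_right_imp_eq)
  then have "count (mset a) x = count (mset b) x" if "x \<noteq> 0" using that by (metis not0_implies_Suc)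
  moreover have "count (mset a) 0 = 0" "count (mset b) 0 = 0"
    using assms(1,2) by (simp_all add: count_eq_zero_iff)
  ultimately show "count (mset a) x = count (mset b) x" by metis
qed

text \<open>Karamata's inequality by summation by parts, with majorisation expressed by truncated sums.\<close>
lemma path_gap_majorization:
  assumes q: "0 < q" "q < 1" and sum: "sum_list a = sum_list b"
    and ge: "\<And>k. trunc_sum b k \<le> trunc_sum a k"
    and le: "(\<Sum>x\<leftarrow>a. path_gap q x) \<le> (\<Sum>x\<leftarrow>b. path_gap q x)"
    and nz: "0 \<notin> set a" "0 \<notin> set b"
  shows "mset a = mset b"
proof (rule mset_eq_if_trunc_sum_eq[OF nz])
  define M where "M = sum_list a"
  have aM: "x \<le> M" if "x \<in> set a" for x using that by (simp add: M_def member_le_sum_list)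
  have bM: "x \<le> M" if "x \<in> set b" for x using that by (simp add: M_def sum member_le_sum_list)
  let ?d = "\<lambda>k. (path_gap_step q k - path_gap_step q (Suc k)) * (real (trunc_sum a (Suc k)) - real (trunc_sum b (Suc k)))"
  have nonneg: "0 \<le> ?d k" for k
    using path_gap_step_decreasing[OF q, of k] ge[of "Suc k"] by (intro mult_nonneg_nonneg) auto
  have "(\<Sum>k<M. ?d k) = (\<Sum>x\<leftarrow>a. path_gap q x) - (\<Sum>x\<leftarrow>b. path_gap q x)"
    using sum_path_gap[OF q(1) aM] sum_path_gap[OF q(1) bM] sum
    by (simp add: right_diff_distrib sum_subtractf)
  then have "(\<Sum>k<M. ?d k) = 0" using le nonneg by (smt (verit) sum_nonneg)
  then have "?d k = 0" if "k < M" for k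
    using that nonneg by (metis (no_types, lifting) finite_lessThan lessThan_iff sum_nonneg_eq_0_iff)
  then have lt: "trunc_sum a (Suc k) = trunc_sum b (Suc k)" if "k < M" for k
    using that path_gap_step_decreasing[OF q, of k] by fastforce
  show "trunc_sum a k = trunc_sum b k" for k
  proof (cases "k \<le> M")
    case True
    then show ?thesis using lt by (cases k) (auto simp: trunc_sum_0)
  next
    case False
    then show ?thesis using aM bM sum by (subst (1 2) trunc_sum_large) fastforce+
  qed
qed

lemma trunc_sum_excess: "trunc_sum a k + (\<Sum>x\<leftarrow>a. x - k) = sum_list a"
  by (induction a) (auto simp: trunc_sum_def min_def)

text \<open>From \<open>n2\<close> on, the excess bound is the claim itself. For
  \<open>k < n2\<close>, let \<open>?l\<close> entries exceed \<open>k\<close>. If \<open>?l\<close>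
  is at least \<open>c + 2\<close>, these entries alone suffice. Otherwise \<open>trunc_sum\<close>
  loses at most \<open>c + 1\<close> per step on the way down from \<open>n2\<close> to
  \<open>k\<close>, as fast as \<open>n1\<close> and the \<open>c\<close> copies of
  \<open>n2\<close> together.\<close>

lemma trunc_sum_ge:
  assumes "n2 \<le> n1" "r < n2" "sum_list a = n1 + c * n2 + r"
    and excess: "\<And>k. n2 \<le> k \<Longrightarrow> (\<Sum>x\<leftarrow>a. x - k) \<le> n1 - k"
  shows "min n1 k + c * min n2 k + min r k \<le> trunc_sum a k"
proof (cases "n2 \<le> k")
  case True
  define S where "S = (\<Sum>x\<leftarrow>a. x - k)"
  have "trunc_sum a k + S = n1 + c * n2 + r" "S \<le> n1 - k"
    using trunc_sum_excess[of a k] excess[OF True] assms(3) by (simp_all add: S_def)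
  then show ?thesis using True assms(1,2) by (auto simp: min_def)
next
  case False
  then have k: "k < n2" by simp
  let ?l = "length (filter (\<lambda>x. k < x) a)"
  have n2: "n2 + c * n2 + r \<le> trunc_sum a n2"
    using trunc_sum_excess[of a n2] excess[of n2] assms(1,3) by auto
  have 1: "?l * k \<le> trunc_sum a k" by (induction a) (auto simp: trunc_sum_def min_def)
  have 2: "trunc_sum a n2 \<le> trunc_sum a k + ?l * (n2 - k)" using k
    by (induction a) (auto simp: trunc_sum_def min_def)
  show ?thesis
  proof (cases "c + 2 \<le> ?l")
    case True
    then have "(c + 2) * k \<le> trunc_sum a k" using 1 by (meson mult_le_mono1 order_trans)
    then show ?thesis using k assms(1) by (auto simp: min_def)
  next
    case False
    then have "?l * (n2 - k) \<le> (c + 1) * (n2 - k)" by (intro mult_le_mono1) simp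
    moreover have "(c + 1) * (n2 - k) + (c + 1) * k = (c + 1) * n2" using k by (simp flip: distrib_left)
    ultimately have "(c + 1) * k + r \<le> trunc_sum a k" using 2 n2 by simp
    then show ?thesis using k assms(1) by (auto simp: min_def)
  qed
qed

text \<open>Every entry is at most \<open>l * (x div l) + (l - 1)\<close>. One entry above
  \<open>k\<close> gets its \<open>k\<close> back on the left side; each further one is reduced by
  \<open>k \<ge> l - 1\<close>, which absorbs its remainder. So a remainder is paid for only once.
  With quotient sum \<open>t - 2\<close> the right side is \<open>t * l - l - 1\<close>, the size of
  the long path in the second case of the theorem.\<close>

lemma excess_le_div:
  fixes l k :: nat
  assumes "0 < l" "l - 1 \<le> k" "\<exists>x\<in>set a. k < x"
  shows "(\<Sum>x\<leftarrow>a. x - k) + k \<le> l * (\<Sum>x\<leftarrow>a. x div l) + (l - 1)"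
  using assms(3)
proof (induction a)
  case (Cons x a)
  have "x mod l \<le> l - 1" using assms(1) by (metis Suc_pred' less_Suc_eq_le mod_less_divisor)
  then have x: "x \<le> l * (x div l) + (l - 1)" using mult_div_mod_eq[of l x] by linarith
  show ?case
  proof (cases "\<exists>y\<in>set a. k < y")
    case True
    then show ?thesis using Cons.IH x assms(2) by (simp add: distrib_left)
  next
    case False
    then have "(\<Sum>x\<leftarrow>a. x - k) = 0" by (simp add: not_less)
    moreover have "k < x" using Cons.prems False by auto
    ultimately have "(\<Sum>y\<leftarrow>x # a. y - k) + k = x" by simp
    then show ?thesis using x by (simp add: distrib_left)
  qed
qed simp

text \<open>Sizes of at most \<open>s\<close> need at least one component per \<open>s\<close>
  vertices, and each component costs at least \<open>path_gap q 1\<close>.\<close>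

lemma path_gap_count_lower:
  assumes "0 < q" "q < 1" "1 \<le> s"
  shows "(real (sum_list a) - real (\<Sum>x\<leftarrow>filter (\<lambda>x. s < x) a. x)) * path_gap q 1 / real s \<le> (\<Sum>x\<leftarrow>a. path_gap q x)"
proof (induction a)
  case (Cons x a)
  have "(if s < x then 0 else real x) * path_gap q 1 / real s \<le> path_gap q x"
  proof (cases "s < x \<or> x = 0")
    case True
    then show ?thesis using path_gap_nonneg[OF assms(1,2)] by auto
  next
    case False
    then have "real x / real s * path_gap q 1 \<le> 1 * path_gap q 1"
      using path_gap_nonneg[OF assms(1,2)] assms(3) by (intro mult_right_mono) auto
    also have "\<dots> \<le> path_gap q x" using path_gap_mono[OF assms(1,2), of 1 x] False by simp
    finally show ?thesis using False by simp
  qed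
  then show ?case using Cons by (auto simp: algebra_simps add_divide_distrib diff_divide_distrib)
qed simp

lemma path_gap_1_ge:
  assumes "0 < q" "q < 1"
  shows "1 - 2 * q \<le> path_gap q 1"
proof -
  have "q\<^sup>2 \<le> q" "0 \<le> q * q\<^sup>2" using assms by (simp_all add: power2_eq_square mult_left_le)
  moreover have "(1 - 2 * q) * (1 + q\<^sup>2) = 1 - q + (q\<^sup>2 - q) - 2 * (q * q\<^sup>2)" by (simp add: algebra_simps)
  ultimately have "(1 - 2 * q) * (1 + q\<^sup>2) \<le> 1 - q" by linarith
  moreover have "0 < 1 + q\<^sup>2" by (simp add: add_pos_nonneg)
  ultimately have "1 - 2 * q \<le> (1 - q) / (1 + q\<^sup>2)" by (simp add: pos_le_divide_eq)
  then show ?thesis by (simp add: path_gap_def power2_eq_square)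
qed

subsection \<open>A dominating vertex\<close>

lemma simple_graph_symp: "simple_graph n E \<Longrightarrow> symp E" "simple_graph n E \<Longrightarrow> irreflp E"
  by (auto simp: simple_graph_def intro!: sympI irreflpI)

lemma sum_nbrs_swap:
  assumes "symp E" "finite A" "finite B"
  shows "(\<Sum>z\<in>A. \<Sum>j | j \<in> B \<and> E z j. f z j) = (\<Sum>j\<in>B. \<Sum>z | z \<in> A \<and> E j z. f z j)"
proof -
  have "(\<Sum>z\<in>A. \<Sum>j | j \<in> B \<and> E z j. f z j) = (\<Sum>z\<in>A. \<Sum>j\<in>B. if E z j then f z j else 0)"
    using assms(3) by (intro sum.cong sum.inter_filter) auto
  also have "\<dots> = (\<Sum>j\<in>B. \<Sum>z\<in>A. if E z j then f z j else 0)" by (rule sum.swap)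
  also have "\<dots> = (\<Sum>j\<in>B. \<Sum>z\<in>A. if E j z then f z j else 0)"
    using assms(1) by (intro sum.cong) (auto dest: sympD)
  also have "\<dots> = (\<Sum>j\<in>B. \<Sum>z | z \<in> A \<and> E j z. f z j)"
    using assms(2) by (intro sum.cong sum.inter_filter[symmetric]) auto
  finally show ?thesis .
qed

lemma nbr_sum_split:
  assumes E: "simple_graph n E" and u: "u < n"
  defines "N \<equiv> {j. E u j}"
  defines "W \<equiv> {..<n} - {u} - N"
  shows "nbr_sum E x i = (if E i u then x u else 0) + (\<Sum>j | j \<in> N \<and> E i j. x j) + (\<Sum>j | j \<in> W \<and> E i j. x j)"
proof -
  have fin: "finite {j. E i j}" using finite_nbrs[OF E] .
  have "{j. E i j} = (if E i u then {u} else {}) \<union> ({j. j \<in> N \<and> E i j} \<union> {j. j \<in> W \<and> E i j})"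
    using E by (auto simp: N_def W_def simple_graph_def)
  then have "nbr_sum E x i = sum x ((if E i u then {u} else {}) \<union> ({j. j \<in> N \<and> E i j} \<union> {j. j \<in> W \<and> E i j}))"
    unfolding nbr_sum_def by (rule arg_cong)
  also have "\<dots> = sum x (if E i u then {u} else {}) + sum x ({j. j \<in> N \<and> E i j} \<union> {j. j \<in> W \<and> E i j})"
    using fin E by (intro sum.union_disjoint) (auto simp: N_def W_def simple_graph_def)
  also have "sum x ({j. j \<in> N \<and> E i j} \<union> {j. j \<in> W \<and> E i j}) = (\<Sum>j | j \<in> N \<and> E i j. x j) + (\<Sum>j | j \<in> W \<and> E i j. x j)"
    using fin by (intro sum.union_disjoint) (auto simp: W_def)
  finally show ?thesis by (simp add: add.assoc)
qed

text \<open>Let S be the total weight of the set W of non-neighbours of u. Two steps from u give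
  \<open>\<lambda>\<^sup>2 \<le> deg u + 2 \<lambda> + 2 S\<close>, and \<open>\<lambda> S \<le> 8 n\<close> by the edge count, so W has
  \<open>O(\<lambda>)\<close> vertices. If M is the maximal weight apart from u, then \<open>\<lambda> M \<le> 1 + 2 M + S\<close> and
  \<open>\<lambda> S \<le> 10 |W| M\<close>, so both are \<open>O(1 / \<lambda>)\<close>.\<close>
lemma perron_non_neighbours:
  fixes x :: "nat \<Rightarrow> real"
  assumes E: "simple_graph n E" and th: "\<not> has_theta E"
    and n: "12700000 \<le> n" and lam: "0 < lam" "real n - 1 \<le> lam\<^sup>2"
    and eig: "\<And>i. i < n \<Longrightarrow> nbr_sum E x i = lam * x i"
    and x: "\<And>i. 0 \<le> x i" "\<And>i. i < n \<Longrightarrow> x i \<le> 1" and u: "u < n" "x u = 1"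
  shows "99 / 100 * lam\<^sup>2 \<le> card {j. E u j}"
    and "w < n \<Longrightarrow> w \<noteq> u \<Longrightarrow> \<not> E u w \<Longrightarrow> nbr_sum E x w < 1"
proof -
  note sym = simple_graph_symp(1)[OF E] and irr = simple_graph_symp(2)[OF E]
  define N where "N = {j. E u j}"
  define W where "W = {..<n} - {u} - N"
  define s where "s A i = (\<Sum>j | j \<in> A \<and> E i j. x j)" for A i
  have Nn: "N \<subseteq> {..<n}" using E by (auto simp: N_def simple_graph_def)
  have fin: "finite N" "finite W" using Nn finite_subset by (auto simp: W_def)
  have uNW: "u \<notin> N" "u \<notin> W" using irr by (auto simp: N_def W_def dest: irreflpD)
  have split: "nbr_sum E x i = (if E i u then 1 else 0) + s N i + s W i" for i
    using nbr_sum_split[OF E u(1), of x i] u(2) by (simp add: s_def N_def W_def)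
  have two: "card {j. j \<in> N \<and> E i j} \<le> 2" if "i \<noteq> u" for i
    using that by (intro theta_common_neighbours[OF th sym irr, of u i]) (use fin in \<open>auto simp: N_def\<close>)
  have sym_iff: "E i j \<longleftrightarrow> E j i" for i j using sym by (auto dest: sympD)
  \<comment> \<open>3563 is the integer part of the square root of 12700000.\<close>
  have lam_big: "3563 \<le> lam"
  proof (rule ccontr)
    assume "\<not> 3563 \<le> lam"
    then have "lam\<^sup>2 \<le> 3563\<^sup>2" using lam(1) by (intro power_mono) auto
    moreover have "(12700000::real) \<le> real n" using n by (metis of_nat_le_iff of_nat_numeral)
    ultimately show False using lam(2) by (simp add: power2_eq_square)
  qed
  define S where "S = sum x W"
  have sN: "sum x N = lam"
    using eig[OF u(1)] u(2) by (simp add: nbr_sum_def N_def)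
  have swap: "(\<Sum>z\<in>N. s B z) = (\<Sum>j\<in>B. real (card {z. z \<in> N \<and> E j z}) * x j)" if "finite B" for B
    unfolding s_def using sum_nbrs_swap[OF sym fin(1) that, of "\<lambda>z j. x j"] by simp
  have le2: "(\<Sum>z\<in>N. s B z) \<le> 2 * sum x B" if "finite B" "u \<notin> B" for B
    unfolding swap[OF that(1)] sum_distrib_left
  proof (intro sum_mono mult_right_mono x(1))
    fix j assume "j \<in> B"
    then show "real (card {z. z \<in> N \<and> E j z}) \<le> 2" using two[of j] that(2)
      by (metis of_nat_le_iff of_nat_numeral)
  qed
  have "lam * lam = (\<Sum>z\<in>N. lam * x z)" using sN by (simp flip: sum_distrib_left)
  also have "\<dots> = (\<Sum>z\<in>N. 1 + s N z + s W z)"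
  proof (intro sum.cong refl)
    fix z assume z: "z \<in> N"
    then have "E z u" "z < n" using sym Nn by (auto simp: N_def dest: sympD)
    then show "lam * x z = 1 + s N z + s W z" using eig[of z] split[of z] by simp
  qed
  also have "\<dots> = card N + (\<Sum>z\<in>N. s N z) + (\<Sum>z\<in>N. s W z)" by (simp add: sum.distrib)
  also have "\<dots> \<le> card N + 2 * lam + 2 * S" using le2[OF fin(1) uNW(1)] le2[OF fin(2) uNW(2)] sN by (simp add: S_def)
  finally have deg: "lam * lam \<le> card N + 2 * lam + 2 * S" .
  have eigW: "nbr_sum E x w = lam * x w" if "w \<in> W" for w using that eig by (simp add: W_def)
  have lamS: "lam * S = (\<Sum>w\<in>W. nbr_sum E x w)"
    by (simp add: S_def sum_distrib_left eigW)
  also have "\<dots> \<le> (\<Sum>w\<in>W. real (card {j \<in> {..<n}. E w j}))"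
  proof (intro sum_mono)
    fix w
    have "{j. E w j} = {j \<in> {..<n}. E w j}" using E by (auto simp: simple_graph_def)
    moreover have "nbr_sum E x w \<le> (\<Sum>j | E w j. 1)"
      unfolding nbr_sum_def using x(2) E by (intro sum_mono) (auto simp: simple_graph_def)
    ultimately show "nbr_sum E x w \<le> real (card {j \<in> {..<n}. E w j})" by simp
  qed
  also have "\<dots> \<le> (\<Sum>w<n. real (card {j \<in> {..<n}. E w j}))"
    by (intro sum_mono2) (auto simp: W_def)
  also have "\<dots> \<le> 8 * real n"
    using theta_degree_sum[OF th sym irr, of "{..<n}"] by (simp flip: of_nat_sum)
  also have "\<dots> \<le> 8 * lam * lam + 8" using lam(2) by (simp add: power2_eq_square)
  finally have S8: "lam * S \<le> lam * (8 * lam) + 8" by (simp add: algebra_simps)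
  have S81: "S \<le> 8 * lam + 1"
  proof -
    have "lam * S \<le> lam * (8 * lam + 1)" using S8 lam_big by (simp add: algebra_simps)
    then show ?thesis using lam(1) by simp
  qed
  have degN: "lam * lam - 18 * lam - 2 \<le> card N" using deg S81 by linarith
  have lam18: "18 * lam + 2 \<le> 1 / 100 * (lam * lam)"
  proof -
    have "3563 * lam \<le> lam * lam" using lam_big by simp
    then show ?thesis using lam_big by linarith
  qed
  then show "99 / 100 * lam\<^sup>2 \<le> card {j. E u j}"
    using degN unfolding N_def power2_eq_square by linarith
  assume w: "w < n" "w \<noteq> u" "\<not> E u w"
  \<comment> \<open>There are at most \<open>lam^2\<close> vertices besides \<open>u\<close>, of
    which all but \<open>18 * lam + 2\<close> are neighbours; here 18 = 2 + 2 * 8 comes from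
    inserting \<open>S \<le> 8 * lam + 1\<close> into \<open>deg\<close>.\<close>
  have cW: "real (card W) \<le> 19 * lam"
  proof -
    have "card W = card ({..<n} - {u}) - card N"
      unfolding W_def using fin Nn uNW by (intro card_Diff_subset) auto
    moreover have "card N \<le> card ({..<n} - {u})" using Nn uNW by (intro card_mono) auto
    ultimately have "real (card W) = real n - 1 - card N" using u by (simp add: of_nat_diff)
    also have "\<dots> \<le> 18 * lam + 2" using degN lam(2) by (simp add: power2_eq_square)
    finally show ?thesis using lam_big by linarith
  qed
  define M where "M = Max (x ` ({..<n} - {u}))"
  have xM: "x i \<le> M" if "i < n" "i \<noteq> u" for i
    unfolding M_def using that by (intro Max_ge) auto
  have "M \<in> x ` ({..<n} - {u})" unfolding M_def using w by (intro Max_in) auto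
  then obtain z where z: "z < n" "z \<noteq> u" "M = x z" by auto
  have M0: "0 \<le> M" using x(1) z by simp
  have bound: "s A i \<le> real (card {j. j \<in> A \<and> E i j}) * M" if "A \<subseteq> {..<n} - {u}" for A i
    unfolding s_def using that by (intro sum_bounded_above xM) auto
  have sN2: "s N i \<le> 2 * M" if "i \<noteq> u" for i
  proof -
    have "s N i \<le> real (card {j. j \<in> N \<and> E i j}) * M" using bound[of N i] Nn uNW by blast
    also have "\<dots> \<le> 2 * M" using two[OF that] M0
      by (intro mult_right_mono) (metis of_nat_le_iff of_nat_numeral)
    finally show ?thesis .
  qed
  have sW: "s W i \<le> S" for i
    unfolding s_def S_def using fin x(1) by (intro sum_mono2) auto
  have MS: "lam * M \<le> 1 + 2 * M + S"
    using eig[OF z(1)] split[of z] sN2[OF z(2)] sW[of z] z(3) by (auto split: if_splits)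
  have "lam * S = (\<Sum>w\<in>W. nbr_sum E x w)" by (rule lamS)
  also have "\<dots> = (\<Sum>w\<in>W. s N w + s W w)"
    using sym_iff by (intro sum.cong) (auto simp: split W_def N_def)
  also have "\<dots> \<le> (\<Sum>w\<in>W. 2 * M + real (card {j \<in> W. E w j}) * M)"
    using sN2 bound[of W] uNW by (intro sum_mono add_mono) (auto simp: W_def)
  also have "\<dots> = (2 * real (card W) + real (\<Sum>w\<in>W. card {j \<in> W. E w j})) * M"
    by (simp add: sum.distrib distrib_right flip: sum_distrib_right)
  also have "\<dots> \<le> (2 * real (card W) + real (8 * card W)) * M"
    using theta_degree_sum[OF th sym irr fin(2)] M0
    by (intro mult_right_mono add_left_mono) (simp_all only: of_nat_le_iff)
  also have "\<dots> \<le> 190 * lam * M"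
    using cW M0 by (intro mult_right_mono) auto
  finally have "lam * S \<le> lam * (190 * M)" by (simp add: algebra_simps)
  then have S190: "S \<le> 190 * M" using lam(1) by simp
  \<comment> \<open>With 190 = 10 * 19, the bounds \<open>3563 * M \<le> 1 + 2 * M + S\<close> and
    \<open>S \<le> 190 * M\<close> give \<open>M < 1 / 3000\<close>, so the sum
    \<open>2 * M + S\<close> around a non-neighbour is at most \<open>192 * M < 1\<close>.\<close>
  have "3563 * M \<le> lam * M" using lam_big M0 by (intro mult_right_mono)
  then have "3371 * M \<le> 1 + S" using MS M0 by linarith
  then have "3181 * M \<le> 1" using S190 by linarith
  moreover have "nbr_sum E x w \<le> 2 * M + S"
    using split[of w] w sym_iff sN2[of w] sW[of w] by simp
  ultimately show "nbr_sum E x w < 1" using S190 M0 by linarith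
qed

lemma contains_subgraph_replace:
  assumes E: "simple_graph n E" and G: "simple_graph n G"
    and N: "m \<le> card {j. E u j}"
    and edges: "\<And>i j. G i j \<Longrightarrow> i = u \<or> j = u \<or> E u i \<and> E u j \<and> E i j"
    and c: "contains_subgraph n G m F"
  shows "contains_subgraph n E m F"
proof -
  define N where "N = {j. E u j}"
  have Nn: "N \<subseteq> {..<n}" "u \<notin> N" using E by (auto simp: N_def simple_graph_def)
  have finN: "finite N" using finite_nbrs[OF E] by (simp add: N_def)
  obtain f where f: "inj_on f {..<m}" "f ` {..<m} \<subseteq> {..<n}"
    "\<And>i j. i < m \<Longrightarrow> j < m \<Longrightarrow> F i j \<Longrightarrow> G (f i) (f j)"
    using c unfolding contains_subgraph_def by blast
  define I where "I = f ` {..<m}"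
  have I: "finite I" "card I = m" using f(1) by (auto simp: I_def card_image)
  define A where "A = I - insert u N"
  have "card A \<le> card (N - I)"
  proof -
    have "card (N \<inter> I) + card A = card ((N \<inter> I) \<union> A)"
      using I finN by (intro card_Un_disjoint[symmetric]) (auto simp: A_def)
    also have "\<dots> \<le> card I" using I by (intro card_mono) (auto simp: A_def)
    also have "\<dots> \<le> card N" using N I by (simp add: N_def)
    also have "card N = card (N \<inter> I) + card (N - I)" using finN by (metis card_Int_Diff)
    finally show ?thesis by simp
  qed
  then obtain g where g: "g ` A \<subseteq> N - I" "inj_on g A"
    using card_le_inj[of A "N - I"] I finN by (auto simp: A_def)
  define h where "h v = (if v \<in> A then g v else v)" for v
  have hN: "h v \<in> N" if "v \<in> I" "v \<noteq> u" for v
    using that g(1) by (auto simp: h_def A_def)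
  have hu: "h u = u" by (simp add: h_def A_def)
  have hid: "h v = v" if "v \<in> N" for v using that by (simp add: h_def A_def)
  have "inj_on h I"
    using g by (auto simp: inj_on_def h_def A_def split: if_splits)
  then have "inj_on (h \<circ> f) {..<m}" using f(1) by (auto simp: I_def intro: comp_inj_on)
  moreover have "(h \<circ> f) ` {..<m} \<subseteq> {..<n}"
  proof
    fix v assume "v \<in> (h \<circ> f) ` {..<m}"
    then obtain i where i: "i < m" "v = h (f i)" by auto
    then have "f i \<in> I" "f i < n" using f(2) by (auto simp: I_def)
    then show "v \<in> {..<n}" using hN[of "f i"] hu Nn(1) i(2) by (cases "f i = u") (simp, blast)
  qed
  moreover have "E ((h \<circ> f) i) ((h \<circ> f) j)" if "i < m" "j < m" "F i j" for i j
  proof -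
    have Gij: "G (f i) (f j)" using f(3) that by blast
    then have ne: "f i \<noteq> f j" using G by (auto simp: simple_graph_def)
    have in_I: "f i \<in> I" "f j \<in> I" using that by (auto simp: I_def)
    have sym: "E b a" if "E a b" for a b using E that by (auto simp: simple_graph_def)
    consider "f i = u" | "f j = u" | "f i \<in> N" "f j \<in> N" "E (f i) (f j)"
      using edges[OF Gij] by (auto simp: N_def)
    then show ?thesis
    proof cases
      case 1
      then show ?thesis using hN[OF in_I(2)] ne hu by (auto simp: N_def)
    next
      case 2
      then show ?thesis using hN[OF in_I(1)] ne hu sym by (auto simp: N_def)
    next
      case 3
      then show ?thesis using hid by simp
    qed
  qed
  ultimately show ?thesis unfolding contains_subgraph_def by blast
qed

text \<open>The Perron vector \<open>x\<close> of \<open>E\<close> serves as test vector for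
  \<open>G\<close>. A vertex of \<open>W\<close> gives up neighbours of total weight below 1 and
  gets \<open>u\<close>, of weight 1, instead; as edges count from both ends, the form grows by at
  least \<open>2 * D\<close>. In case of equality \<open>x\<close> is an eigenvector of
  \<open>G\<close>, and \<open>D = 0\<close> forces \<open>x w = 0\<close>, although in
  \<open>G\<close> the vertex \<open>w\<close> sees weight 1.\<close>

lemma spectral_radius_star_increase:
  assumes E: "simple_graph n E" and G: "simple_graph n G" and u: "u < n" "x u = 1"
    and eig: "\<And>i. i < n \<Longrightarrow> nbr_sum E x i = spectral_radius_graph n E * x i" and x0: "\<And>i. 0 \<le> x i"
    and edges: "\<And>i j. G i j \<longleftrightarrow> i \<noteq> j \<and> i < n \<and> j < n \<and> (i = u \<or> j = u \<or> E u i \<and> E u j \<and> E i j)"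
    and small: "\<And>w. w < n \<Longrightarrow> w \<noteq> u \<Longrightarrow> \<not> E u w \<Longrightarrow> nbr_sum E x w < 1"
    and w: "w < n" "w \<noteq> u" "\<not> E u w"
  shows "spectral_radius_graph n E < spectral_radius_graph n G"
proof -
  note sym = simple_graph_symp(1)[OF E] and irr = simple_graph_symp(2)[OF E]
  define N where "N = {j. E u j}"
  define W where "W = {..<n} - {u} - N"
  define s where "s A i = (\<Sum>j | j \<in> A \<and> E i j. x j)" for A i
  have Nn: "N \<subseteq> {..<n}" using E by (auto simp: N_def simple_graph_def)
  have fin: "finite N" "finite W" using Nn finite_subset by (auto simp: W_def)
  have uNW: "u \<notin> N" using irr by (auto simp: N_def dest: irreflpD)
  have sym_iff: "E i j \<longleftrightarrow> E j i" for i j using sym by (auto dest: sympD)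
  have split: "nbr_sum E x i = (if E i u then 1 else 0) + s N i + s W i" for i
    using nbr_sum_split[OF E u(1), of x i] u(2) by (simp add: s_def N_def W_def)
  have disj: "N \<inter> W = {}" by (auto simp: W_def)
  have part: "{..<n} = insert u (N \<union> W)" using u Nn by (auto simp: W_def)
  have total: "(\<Sum>i<n. f i) = f u + sum f N + sum f W" for f :: "nat \<Rightarrow> real"
  proof -
    have "u \<notin> N \<union> W" using uNW by (auto simp: W_def)
    then show ?thesis unfolding part using fin disj by (simp add: sum.union_disjoint add.assoc)
  qed
  have Gu: "nbr_sum G x u = nbr_sum E x u + sum x W"
  proof -
    have "{j. G u j} = N \<union> W" using edges Nn uNW u by (auto simp: W_def)
    then have "nbr_sum G x u = sum x N + sum x W"
      unfolding nbr_sum_def using fin disj by (simp add: sum.union_disjoint)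
    then show ?thesis by (simp add: nbr_sum_def N_def)
  qed
  have GN: "nbr_sum G x i = nbr_sum E x i - s W i" if "i \<in> N" for i
  proof -
    have "i < n" "i \<noteq> u" "E u i" "E i u" using that Nn uNW sym_iff by (auto simp: N_def)
    then have "{j. G i j} = insert u {j. j \<in> N \<and> E i j}"
      using edges Nn irr u by (auto simp: N_def dest: irreflpD)
    then have "nbr_sum G x i = 1 + s N i"
      unfolding nbr_sum_def s_def using fin uNW u by simp
    then show ?thesis using split[of i] \<open>E i u\<close> by simp
  qed
  have GW: "nbr_sum G x i = 1" if "i \<in> W" for i
  proof -
    have "{j. G i j} = {u}" using edges that u by (auto simp: W_def N_def)
    then show ?thesis using u by (simp add: nbr_sum_def)
  qed
  define D where "D = (\<Sum>i\<in>W. x i * (1 - nbr_sum E x i))"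
  have "(\<Sum>i\<in>N. x i * s W i) = (\<Sum>i\<in>W. x i * s N i)"
    unfolding s_def sum_distrib_left
    using sum_nbrs_swap[OF sym fin, of "\<lambda>i j. x i * x j"] by (simp add: mult.commute)
  also have "\<dots> \<le> (\<Sum>i\<in>W. x i * nbr_sum E x i)"
  proof (intro sum_mono mult_left_mono x0)
    fix i assume "i \<in> W"
    have "0 \<le> s W i" unfolding s_def using x0 by (intro sum_nonneg) auto
    then show "s N i \<le> nbr_sum E x i" using split[of i] by auto
  qed
  finally have NW: "(\<Sum>i\<in>N. x i * s W i) \<le> (\<Sum>i\<in>W. x i * nbr_sum E x i)" .
  have "adj_form n G x = x u * nbr_sum G x u + (\<Sum>i\<in>N. x i * nbr_sum G x i) + (\<Sum>i\<in>W. x i * nbr_sum G x i)"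
    unfolding adj_form_def by (rule total)
  also have "\<dots> = (nbr_sum E x u + sum x W) + (\<Sum>i\<in>N. x i * (nbr_sum E x i - s W i)) + sum x W"
    using Gu GN GW u(2) by simp
  also have "\<dots> = adj_form n E x + (\<Sum>i\<in>W. 2 * x i - x i * nbr_sum E x i) - (\<Sum>i\<in>N. x i * s W i)"
    unfolding adj_form_def total using u(2)
    by (simp add: sum_subtractf right_diff_distrib sum_distrib_left[symmetric])
  also have "\<dots> \<ge> adj_form n E x + 2 * D"
    using NW by (simp add: D_def sum_subtractf right_diff_distrib sum_distrib_left[symmetric])
  finally have ge: "adj_form n E x + 2 * D \<le> adj_form n G x" .
  have Dterm: "0 \<le> x i * (1 - nbr_sum E x i)" if "i \<in> W" for i
    using that small[of i] x0[of i] by (intro mult_nonneg_nonneg) (auto simp: W_def N_def)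
  then have D0: "0 \<le> D" unfolding D_def by (intro sum_nonneg)
  have "0 < n" using u by simp
  have Ex: "adj_form n E x = spectral_radius_graph n E * (\<Sum>i<n. (x i)\<^sup>2)"
    unfolding adj_form_def sum_distrib_left by (intro sum.cong) (auto simp: eig power2_eq_square)
  note ray = spectral_radius_rayleigh(1)[OF G \<open>0 < n\<close>]
  have pos: "0 < (\<Sum>i<n. (x i)\<^sup>2)" using u by (intro sum_pos2[of _ u]) auto
  show ?thesis
  proof (rule ccontr)
    assume "\<not> ?thesis"
    then have "spectral_radius_graph n G * (\<Sum>i<n. (x i)\<^sup>2) \<le> adj_form n E x"
      unfolding Ex using pos by (intro mult_right_mono) auto
    then have eq: "adj_form n G x = spectral_radius_graph n G * (\<Sum>i<n. (x i)\<^sup>2)" and "D \<le> 0"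
      using ray[of x] ge D0 by linarith+
    then have "D = 0" using D0 by simp
    have wW: "w \<in> W" using w by (simp add: W_def N_def)
    have "x w * (1 - nbr_sum E x w) = 0"
      using \<open>D = 0\<close> Dterm fin wW unfolding D_def by (subst (asm) sum_nonneg_eq_0_iff) auto
    then have "x w = 0" using small[OF w] by simp
    moreover have "nbr_sum G x w = spectral_radius_graph n G * x w"
      by (rule rayleigh_maximiser[OF G ray eq w(1)])
    ultimately show False using GW[OF wW] by simp
  qed
qed

subsection \<open>Linear forests\<close>

lemma card_ge_3: "finite A \<Longrightarrow> {a, b, c} \<subseteq> A \<Longrightarrow> a \<noteq> b \<Longrightarrow> a \<noteq> c \<Longrightarrow> b \<noteq> c \<Longrightarrow> 3 \<le> card A"
  using card_mono[of A "{a, b, c}"] by auto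

text \<open>A cover of the vertices by as few paths as possible uses every edge: an unused edge
  joins two path ends, so it either merges two paths or closes a cycle.\<close>
lemma linear_forest_paths:
  assumes "finite V" "symp R" "irreflp R" "\<And>x y. R x y \<Longrightarrow> x \<in> V"
    and deg: "\<And>x. card {y. R x y} \<le> 2"
    and acyclic: "\<And>xs. distinct xs \<Longrightarrow> 3 \<le> length xs \<Longrightarrow> successively R xs \<Longrightarrow> \<not> R (last xs) (hd xs)"
  obtains pss where "[] \<notin> set pss" "distinct (concat pss)" "set (concat pss) = V"
    "\<And>x y. R x y \<longleftrightarrow> links pss x y \<or> links pss y x"
proof -
  have sym: "R y x" if "R x y" for x y using that assms(2) by (auto dest: sympD)
  have flip: "(\<lambda>x y. R y x) = R" using sym by (auto intro!: ext)
  have rev: "successively R (rev zs) \<longleftrightarrow> successively R zs" for zs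
    unfolding successively_rev flip ..
  define good where "good pss \<longleftrightarrow> [] \<notin> set pss \<and> distinct (concat pss) \<and> set (concat pss) = V \<and>
    (\<forall>ps\<in>set pss. successively R ps)" for pss
  obtain vs where vs: "set vs = V" "distinct vs" using finite_distinct_list[OF assms(1)] by blast
  have "concat (map (\<lambda>x. [x]) vs) = vs" by (induction vs) auto
  then have "good (map (\<lambda>x. [x]) vs)" unfolding good_def using vs by (auto simp del: set_concat)
  then obtain pss where pss: "good pss" "\<And>qss. good qss \<Longrightarrow> length pss \<le> length qss"
    using ex_has_least_nat[of good _ length] by blast
  have link_R: "R x y" if xy: "links pss x y" for x y
  proof -
    obtain us ws where "us @ x # y # ws \<in> set pss" using xy by (auto simp: links_def)
    then have "successively R (us @ x # y # ws)" using pss(1) unfolding good_def by blast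
    then show ?thesis by (simp add: successively_append_iff)
  qed
  have dist_ps: "distinct ps" if "ps \<in> set pss" for ps
    using pss(1) that unfolding good_def by (auto simp: distinct_concat_iff)
  have end_vertex: "x = hd ps \<or> x = last ps"
    if xy: "R x y" "\<not> links pss x y" "\<not> links pss y x" "ps \<in> set pss" "x \<in> set ps" for x y ps
  proof (rule ccontr)
    assume no: "\<not> ?thesis"
    obtain us ws where ps: "ps = us @ x # ws" using xy(5) by (meson split_list)
    have "us \<noteq> []" "ws \<noteq> []" using no ps by auto
    then obtain us' a b ws' where uw: "us = us' @ [a]" "ws = b # ws'"
      by (metis append_butlast_last_id neq_Nil_conv)
    have ps1: "us' @ a # x # (b # ws') \<in> set pss" and ps2: "(us' @ [a]) @ x # b # ws' \<in> set pss"
      using that(4) ps uw by simp_all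
    then have l: "links pss a x" "links pss x b" unfolding links_def by blast+
    have "a \<noteq> b" using dist_ps[OF that(4)] ps uw by auto
    moreover have "finite {z. R x z}" using assms(4) sym by (intro finite_subset[OF _ assms(1)]) blast
    moreover have "{a, b, y} \<subseteq> {z. R x z}" using l link_R sym that(1) by auto
    moreover have "a \<noteq> y" "b \<noteq> y" using l that by auto
    ultimately have "3 \<le> card {z. R x z}" by (intro card_ge_3)
    then show False using deg[of x] by simp
  qed
  have "links pss x y \<or> links pss y x" if "R x y" for x y
  proof (rule ccontr)
    assume "\<not> ?thesis"
    then have n: "\<not> links pss x y" "\<not> links pss y x" by auto
    have "x \<in> V" "y \<in> V" using that assms(4) sym by blast+
    then obtain ps qs where p: "ps \<in> set pss" "x \<in> set ps" and q: "qs \<in> set pss" "y \<in> set qs"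
      using pss(1) unfolding good_def by auto
    have sp: "successively R ps" "successively R qs" using pss(1) p q unfolding good_def by auto
    have ex: "x = hd ps \<or> x = last ps" using end_vertex[OF that n p] .
    have ey: "y = hd qs \<or> y = last qs" using end_vertex[OF sym[OF that] n(2,1) q] .
    have "x \<noteq> y" using that assms(3) by (auto dest: irreflpD)
    show False
    proof (cases "ps = qs")
      case True
      then have ends: "R (last ps) (hd ps)" "hd ps \<noteq> last ps" using ex ey \<open>x \<noteq> y\<close> that sym by auto
      then obtain a b rest where ps: "ps = a # b # rest"
        using p(2) by (cases ps rule: remdups_adj.cases) auto
      show False
      proof (cases rest)
        case Nil
        then have "{x, y} = {a, b}" using ex ey True \<open>x \<noteq> y\<close> ps by auto
        moreover have "links pss a b" using p(1) ps unfolding links_def by (metis append_Nil)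
        ultimately show False using n by (auto simp: doubleton_eq_iff)
      next
        case (Cons c rest')
        then show False using acyclic[OF dist_ps[OF p(1)] _ sp(1)] ends ps by simp
      qed
    next
      case False
      define ps' where "ps' = (if x = last ps then ps else rev ps)"
      define qs' where "qs' = (if y = hd qs then qs else rev qs)"
      have ne: "ps \<noteq> []" "qs \<noteq> []" using p q by auto
      have p': "successively R ps'" "last ps' = x" "ps' \<noteq> []" "mset ps' = mset ps"
        using sp ex ne by (auto simp: ps'_def rev last_rev simp del: successively_rev)
      have q': "successively R qs'" "hd qs' = y" "qs' \<noteq> []" "mset qs' = mset qs"
        using sp ey ne by (auto simp: qs'_def rev hd_rev simp del: successively_rev)
      define rest where "rest = remove1 qs (remove1 ps pss)"
      have m: "mset pss = mset (ps # qs # rest)"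
      proof -
        have "qs \<in> set (remove1 ps pss)" using q(1) False by simp
        then have "mset (remove1 ps pss) = add_mset qs (mset rest)"
          unfolding rest_def by (metis insert_DiffM mset_remove1 set_mset_mset)
        moreover have "mset pss = add_mset ps (mset (remove1 ps pss))"
          using p(1) by (metis insert_DiffM mset_remove1 set_mset_mset)
        ultimately show ?thesis by (simp only: mset.simps)
      qed
      have "mset (concat ((ps' @ qs') # rest)) = mset (concat pss)"
        using mset_concat_cong[OF m] p'(4) q'(4) by simp
      then have "distinct (concat ((ps' @ qs') # rest))" "set (concat ((ps' @ qs') # rest)) = V"
        using pss(1) unfolding good_def by (metis mset_eq_imp_distinct_iff, metis mset_eq_setD)
      moreover have "set rest \<subseteq> set pss" unfolding rest_def by (meson set_remove1_subset subset_trans)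
      moreover have "successively R (ps' @ qs')" using p' q' that by (simp add: successively_append_iff)
      ultimately have "good ((ps' @ qs') # rest)"
        using pss(1) p'(3) unfolding good_def by auto
      then have "length pss \<le> Suc (length rest)" using pss(2) by fastforce
      moreover have "length pss = Suc (Suc (length rest))" using m by (metis length_Cons size_mset)
      ultimately show False by simp
    qed
  qed
  then show ?thesis using that[of pss] pss(1) link_R sym unfolding good_def by blast
qed

subsection \<open>Eigenvalues of fans\<close>

text \<open>The solution of \<open>(q + 1/q) y\<^sub>i = 1 + y\<^bsub>i-1\<^esub> + y\<^bsub>i+1\<^esub>\<close> with
  zero boundary values at 0 and \<open>m + 1\<close>.\<close>
definition path_vec :: "real \<Rightarrow> nat \<Rightarrow> nat \<Rightarrow> real" where
  "path_vec q m i = (1 - (q ^ i + q ^ (Suc m - i)) / (1 + q ^ Suc m)) / (q + 1 / q - 2)"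

lemma path_vec_ends:
  assumes "0 < q"
  shows "path_vec q m 0 = 0" "path_vec q m (Suc m) = 0"
proof -
  have "1 + q * q ^ m \<noteq> 0" using assms by (smt (verit) mult_pos_pos zero_less_power)
  then show "path_vec q m 0 = 0" "path_vec q m (Suc m) = 0"
    by (simp_all add: path_vec_def add.commute)
qed

lemma two_less_q_plus_inverse:
  fixes q :: real
  assumes "0 < q" "q < 1"
  shows "0 < q + 1 / q - 2"
proof -
  have "q + 1 / q - 2 = (1 - q)\<^sup>2 / q" using assms by (simp add: field_simps power2_eq_square)
  then show ?thesis using assms by simp
qed

lemma path_vec_eq:
  assumes "0 < q" "q < 1" "i < m"
  shows "(q + 1 / q) * path_vec q m (Suc i) = 1 + path_vec q m i + path_vec q m (Suc (Suc i))"
proof -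
  define c where "c = q + 1 / q - 2"
  define P where "P = 1 + q ^ Suc m"
  define a where "a = q ^ i"
  define b where "b = q ^ (m - Suc i)"
  have c: "c \<noteq> 0" using two_less_q_plus_inverse[OF assms(1,2)] by (simp add: c_def)
  have P: "P \<noteq> 0" unfolding P_def using assms(1) by (smt (verit) zero_less_power)
  have e: "Suc m - i = Suc (Suc (m - Suc i))" "Suc m - Suc i = Suc (m - Suc i)" "Suc m - Suc (Suc i) = m - Suc i"
    using assms(3) by auto
  have y: "path_vec q m i = (1 - (a + q * (q * b)) / P) / c"
    "path_vec q m (Suc i) = (1 - (q * a + q * b) / P) / c"
    "path_vec q m (Suc (Suc i)) = (1 - (q * (q * a) + b) / P) / c"
    unfolding path_vec_def e c_def P_def a_def b_def by simp_all
  have "(q + 1 / q) * (q * a + q * b) = (a + q * (q * b)) + (q * (q * a) + b)"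
    using assms(1) by (simp add: field_simps)
  then have "(q + 1 / q) * ((q * a + q * b) / P) = (a + q * (q * b)) / P + (q * (q * a) + b) / P"
    by (simp only: times_divide_eq_right add_divide_distrib[symmetric])
  then have "(q + 1 / q) * (1 - (q * a + q * b) / P) = c + (1 - (a + q * (q * b)) / P) + (1 - (q * (q * a) + b) / P)"
    by (simp add: right_diff_distrib c_def)
  then have "(q + 1 / q) * (1 - (q * a + q * b) / P) / c = (c + (1 - (a + q * (q * b)) / P) + (1 - (q * (q * a) + b) / P)) / c"
    by simp
  moreover have "(c + X + Y) / c = 1 + X / c + Y / c" for X Y
    using c by (simp add: add_divide_distrib)
  ultimately show ?thesis unfolding y by (simp only: times_divide_eq_right)
qed

lemma path_vec_sum:
  assumes "0 < q" "q < 1"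
  shows "(\<Sum>i<m. path_vec q m (Suc i)) = (real m - 2 * q / (1 - q) * path_gap q m) / (q + 1 / q - 2)"
proof -
  define P where "P = 1 + q ^ Suc m"
  have P: "P \<noteq> 0" unfolding P_def using assms(1) by (smt (verit) zero_less_power)
  have geo: "(\<Sum>i<m. q ^ Suc i) = q * (1 - q ^ m) / (1 - q)"
    using assms(2) by (simp add: sum_gp_strict sum_distrib_left[symmetric])
  have "(\<Sum>i<m. q ^ (Suc m - Suc i)) = (\<Sum>i<m. q ^ Suc (m - Suc i))"
    by (intro sum.cong) (auto simp: Suc_diff_Suc)
  also have "\<dots> = (\<Sum>i<m. q ^ Suc i)" by (rule sum.nat_diff_reindex)
  finally have geo': "(\<Sum>i<m. q ^ (Suc m - Suc i)) = q * (1 - q ^ m) / (1 - q)" using geo by simp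
  have "(\<Sum>i<m. path_vec q m (Suc i)) = (\<Sum>i<m. 1 - (q ^ Suc i + q ^ (Suc m - Suc i)) / P) / (q + 1 / q - 2)"
    unfolding path_vec_def P_def sum_divide_distrib ..
  also have "(\<Sum>i<m. 1 - (q ^ Suc i + q ^ (Suc m - Suc i)) / P) = real m - ((\<Sum>i<m. q ^ Suc i) + (\<Sum>i<m. q ^ (Suc m - Suc i))) / P"
    by (simp add: sum_subtractf sum.distrib sum_divide_distrib[symmetric] del: power_Suc diff_Suc_Suc)
  also have "\<dots> = real m - 2 * q / (1 - q) * path_gap q m"
    unfolding geo geo' path_gap_def P_def by (simp add: mult.commute)
  finally show ?thesis .
qed

section \<open>Test vectors on fans and comparison of their spectral radii\<close>

lemma fan_nbrs_hub:
  assumes "fan_layout n u pss"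
  shows "{j. fan u pss u j} = set (concat pss)"
  using assms links_in[of pss] by (auto simp: fan_def fan_layout_def simp del: set_concat)

lemma distinct_concat_nth_unique:
  assumes "distinct (concat pss)" "ps \<in> set pss" "qs \<in> set pss" "i < length ps" "j < length qs" "ps ! i = qs ! j"
  shows "ps = qs \<and> i = j"
proof -
  have "ps = qs"
  proof (rule ccontr)
    assume "ps \<noteq> qs"
    then have "set ps \<inter> set qs = {}" using assms(1,2,3) by (auto simp: distinct_concat_iff)
    then show False using assms(4-6) by (metis disjoint_iff nth_mem)
  qed
  moreover have "distinct ps" using assms(1,2) by (auto simp: distinct_concat_iff)
  ultimately show ?thesis using assms(4-6) by (auto simp: nth_eq_iff_index_eq)
qed

lemma fan_nbrs_path:
  assumes "fan_layout n u pss" "ps \<in> set pss" "i < length ps"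
  shows "{j. fan u pss (ps ! i) j} = insert u ((if i = 0 then {} else {ps ! (i - 1)}) \<union> (if Suc i = length ps then {} else {ps ! Suc i}))"
proof -
  have d: "distinct (concat pss)" "u \<notin> set (concat pss)" using assms(1) by (auto simp: fan_layout_def simp del: set_concat)
  have v: "ps ! i \<in> set (concat pss)" using assms(2,3) by (auto intro!: bexI[of _ ps])
  have 1: "links pss (ps ! i) j \<longleftrightarrow> Suc i < length ps \<and> j = ps ! Suc i" for j
  proof
    assume "links pss (ps ! i) j"
    then obtain qs k where q: "qs \<in> set pss" "Suc k < length qs" "qs ! k = ps ! i" "qs ! Suc k = j"
      by (auto simp: links_nth)
    then have "qs = ps \<and> k = i" using distinct_concat_nth_unique[OF d(1) q(1) assms(2) _ assms(3) q(3)] q(2) by simp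
    then show "Suc i < length ps \<and> j = ps ! Suc i" using q by auto
  qed (use assms(2) in \<open>auto simp: links_nth\<close>)
  have 2: "links pss j (ps ! i) \<longleftrightarrow> 0 < i \<and> j = ps ! (i - 1)" for j
  proof
    assume "links pss j (ps ! i)"
    then obtain qs k where q: "qs \<in> set pss" "Suc k < length qs" "qs ! k = j" "qs ! Suc k = ps ! i"
      by (auto simp: links_nth)
    then have "qs = ps \<and> Suc k = i" using distinct_concat_nth_unique[OF d(1) q(1) assms(2) q(2) assms(3) q(4)] by simp
    then show "0 < i \<and> j = ps ! (i - 1)" using q by auto
  next
    assume "0 < i \<and> j = ps ! (i - 1)"
    then show "links pss j (ps ! i)" using assms(2,3)
      by (auto simp: links_nth intro!: bexI[of _ ps] exI[of _ "i - 1"])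
  qed
  have "fan u pss (ps ! i) j \<longleftrightarrow> j = u \<or> links pss (ps ! i) j \<or> links pss j (ps ! i)" for j
    using v d(2) unfolding fan_def by auto
  then show ?thesis unfolding 1 2 using assms(3) by auto
qed

lemma sum_set_concat:
  fixes f :: "'a \<Rightarrow> real"
  shows "distinct (concat pss) \<Longrightarrow> sum f (set (concat pss)) = (\<Sum>ps\<leftarrow>pss. \<Sum>i<length ps. f (ps ! i))"
proof (induction pss)
  case (Cons ps pss)
  have "sum f (set ps) = (\<Sum>i<length ps. f (ps ! i))"
    using Cons.prems by (simp add: sum.distinct_set_conv_list sum_list_sum_nth atLeast0LessThan)
  moreover have "sum f (set ps \<union> set (concat pss)) = sum f (set ps) + sum f (set (concat pss))"
    using Cons.prems by (intro sum.union_disjoint) auto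
  ultimately show ?case using Cons by simp
qed simp

text \<open>The total weight seen by a hub of weight 1 when each path carries
  \<open>path_vec\<close>. The eigenvalue equation at the hub reads
  \<open>fan_weight q ls = q + 1 / q\<close>.\<close>

definition fan_weight :: "real \<Rightarrow> nat list \<Rightarrow> real" where
  "fan_weight q ls = (real (sum_list ls) - 2 * q / (1 - q) * (\<Sum>m\<leftarrow>ls. path_gap q m)) / (q + 1 / q - 2)"

text \<open>The vector exists for every \<open>q\<close> between 0 and 1, whether or not
  \<open>q + 1 / q\<close> is an eigenvalue; all information about the spectrum sits in the hub
  equation.\<close>

lemma fan_test_vector:
  assumes lay: "fan_layout n u pss" and q: "0 < q" "q < 1"
  obtains y where "y u = 1" "nbr_sum (fan u pss) y u = fan_weight q (map length pss)"
    "\<And>i. i < n \<Longrightarrow> i \<noteq> u \<Longrightarrow> nbr_sum (fan u pss) y i = (q + 1 / q) * y i"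
proof -
  have d: "distinct (concat pss)" "u \<notin> set (concat pss)" "set (concat pss) = {..<n} - {u}"
    using lay by (auto simp: fan_layout_def simp del: set_concat)
  define y where "y v = (if v = u then 1 else
    (let (ps, i) = (SOME (ps, i). ps \<in> set pss \<and> i < length ps \<and> ps ! i = v) in path_vec q (length ps) (Suc i)))" for v
  have y: "y (ps ! i) = path_vec q (length ps) (Suc i)" if "ps \<in> set pss" "i < length ps" for ps i
  proof -
    have "ps ! i \<noteq> u" using that d(2) by (auto dest: nth_mem)
    moreover have "(SOME (qs, j). qs \<in> set pss \<and> j < length qs \<and> qs ! j = ps ! i) = (ps, i)"
      by (rule some_equality) (use that distinct_concat_nth_unique[OF d(1)] in auto)
    ultimately show ?thesis by (simp add: y_def)
  qed
  have "y u = 1" by (simp add: y_def)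
  moreover have "nbr_sum (fan u pss) y u = fan_weight q (map length pss)"
  proof -
    have "nbr_sum (fan u pss) y u = (\<Sum>ps\<leftarrow>pss. \<Sum>i<length ps. y (ps ! i))"
      unfolding nbr_sum_def fan_nbrs_hub[OF lay] by (rule sum_set_concat[OF d(1)])
    also have "\<dots> = (\<Sum>ps\<leftarrow>pss. (real (length ps) - 2 * q / (1 - q) * path_gap q (length ps)) / (q + 1 / q - 2))"
    proof (intro arg_cong[of _ _ sum_list] map_cong refl)
      fix ps assume "ps \<in> set pss"
      then have "(\<Sum>i<length ps. y (ps ! i)) = (\<Sum>i<length ps. path_vec q (length ps) (Suc i))"
        using y by (intro sum.cong) auto
      then show "(\<Sum>i<length ps. y (ps ! i)) = (real (length ps) - 2 * q / (1 - q) * path_gap q (length ps)) / (q + 1 / q - 2)"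
        using path_vec_sum[OF q] by simp
    qed
    also have "\<dots> = fan_weight q (map length pss)"
      unfolding fan_weight_def
      by (induction pss) (simp_all add: add_divide_distrib diff_divide_distrib distrib_left comp_def)
    finally show ?thesis .
  qed
  moreover have "nbr_sum (fan u pss) y v = (q + 1 / q) * y v" if v: "v < n" "v \<noteq> u" for v
  proof -
    have "v \<in> set (concat pss)" using v d(3) by simp
    then obtain ps i where ps: "ps \<in> set pss" "i < length ps" "v = ps ! i" by (auto simp: in_set_conv_nth)
    have dist: "distinct ps" using d(1) ps(1) by (auto simp: distinct_concat_iff)
    have un: "ps ! j \<noteq> u" if "j < length ps" for j using that ps(1) d(2) by (auto dest: nth_mem)
    let ?A = "if i = 0 then {} else {ps ! (i - 1)}" and ?B = "if Suc i = length ps then {} else {ps ! Suc i}"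
    have A: "sum y ?A = path_vec q (length ps) i"
      using y[OF ps(1), of "i - 1"] ps(2) path_vec_ends(1)[OF q(1)] by auto
    have B: "sum y ?B = path_vec q (length ps) (Suc (Suc i))"
      using y[OF ps(1), of "Suc i"] ps(2) path_vec_ends(2)[OF q(1)] by auto
    have "ps ! (i - 1) \<noteq> u" using un ps(2) by simp
    moreover have "Suc i \<noteq> length ps \<Longrightarrow> ps ! Suc i \<noteq> u" using un ps(2) by simp
    ultimately have "u \<notin> ?A \<union> ?B" by auto
    moreover have "?A \<inter> ?B = {}" using dist ps(2) by (auto simp: nth_eq_iff_index_eq)
    ultimately have "sum y (insert u (?A \<union> ?B)) = y u + (sum y ?A + sum y ?B)"
      by (subst sum.insert) (auto simp: sum.union_disjoint)
    then have "nbr_sum (fan u pss) y v = 1 + (path_vec q (length ps) i + path_vec q (length ps) (Suc (Suc i)))"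
      unfolding nbr_sum_def ps(3) fan_nbrs_path[OF lay ps(1,2)] A B by (simp add: \<open>y u = 1\<close>)
    then show ?thesis using path_vec_eq[OF q ps(2)] y[OF ps(1,2)] ps(3) by simp
  qed
  ultimately show ?thesis using that by blast
qed

text \<open>Pair the test vector with the Perron vector \<open>x\<close>. By symmetry of the matrix
  the defect of the eigenvalue equation is orthogonal to \<open>x\<close>, and it is supported on
  the hub. There \<open>x\<close> does not vanish, since otherwise the non-negative weights of all
  other vertices would have sum 0.\<close>

lemma fan_weight_spectral_radius:
  assumes lay: "fan_layout n u pss" and q: "0 < q" "q < 1" and rho: "spectral_radius_graph n (fan u pss) = q + 1 / q"
  shows "fan_weight q (map length pss) = q + 1 / q"
proof -
  let ?E = "fan u pss"
  have E: "simple_graph n ?E" by (rule fan_simple_graph[OF lay])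
  have un: "u < n" using lay by (auto simp: fan_layout_def)
  then have "0 < n" by simp
  obtain x where x: "(\<Sum>i<n. (x i)\<^sup>2) = 1" "\<And>i. 0 \<le> x i" "\<And>i. i < n \<Longrightarrow> nbr_sum ?E x i = (q + 1 / q) * x i"
    using spectral_radius_rayleigh(2)[OF E \<open>0 < n\<close>] rho by auto
  obtain y where y: "y u = 1" "nbr_sum ?E y u = fan_weight q (map length pss)"
    "\<And>i. i < n \<Longrightarrow> i \<noteq> u \<Longrightarrow> nbr_sum ?E y i = (q + 1 / q) * y i"
    using fan_test_vector[OF lay q] by blast
  have xu: "x u \<noteq> 0"
  proof
    assume xu: "x u = 0"
    have "sum x (set (concat pss)) = 0"
      using x(3)[OF un] xu by (simp add: nbr_sum_def fan_nbrs_hub[OF lay] del: set_concat)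
    then have "x v = 0" if "v \<in> set (concat pss)" for v
      using that x(2) by (subst (asm) sum_nonneg_eq_0_iff) (auto simp del: set_concat)
    moreover have "set (concat pss) = {..<n} - {u}" using lay by (auto simp: fan_layout_def simp del: set_concat)
    ultimately have "x v = 0" if "v < n" for v using xu that by (cases "v = u") (auto simp del: set_concat)
    then show False using x(1) by simp
  qed
  have "(\<Sum>i<n. x i * nbr_sum ?E y i) = (\<Sum>i<n. y i * nbr_sum ?E x i)" by (rule adj_bilinear_sym[OF E])
  also have "\<dots> = (\<Sum>i<n. x i * ((q + 1 / q) * y i))" by (intro sum.cong) (auto simp: x(3))
  finally have "(\<Sum>i<n. x i * (nbr_sum ?E y i - (q + 1 / q) * y i)) = 0"
    by (simp add: right_diff_distrib sum_subtractf)
  moreover have "(\<Sum>i<n. x i * (nbr_sum ?E y i - (q + 1 / q) * y i)) = (\<Sum>i\<in>{u}. x i * (nbr_sum ?E y i - (q + 1 / q) * y i))"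
    using un y(3) by (intro sum.mono_neutral_right) auto
  ultimately have "x u * (fan_weight q (map length pss) - (q + 1 / q)) = 0" using y(1,2) by simp
  then show ?thesis using xu by simp
qed

text \<open>For the test vector, the quadratic form minus \<open>q + 1 / q\<close> times the squared
  norm equals the defect at the hub, because the hub has weight 1 and there is no defect elsewhere.
  The Rayleigh bound makes this difference non-positive.\<close>

lemma fan_weight_le_spectral_radius:
  assumes lay: "fan_layout n u pss" and q: "0 < q" "q < 1" and rho: "spectral_radius_graph n (fan u pss) \<le> q + 1 / q"
  shows "fan_weight q (map length pss) \<le> q + 1 / q"
proof -
  let ?E = "fan u pss"
  have E: "simple_graph n ?E" by (rule fan_simple_graph[OF lay])
  have un: "u < n" using lay by (auto simp: fan_layout_def)
  then have "0 < n" by simp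
  obtain y where y: "y u = 1" "nbr_sum ?E y u = fan_weight q (map length pss)"
    "\<And>i. i < n \<Longrightarrow> i \<noteq> u \<Longrightarrow> nbr_sum ?E y i = (q + 1 / q) * y i"
    using fan_test_vector[OF lay q] by blast
  have "adj_form n ?E y - (q + 1 / q) * (\<Sum>i<n. (y i)\<^sup>2) = (\<Sum>i<n. y i * (nbr_sum ?E y i - (q + 1 / q) * y i))"
    unfolding adj_form_def sum_distrib_left sum_subtractf[symmetric]
    by (intro sum.cong) (auto simp: algebra_simps power2_eq_square)
  also have "\<dots> = (\<Sum>i\<in>{u}. y i * (nbr_sum ?E y i - (q + 1 / q) * y i))"
    using un y(3) by (intro sum.mono_neutral_right) auto
  also have "\<dots> = fan_weight q (map length pss) - (q + 1 / q)" using y by simp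
  finally have *: "adj_form n ?E y - (q + 1 / q) * (\<Sum>i<n. (y i)\<^sup>2) = fan_weight q (map length pss) - (q + 1 / q)" .
  have "adj_form n ?E y \<le> spectral_radius_graph n ?E * (\<Sum>i<n. (y i)\<^sup>2)"
    by (rule spectral_radius_rayleigh(1)[OF E \<open>0 < n\<close>])
  also have "\<dots> \<le> (q + 1 / q) * (\<Sum>i<n. (y i)\<^sup>2)" using rho by (intro mult_right_mono sum_nonneg) auto
  finally show ?thesis using * by linarith
qed

lemma fan_layout_sum_lengths:
  assumes "fan_layout n u pss"
  shows "sum_list (map length pss) = n - 1"
proof -
  have "length (concat pss) = card (set (concat pss))"
    using assms by (intro distinct_card[symmetric]) (auto simp: fan_layout_def simp del: set_concat)
  also have "set (concat pss) = {..<n} - {u}" "u < n" using assms by (auto simp: fan_layout_def simp del: set_concat)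
  then have "card (set (concat pss)) = n - 1" by simp
  finally show ?thesis by (simp add: length_concat)
qed

text \<open>Both fans are tested at the \<open>q\<close> of the first one: there the first has
  defect 0 at the hub, the second a defect of at most 0. As both have \<open>n - 1\<close> rim
  vertices, the weights differ only in the sums of \<open>path_gap\<close>, which enter with a
  negative factor.\<close>

lemma fan_path_gap_compare:
  assumes p: "fan_layout n u pss" and r: "fan_layout n v rss"
    and q: "0 < q" "q < 1" and rho: "spectral_radius_graph n (fan u pss) = q + 1 / q"
    and le: "spectral_radius_graph n (fan v rss) \<le> spectral_radius_graph n (fan u pss)"
  shows "(\<Sum>m\<leftarrow>map length pss. path_gap q m) \<le> (\<Sum>m\<leftarrow>map length rss. path_gap q m)"
proof -
  note len = fan_layout_sum_lengths
  have "fan_weight q (map length rss) \<le> fan_weight q (map length pss)"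
    using fan_weight_spectral_radius[OF p q rho] fan_weight_le_spectral_radius[OF r q] le rho by simp
  then have "2 * q / (1 - q) * (\<Sum>m\<leftarrow>map length pss. path_gap q m) \<le> 2 * q / (1 - q) * (\<Sum>m\<leftarrow>map length rss. path_gap q m)"
    unfolding fan_weight_def len[OF p] len[OF r] divide_le_cancel
    using two_less_q_plus_inverse[OF q] by linarith
  moreover have "0 < 2 * q / (1 - q)" using q by simp
  ultimately show ?thesis by (simp only: mult_le_cancel_left_pos)
qed

subsection \<open>Packings of paths in fans\<close>

definition path_packing :: "('a \<Rightarrow> 'a \<Rightarrow> bool) \<Rightarrow> nat \<Rightarrow> nat \<Rightarrow> 'a list list \<Rightarrow> bool" where
  "path_packing G t l qss \<longleftrightarrow>
     length qss = t \<and> (\<forall>q\<in>set qss. length q = l \<and> successively G q) \<and> distinct (concat qss)"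

lemma split_chunks:
  assumes "0 < l"
  shows "\<exists>cs r. ps = concat cs @ r \<and> length cs = length ps div l \<and> (\<forall>c\<in>set cs. length c = l) \<and> length r = length ps mod l"
proof (induction "length ps" arbitrary: ps rule: less_induct)
  case less
  show ?case
  proof (cases "length ps < l")
    case True
    then show ?thesis by (intro exI[of _ "[]"] exI[of _ ps]) simp
  next
    case False
    then have "length (drop l ps) < length ps" using assms by simp
    then obtain cs r where *: "drop l ps = concat cs @ r" "length cs = length (drop l ps) div l"
      "\<forall>c\<in>set cs. length c = l" "length r = length (drop l ps) mod l"
      using less by blast
    have "ps = concat (take l ps # cs) @ r" using *(1) by (metis append_take_drop_id append_assoc concat.simps(2))
    moreover have "length (take l ps # cs) = length ps div l" using *(2) False assms by (simp add: le_div_geq)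
    moreover have "length r = length ps mod l" using *(4) False by (simp add: le_mod_geq)
    ultimately show ?thesis using *(3) False by (intro exI[of _ "take l ps # cs"] exI[of _ r]) auto
  qed
qed

lemma successively_fan_path:
  assumes "ps \<in> set pss"
  shows "successively (fan u pss) ps"
  unfolding successively_iff_links using assms by (auto simp: links_def fan_def)

lemma successively_sublist: "successively P (xs @ ys @ zs) \<Longrightarrow> successively P ys"
  by (simp add: successively_append_iff)

text \<open>Every path is cut into as many pieces of \<open>l\<close> vertices as possible. The
  remainders are kept, in the order of the paths, for one additional path through the hub.\<close>

lemma fan_chunks:
  assumes lay: "fan_layout n u pss" and l: "0 < l"
  obtains C R where "length C = (\<Sum>ps\<leftarrow>pss. length ps div l)"
    "\<And>c. c \<in> set C \<Longrightarrow> length c = l \<and> successively (fan u pss) c"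
    "length R = length pss" "\<And>i. i < length pss \<Longrightarrow> length (R ! i) = length (pss ! i) mod l \<and> successively (fan u pss) (R ! i)"
    "mset (concat pss) = mset (concat C @ concat R)"
proof -
  obtain c r where cr: "\<And>ps :: nat list. ps = concat (c ps) @ r ps \<and> length (c ps) = length ps div l \<and>
      (\<forall>x\<in>set (c ps). length x = l) \<and> length (r ps) = length ps mod l"
    using split_chunks[OF l] by metis
  let ?C = "concat (map c pss)" and ?R = "map r pss"
  have succ: "successively (fan u pss) x" if "ps \<in> set pss" "x \<in> set (c ps)" for ps x
  proof -
    obtain xs ys where "c ps = xs @ x # ys" using split_list[OF \<open>x \<in> set (c ps)\<close>] by blast
    then have "ps = concat xs @ x @ (concat ys @ r ps)" using cr[of ps] by simp
    then show ?thesis using successively_fan_path[OF that(1), of u] successively_sublist by metis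
  qed
  have succ_r: "successively (fan u pss) (r ps)" if "ps \<in> set pss" for ps
    using successively_fan_path[OF that, of u] cr[of ps] by (metis successively_append_iff)
  show ?thesis
  proof (rule that)
    show "length ?C = (\<Sum>ps\<leftarrow>pss. length ps div l)" using cr by (simp add: length_concat comp_def)
    show "length x = l \<and> successively (fan u pss) x" if "x \<in> set ?C" for x
      using that succ cr by auto
    show "length (?R ! i) = length (pss ! i) mod l \<and> successively (fan u pss) (?R ! i)" if "i < length pss" for i
      using that cr succ_r by simp
    have "mset (concat qss) = mset (concat (concat (map c qss)) @ concat (map r qss))" for qss
    proof (induction qss)
      case (Cons ps qss)
      have "mset ps = mset (concat (c ps)) + mset (r ps)" using cr[of ps] by (metis mset_append)
      then show ?case using Cons by simp
    qed simp
    then show "mset (concat pss) = mset (concat ?C @ concat ?R)" .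
  qed simp
qed

lemma concat_take_drop: "concat xs = concat (take k xs) @ concat (drop k xs)"
  by (metis append_take_drop_id concat_append)

lemma fan_packing_paths:
  assumes lay: "fan_layout n u pss" and l: "0 < l" and t: "t \<le> (\<Sum>ps\<leftarrow>pss. length ps div l)"
  obtains qss where "path_packing (fan u pss) t l qss" "set (concat qss) \<subseteq> {..<n}"
proof -
  obtain C R where C: "length C = (\<Sum>ps\<leftarrow>pss. length ps div l)"
    "\<And>c. c \<in> set C \<Longrightarrow> length c = l \<and> successively (fan u pss) c"
    and m: "mset (concat pss) = mset (concat C @ concat R)"
    using fan_chunks[OF lay l] by metis
  have "distinct (concat pss)" "set (concat pss) \<subseteq> {..<n}" using lay by (auto simp: fan_layout_def simp del: set_concat)
  then have "distinct (concat C @ concat R)" "set (concat C @ concat R) \<subseteq> {..<n}"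
    using mset_eq_imp_distinct_iff[OF m] mset_eq_setD[OF m] by blast+
  then have d: "distinct (concat (take t C))" "set (concat (take t C)) \<subseteq> {..<n}"
    using concat_take_drop[of C t] by (simp_all only: distinct_append set_append Un_subset_iff)
  have "path_packing (fan u pss) t l (take t C)"
    unfolding path_packing_def using C t d by (auto dest: in_set_takeD simp del: set_concat)
  then show ?thesis using that d by blast
qed

text \<open>The remainders of \<open>A\<close> and \<open>B\<close>, joined through the hub, form a
  path with at least \<open>l\<close> vertices that is disjoint from all pieces of length
  \<open>l\<close>.\<close>

lemma fan_packing_hub:
  assumes lay: "fan_layout n u pss" and l: "0 < l" and t: "t \<le> (\<Sum>ps\<leftarrow>pss. length ps div l)"
    and pair: "mset pss = mset (A # B # rest)" "l \<le> Suc (length A mod l + length B mod l)"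
  obtains qss where "path_packing (fan u pss) (Suc t) l qss" "set (concat qss) \<subseteq> {..<n}"
proof -
  let ?pss = "A # B # rest"
  have fan_eq: "fan u pss = fan u ?pss" and lay': "fan_layout n u ?pss"
    using fan_mset_cong[OF pair(1)] lay by simp_all
  have sum_eq: "(\<Sum>ps\<leftarrow>pss. length ps div l) = (\<Sum>ps\<leftarrow>?pss. length ps div l)"
  proof -
    have "mset (map (\<lambda>ps. length ps div l) pss) = mset (map (\<lambda>ps. length ps div l) ?pss)"
      unfolding mset_map pair(1) ..
    then show ?thesis by (metis sum_mset_sum_list)
  qed
  obtain C R where C: "length C = (\<Sum>ps\<leftarrow>?pss. length ps div l)"
    "\<And>c. c \<in> set C \<Longrightarrow> length c = l \<and> successively (fan u ?pss) c"
    and R: "length R = length ?pss" "\<And>i. i < length ?pss \<Longrightarrow> length (R ! i) = length (?pss ! i) mod l \<and> successively (fan u ?pss) (R ! i)"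
    and m: "mset (concat ?pss) = mset (concat C @ concat R)"
    by (rule fan_chunks[OF lay' l]) (rule that)
  obtain RA RB R' where R': "R = RA # RB # R'" using R(1) by (metis Suc_length_conv length_Cons)
  have RA: "length RA = length A mod l" "successively (fan u ?pss) RA"
    and RB: "length RB = length B mod l" "successively (fan u ?pss) RB"
    using R(2)[of 0] R(2)[of 1] by (simp_all add: R')
  define w where "w = RA @ u # RB"
  have dl: "distinct (u # concat ?pss)" "set (u # concat ?pss) \<subseteq> {..<n}"
    using lay' unfolding fan_layout_def by blast+
  have m': "mset (u # concat ?pss) = mset (w @ concat C @ concat R')"
    using m by (simp add: w_def R')
  have d: "distinct (w @ concat C @ concat R')" "set (w @ concat C @ concat R') \<subseteq> {..<n}"
    using dl mset_eq_imp_distinct_iff[OF m'] mset_eq_setD[OF m'] by blast+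
  have in_pss: "set RA \<subseteq> set (concat ?pss)" "set RB \<subseteq> set (concat ?pss)"
    using mset_eq_setD[OF m] unfolding R' by (auto simp del: set_concat simp: concat.simps)
  have hub: "fan u ?pss x u" "fan u ?pss u x" if "x \<in> set (concat ?pss)" for x
    using that unfolding fan_def by blast+
  have "fan u ?pss (last RA) u" if "RA \<noteq> []" using in_pss(1) hub(1) last_in_set[OF that] by blast
  moreover have "fan u ?pss u (hd RB)" if "RB \<noteq> []" using in_pss(2) hub(2) hd_in_set[OF that] by blast
  ultimately have "successively (fan u ?pss) w"
    using RA RB unfolding w_def by (auto simp: successively_append_iff successively_Cons)
  then have sw: "successively (fan u ?pss) (take l w)"
    by (metis append_take_drop_id successively_append_iff)
  have lw: "length (take l w) = l" using pair(2) RA RB by (simp add: w_def)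
  have "set (take l w) \<subseteq> set w" by (rule set_take_subset)
  moreover have "set (concat (take t C)) \<subseteq> set (concat C)" using concat_take_drop[of C t] by (metis set_append Un_upper1)
  moreover have "distinct (concat (take t C))" using d(1) concat_take_drop[of C t] by (metis distinct_append)
  ultimately have "distinct (concat (take l w # take t C))" "set (concat (take l w # take t C)) \<subseteq> {..<n}"
    using d by (auto simp del: set_concat simp: concat.simps)
  moreover from this have "path_packing (fan u ?pss) (Suc t) l (take l w # take t C)"
    unfolding path_packing_def using C(1,2) t sum_eq sw lw by (auto dest: in_set_takeD simp del: set_concat)
  ultimately show ?thesis using that fan_eq by metis
qed

section \<open>Packings that a fan excludes\<close>

lemma fan_walk_in_path:
  assumes "distinct (concat pss)" "q \<noteq> []" "successively (fan u pss) q" "u \<notin> set q" "set q \<subseteq> set (concat pss)"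
  obtains ps where "ps \<in> set pss" "set q \<subseteq> set ps"
proof -
  have "\<exists>ps\<in>set pss. set q \<subseteq> set ps"
    using assms(2-5)
  proof (induction q rule: list_nonempty_induct)
    case (single x)
    then show ?case by auto
  next
    case (cons x q)
    then obtain ps where ps: "ps \<in> set pss" "set q \<subseteq> set ps" by (auto simp: successively_Cons)
    have "fan u pss x (hd q)" "hd q \<in> set q" using cons by (auto simp: successively_Cons)
    then have "links pss x (hd q) \<or> links pss (hd q) x" using cons.prems(2) unfolding fan_def by auto
    then obtain rs where "rs \<in> set pss" "x \<in> set rs" "hd q \<in> set rs" by (force simp: links_def)
    moreover have "set ys \<inter> set zs = {}" if "ys \<in> set pss" "zs \<in> set pss" "ys \<noteq> zs" for ys zs
      using assms(1) that by (auto simp: distinct_concat_iff)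
    ultimately have "rs = ps" using ps \<open>hd q \<in> set q\<close> by blast
    then show ?case using ps \<open>x \<in> set rs\<close> by auto
  qed
  then show ?thesis using that by blast
qed

lemma length_le_if_subset: "distinct xs \<Longrightarrow> set xs \<subseteq> set ys \<Longrightarrow> length xs \<le> length ys"
  by (metis List.finite_set card_length card_mono distinct_card le_trans)

text \<open>The hub cuts a path into at most two pieces, each within one rim path. Two pieces in the
  same rim path share its at most \<open>n1\<close> vertices; in different rim paths they have at
  most \<open>n1 + n2\<close> vertices together. With the hub this stays below
  \<open>l\<close>.\<close>

lemma fan_no_long_path:
  assumes lay: "fan_layout n u pss" and pss: "pss = P # rest"
    and len: "length P = n1" "\<And>ps. ps \<in> set rest \<Longrightarrow> length ps \<le> n2" "n2 \<le> n1" "n1 + n2 + 1 < l"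
  shows "\<not> (path_packing (fan u pss) 1 l qss \<and> set (concat qss) \<subseteq> {..<n})"
proof
  assume a: "path_packing (fan u pss) 1 l qss \<and> set (concat qss) \<subseteq> {..<n}"
  then obtain q where qss: "qss = [q]" by (auto simp: path_packing_def length_Suc_conv)
  have q: "length q = l" "successively (fan u pss) q" "distinct q" "set q \<subseteq> {..<n}"
    using a by (auto simp: path_packing_def qss)
  have d: "distinct (concat pss)" "set (concat pss) = {..<n} - {u}"
    using lay by (auto simp: fan_layout_def simp del: set_concat)
  have le: "length ps \<le> n1" if "ps \<in> set pss" for ps
    using that len pss by (auto intro: order_trans)
  have le2: "length ps + length rs \<le> n1 + n2" if "ps \<in> set pss" "rs \<in> set pss" "ps \<noteq> rs" for ps rs
    using that len le unfolding pss by (auto simp: add.commute add_mono)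
  have part: "\<exists>ps\<in>set pss. set xs \<subseteq> set ps" if xs: "xs \<noteq> []" "successively (fan u pss) xs" "u \<notin> set xs" "set xs \<subseteq> {..<n}" for xs
  proof -
    have "set xs \<subseteq> set (concat pss)" unfolding d(2) using xs(3,4) by auto
    then obtain ps where "ps \<in> set pss" "set xs \<subseteq> set ps"
      using fan_walk_in_path[OF d(1) xs(1-3)] by metis
    then show ?thesis by blast
  qed
  show False
  proof (cases "u \<in> set q")
    case False
    have "q \<noteq> []" using q(1) len(4) by auto
    then obtain ps where "ps \<in> set pss" "set q \<subseteq> set ps" using part q False by blast
    then have "l \<le> n1" using length_le_if_subset[OF q(3)] le q(1) by (meson order_trans)
    then show False using len(4) by simp
  next
    case True
    then obtain xs ys where s: "q = xs @ u # ys" by (meson split_list)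
    have xs: "successively (fan u pss) xs" "u \<notin> set xs" "set xs \<subseteq> {..<n}" "distinct xs"
      and ys: "successively (fan u pss) ys" "u \<notin> set ys" "set ys \<subseteq> {..<n}" "distinct ys"
      using q unfolding s by (auto simp: successively_append_iff successively_Cons)
    have "length xs + length ys \<le> n1 + n2"
    proof (cases "xs = [] \<or> ys = []")
      case True
      have one: "length zs \<le> n1" if zs: "successively (fan u pss) zs" "u \<notin> set zs" "set zs \<subseteq> {..<n}" "distinct zs" for zs
      proof (cases "zs = []")
        case False
        then obtain ps where "ps \<in> set pss" "set zs \<subseteq> set ps" using part[OF False zs(1,2,3)] by blast
        then show ?thesis using length_le_if_subset[OF zs(4)] le by (meson order_trans)
      qed simp
      show ?thesis using one[OF xs] one[OF ys] True by auto
    next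
      case False
      then obtain ps rs where ps: "ps \<in> set pss" "set xs \<subseteq> set ps" and rs: "rs \<in> set pss" "set ys \<subseteq> set rs"
        using part[OF _ xs(1,2,3)] part[OF _ ys(1,2,3)] False by blast
      show ?thesis
      proof (cases "ps = rs")
        case True
        have "length (xs @ ys) \<le> length ps"
          using q(3) ps rs True unfolding s by (intro length_le_if_subset) auto
        then show ?thesis using le[OF ps(1)] by simp
      next
        case False
        then have "length ps + length rs \<le> n1 + n2" using le2 ps rs by blast
        then show ?thesis using length_le_if_subset[OF xs(4) ps(2)] length_le_if_subset[OF ys(4) rs(2)] by simp
      qed
    qed
    then show False using q(1) len(4) by (simp add: s)
  qed
qed

lemma filter_containing_le_1: "distinct (concat qss) \<Longrightarrow> length (filter (\<lambda>q. u \<in> set q) qss) \<le> 1"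
proof (induction qss)
  case (Cons q qss)
  show ?case
  proof (cases "u \<in> set q")
    case True
    then have "\<forall>r\<in>set qss. u \<notin> set r" using Cons.prems by auto
    then have "filter (\<lambda>q. u \<in> set q) qss = []" by (simp add: filter_empty_conv)
    then show ?thesis by simp
  qed (use Cons in simp)
qed simp

lemma distinct_concat_filter: "distinct (concat xs) \<Longrightarrow> distinct (concat (filter P xs))"
  by (induction xs) auto

text \<open>At most one of the \<open>t\<close> disjoint paths uses the hub. The other
  \<open>t - 1\<close> avoid it, so each lies in a rim path with at least \<open>l\<close> vertices.
  Only \<open>P\<close> is that long, and it has fewer than \<open>(t - 1) * l\<close>
  vertices.\<close>

lemma fan_no_long_packing:
  assumes lay: "fan_layout n u pss" and pss: "pss = P # rest"
    and len: "length P < (t - 1) * l" "\<And>ps. ps \<in> set rest \<Longrightarrow> length ps < l"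
  shows "\<not> (path_packing (fan u pss) t l qss \<and> set (concat qss) \<subseteq> {..<n})"
proof
  assume a: "path_packing (fan u pss) t l qss \<and> set (concat qss) \<subseteq> {..<n}"
  then have q: "length qss = t" "\<And>q. q \<in> set qss \<Longrightarrow> length q = l \<and> successively (fan u pss) q" "distinct (concat qss)"
    "set (concat qss) \<subseteq> {..<n}" by (auto simp: path_packing_def simp del: set_concat)
  have "0 < l" using len(1) by (cases l) auto
  have d: "distinct (concat pss)" "set (concat pss) = {..<n} - {u}"
    using lay by (auto simp: fan_layout_def simp del: set_concat)
  define rss where "rss = filter (\<lambda>q. u \<notin> set q) qss"
  have "length rss + length (filter (\<lambda>q. u \<in> set q) qss) = t"
    using sum_length_filter_compl[of "\<lambda>q. u \<in> set q" qss] q(1) unfolding rss_def by simp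
  then have tr: "t - 1 \<le> length rss" using filter_containing_le_1[OF q(3), of u] by linarith
  have sub: "set r \<subseteq> set P" if "r \<in> set rss" for r
  proof -
    have r: "r \<in> set qss" "u \<notin> set r" using that by (auto simp: rss_def)
    have "r \<noteq> []" using q(2)[OF r(1)] \<open>0 < l\<close> by auto
    moreover have "set r \<subseteq> set (concat pss)" using d(2) q(4) r by fastforce
    ultimately obtain ps where ps: "ps \<in> set pss" "set r \<subseteq> set ps"
      using fan_walk_in_path[OF d(1)] q(2)[OF r(1)] r(2) by metis
    have "distinct r" using q(3) r(1) by (auto simp: distinct_concat_iff)
    then have "l \<le> length ps" using length_le_if_subset[OF _ ps(2)] q(2)[OF r(1)] by auto
    then have "ps = P" using ps(1) len(2) unfolding pss by fastforce
    then show ?thesis using ps(2) by simp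
  qed
  have "length (concat rss) \<le> length P"
    using distinct_concat_filter[OF q(3)] sub by (intro length_le_if_subset) (auto simp: rss_def)
  moreover have "length (concat rss) = length rss * l"
  proof -
    have "map length rss = replicate (length rss) l" using q(2) by (intro nth_equalityI) (auto simp: rss_def dest: nth_mem)
    then show ?thesis by (simp add: length_concat sum_list_replicate)
  qed
  moreover have "(t - 1) * l \<le> length rss * l" using tr by (rule mult_le_mono1)
  ultimately show False using len(1) by linarith
qed

subsection \<open>Optimal path sizes\<close>

text \<open>The test vector is the Perron vector of the spanning star at the hub, whose spectral
  radius is \<open>sqrt (real n - 1)\<close>; rim edges can only add to the form.\<close>

lemma fan_spectral_radius_ge:
  assumes lay: "fan_layout n u pss" and n: "2 \<le> n"
  shows "sqrt (real n - 1) \<le> spectral_radius_graph n (fan u pss)"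
proof -
  let ?E = "fan u pss" and ?s = "sqrt (real n - 1)"
  have E: "simple_graph n ?E" by (rule fan_simple_graph[OF lay])
  have V: "set (concat pss) = {..<n} - {u}" "u < n" using lay by (auto simp: fan_layout_def simp del: set_concat)
  define y where "y i = (if i = u then ?s else 1)" for i
  have s2: "?s * ?s = real n - 1" "0 \<le> ?s" using n by auto
  have cV: "card ({..<n} - {u}) = n - 1" using V by simp
  have "nbr_sum ?E y u = (\<Sum>j\<in>{..<n} - {u}. 1)"
    unfolding nbr_sum_def fan_nbrs_hub[OF lay] V(1) by (intro sum.cong) (auto simp: y_def)
  then have hub: "nbr_sum ?E y u = real n - 1" using cV n by (simp add: of_nat_diff)
  have rim: "?s \<le> nbr_sum ?E y i" if "i \<in> {..<n} - {u}" for i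
  proof -
    have "u \<in> {j. ?E i j}" using that V(1) unfolding fan_def by auto
    then have "y u \<le> nbr_sum ?E y i"
      unfolding nbr_sum_def using s2 finite_nbrs[OF E] by (intro member_le_sum) (auto simp: y_def)
    then show ?thesis by (simp add: y_def)
  qed
  have split: "(\<Sum>i<n. f i) = f u + (\<Sum>i\<in>{..<n} - {u}. f i)" for f :: "nat \<Rightarrow> real"
    using V(2) by (intro sum.remove) auto
  have "2 * ?s * (real n - 1) = ?s * (real n - 1) + (\<Sum>i\<in>{..<n} - {u}. ?s)"
    using cV n by (simp add: of_nat_diff algebra_simps)
  also have "\<dots> \<le> ?s * (real n - 1) + (\<Sum>i\<in>{..<n} - {u}. y i * nbr_sum ?E y i)"
    using rim by (intro add_left_mono sum_mono) (auto simp: y_def)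
  also have "\<dots> = adj_form n ?E y" unfolding adj_form_def split hub by (simp add: y_def)
  also have "\<dots> \<le> spectral_radius_graph n ?E * (\<Sum>i<n. (y i)\<^sup>2)"
    using n by (intro spectral_radius_rayleigh(1)[OF E]) auto
  also have "(\<Sum>i<n. (y i)\<^sup>2) = (real n - 1) + (\<Sum>i\<in>{..<n} - {u}. 1)"
    unfolding split using s2 by (intro arg_cong2[of _ _ _ _ "(+)"] sum.cong) (auto simp: y_def power2_eq_square)
  also have "\<dots> = 2 * (real n - 1)" using cV n by (simp add: of_nat_diff)
  finally have "?s * (2 * (real n - 1)) \<le> spectral_radius_graph n ?E * (2 * (real n - 1))" by (simp add: algebra_simps)
  then show ?thesis using n by (simp add: mult_le_cancel_right)
qed

section \<open>From extremal graphs to extremal path sizes\<close>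

lemma perron_vector_normalised:
  assumes E: "simple_graph n E" and "0 < n"
  obtains x u where "u < n" "x u = 1" "\<And>i. 0 \<le> x i" "\<And>i. i < n \<Longrightarrow> x i \<le> 1"
    "\<And>i. i < n \<Longrightarrow> nbr_sum E x i = spectral_radius_graph n E * x i"
proof -
  obtain x where x: "(\<Sum>i<n. (x i)\<^sup>2) = 1" "\<And>i. 0 \<le> x i"
    "\<And>i. i < n \<Longrightarrow> nbr_sum E x i = spectral_radius_graph n E * x i"
    using spectral_radius_rayleigh(2)[OF assms] by blast
  have "Max (x ` {..<n}) \<in> x ` {..<n}" using \<open>0 < n\<close> by (intro Max_in) auto
  then obtain u where u: "u < n" "x u = Max (x ` {..<n})" by auto
  have le: "x i \<le> x u" if "i < n" for i unfolding u(2) using that by (intro Max_ge) auto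
  have "x u \<noteq> 0"
  proof
    assume "x u = 0"
    then have "x i = 0" if "i < n" for i using le[OF that] x(2)[of i] by simp
    then show False using x(1) by simp
  qed
  then have pos: "0 < x u" using x(2)[of u] by simp
  show ?thesis
  proof (rule that[of u "\<lambda>i. x i / x u"])
    show "nbr_sum E (\<lambda>i. x i / x u) i = spectral_radius_graph n E * (x i / x u)" if "i < n" for i
      using x(3)[OF that] by (simp add: nbr_sum_def flip: sum_divide_distrib)
  qed (use u le pos x(2) in auto)
qed

text \<open>A vertex other than \<open>u\<close> has at most two neighbours in common with
  \<open>u\<close>, and a cycle among the neighbours of \<open>u\<close> would give a theta subgraph
  or a K(4). Non-neighbours of \<open>u\<close> are isolated in \<open>R\<close> and become
  one-vertex paths, so the fan is exactly \<open>E\<close> with these vertices made pendant at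
  \<open>u\<close>.\<close>

lemma outerplanar_neighbourhood_paths:
  assumes E: "simple_graph n E" and free: "\<not> has_theta E" "\<not> has_K4 E" and u: "u < n"
  obtains pss where "fan_layout n u pss"
    "\<And>i j. fan u pss i j \<longleftrightarrow> i \<noteq> j \<and> i < n \<and> j < n \<and> (i = u \<or> j = u \<or> E u i \<and> E u j \<and> E i j)"
proof -
  note sym = simple_graph_symp(1)[OF E] and irr = simple_graph_symp(2)[OF E]
  define R where "R i j \<longleftrightarrow> E i j \<and> E u i \<and> E u j" for i j
  have Rn: "i < n \<and> j < n \<and> i \<noteq> u \<and> j \<noteq> u \<and> i \<noteq> j" if "R i j" for i j
    using that E by (auto simp: R_def simple_graph_def)
  have symR: "symp R" using sym by (auto simp: R_def intro!: sympI dest: sympD)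
  obtain pss where pss: "[] \<notin> set pss" "distinct (concat pss)" "set (concat pss) = {..<n} - {u}"
    "\<And>x y. R x y \<longleftrightarrow> links pss x y \<or> links pss y x"
  proof (rule linear_forest_paths[of "{..<n} - {u}" R])
    show "symp R" by (rule symR)
    show "irreflp R" using Rn by (auto intro!: irreflpI)
    show "x \<in> {..<n} - {u}" if "R x y" for x y using Rn[OF that] by simp
    show "card {y. R x y} \<le> 2" for x
    proof (cases "x = u")
      case True
      then have "{y. R x y} = {}" using Rn by auto
      then show ?thesis by (metis card.empty zero_le)
    next
      case False
      have "finite {y. R x y}" using Rn by (intro finite_subset[of "{y. R x y}" "{..<n}"]) auto
      then show ?thesis using False by (intro theta_common_neighbours[OF free(1) sym irr, of u x]) (auto simp: R_def)
    qed
    show "\<not> R (last xs) (hd xs)" if xs: "distinct xs" "3 \<le> length xs" "successively R xs" for xs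
    proof
      assume close: "R (last xs) (hd xs)"
      have "E u x" if x: "x \<in> set xs" for x
      proof -
        obtain as bs where s: "xs = as @ x # bs" using x by (meson split_list)
        show ?thesis
        proof (cases bs)
          case Nil
          then show ?thesis using close s by (simp add: R_def)
        next
          case (Cons b bs')
          then have "R x b" using xs(3) s by (simp add: successively_append_iff)
          then show ?thesis by (simp add: R_def)
        qed
      qed
      moreover have "successively E xs" using xs(3) by (rule successively_mono) (simp add: R_def)
      moreover have "E (last xs) (hd xs)" using close by (simp add: R_def)
      ultimately show False using cycle_in_neighbourhood[OF sym irr xs(1,2)] free by blast
    qed
  qed auto
  have lay: "fan_layout n u pss"
    unfolding fan_layout_def using pss(1-3) u by (auto simp del: set_concat)
  have edges: "fan u pss i j \<longleftrightarrow> i \<noteq> j \<and> i < n \<and> j < n \<and> (i = u \<or> j = u \<or> E u i \<and> E u j \<and> E i j)" for i j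
  proof -
    have "fan u pss i j \<longleftrightarrow> (i = u \<and> j \<in> {..<n} - {u}) \<or> (j = u \<and> i \<in> {..<n} - {u}) \<or> R i j"
      unfolding fan_def pss(3) pss(4)[symmetric] by (simp add: pss(4))
    then show ?thesis using Rn[of i j] u by (auto simp: R_def)
  qed
  show ?thesis by (rule that[OF lay edges])
qed

text \<open>\<open>q\<close> is the smaller root of \<open>q\<^sup>2 - \<rho> * q + 1\<close>,
  written with the square root in the denominator so that the bound \<open>2 / \<rho>\<close> is
  immediate.\<close>

lemma q_plus_inverse:
  fixes \<rho> :: real
  assumes "2 < \<rho>"
  obtains q where "0 < q" "q < 1" "q \<le> 2 / \<rho>" "q + 1 / q = \<rho>"
proof -
  define d where "d = sqrt (\<rho>\<^sup>2 - 4)"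
  have "2\<^sup>2 < \<rho>\<^sup>2" using assms by (intro power_strict_mono) auto
  then have d: "d * d = \<rho>\<^sup>2 - 4" "0 < d" by (auto simp: d_def)
  define q where "q = 2 / (\<rho> + d)"
  have pos: "0 < \<rho> + d" using assms d by simp
  have h1: "1 / q = (\<rho> + d) / 2" by (simp add: q_def)
  have h2: "q = (\<rho> - d) / 2"
  proof -
    have "(\<rho> + d) * (\<rho> - d) = 4" using d(1) by (simp add: algebra_simps power2_eq_square)
    then show ?thesis using pos by (simp add: q_def field_simps)
  qed
  have "q + 1 / q = \<rho>" unfolding h1 unfolding h2 by (simp add: field_simps)
  moreover have "0 < q" "q < 1" "q \<le> 2 / \<rho>" using pos d assms by (auto simp: q_def intro!: divide_left_mono)
  ultimately show ?thesis using that by blast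
qed

text \<open>Reduces both cases of the theorem to the optimisation of path sizes in
  \<open>best\<close>. The bound on \<open>m\<close> is the lower bound on the degree of
  \<open>u\<close>, so the fan derived from a maximiser \<open>E\<close> is F-free. It therefore
  cannot beat \<open>E\<close>, which forces \<open>u\<close> to dominate, and then the fan is
  \<open>E\<close> itself.\<close>

lemma extremal_fan:
  assumes n: "12700000 \<le> n" and m: "real m \<le> 99 / 100 * (real n - 1)"
    and ls: "sum_list ls = n - 1" "0 \<notin> set ls"
    and free: "\<not> contains_subgraph n (K1_join_paths ls) m F"
    and best: "\<And>u pss q. fan_layout n u pss \<Longrightarrow> \<not> contains_subgraph n (fan u pss) m F \<Longrightarrow>
      0 < q \<Longrightarrow> q < 1 \<Longrightarrow> q \<le> 2 / sqrt (real n - 1) \<Longrightarrow>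
      (\<Sum>x\<leftarrow>map length pss. path_gap q x) \<le> (\<Sum>x\<leftarrow>ls. path_gap q x) \<Longrightarrow> mset (map length pss) = mset ls"
  shows "extremal_OP n m F (K1_join_paths ls)"
proof -
  let ?X = "K1_join_paths ls" and ?r = "sqrt (real n - 1)"
  have Suc_sum: "Suc (sum_list ls) = n" using ls(1) n by simp
  have X_lay: "fan_layout n 0 (blocks 1 ls)"
    using K1_join_paths_layout[OF ls(2)] unfolding Suc_sum .
  have X: "OP_free n m F ?X"
    unfolding OP_free_def using free fan_simple_graph[OF X_lay] fan_outerplanar[OF X_lay]
    by (simp add: K1_join_paths_fan)
  have rX: "?r \<le> spectral_radius_graph n ?X"
    unfolding K1_join_paths_fan using fan_spectral_radius_ge[OF X_lay] n by simp
  have "graph_iso n E ?X"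
    if E: "OP_free n m F E" and max: "\<And>H. OP_free n m F H \<Longrightarrow> spectral_radius_graph n H \<le> spectral_radius_graph n E" for E
  proof -
    let ?\<rho> = "spectral_radius_graph n E"
    have sE: "simple_graph n E" "outerplanar n E" "\<not> contains_subgraph n E m F"
      using E by (auto simp: OP_free_def)
    have th: "\<not> has_theta E" "\<not> has_K4 E" using outerplanar_no_theta_K4[OF sE(1,2)] by auto
    have X_le: "spectral_radius_graph n ?X \<le> ?\<rho>" by (rule max[OF X])
    have r: "?r \<le> ?\<rho>" using X_le rX by simp
    have "(3563::real)\<^sup>2 \<le> real n - 1" using n by simp
    then have r_big: "3563 \<le> ?r" by (rule real_le_rsqrt)
    have \<rho>2: "real n - 1 \<le> ?\<rho>\<^sup>2"
      using power_mono[OF r, of 2] n by simp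
    obtain x u where u: "u < n" "x u = 1" and x: "\<And>i. 0 \<le> x i" "\<And>i. i < n \<Longrightarrow> x i \<le> 1"
      and eig: "\<And>i. i < n \<Longrightarrow> nbr_sum E x i = ?\<rho> * x i"
      using perron_vector_normalised[OF sE(1)] n by (metis gr0I not_numeral_le_zero)
    have \<rho>0: "0 < ?\<rho>" using r r_big by linarith
    have "99 / 100 * ?\<rho>\<^sup>2 \<le> real (card {j. E u j})"
      by (rule perron_non_neighbours(1)[where x = x and u = u and E = E and n = n])
        (rule sE(1) th(1) n \<rho>0 \<rho>2 eig x u; assumption)+
    moreover have "99 / 100 * (real n - 1) \<le> 99 / 100 * ?\<rho>\<^sup>2"
      using \<rho>2 by (intro mult_left_mono) auto
    ultimately have "real m \<le> real (card {j. E u j})" using m by (meson order_trans)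
    then have m_le: "m \<le> card {j. E u j}" by simp
    obtain pss where lay: "fan_layout n u pss" and edges:
      "\<And>i j. fan u pss i j \<longleftrightarrow> i \<noteq> j \<and> i < n \<and> j < n \<and> (i = u \<or> j = u \<or> E u i \<and> E u j \<and> E i j)"
      using outerplanar_neighbourhood_paths[OF sE(1) th u(1)] by blast
    have fan_graph: "simple_graph n (fan u pss)" by (rule fan_simple_graph[OF lay])
    have fan_free: "\<not> contains_subgraph n (fan u pss) m F"
    proof
      assume c: "contains_subgraph n (fan u pss) m F"
      have "contains_subgraph n E m F"
        by (rule contains_subgraph_replace[OF sE(1) fan_graph m_le _ c]) (auto simp: edges)
      then show False using sE(3) by blast
    qed
    have "OP_free n m F (fan u pss)"
      unfolding OP_free_def using fan_graph fan_outerplanar[OF lay] fan_free by blast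
    then have le: "spectral_radius_graph n (fan u pss) \<le> ?\<rho>" by (rule max)
    have dominating: "E u w" if w: "w < n" "w \<noteq> u" for w
    proof (rule ccontr)
      assume nw: "\<not> E u w"
      have small: "nbr_sum E x v < 1" if "v < n" "v \<noteq> u" "\<not> E u v" for v
        by (rule perron_non_neighbours(2)[where x = x and u = u and E = E and n = n])
          (rule sE(1) th(1) n \<rho>0 \<rho>2 eig x u that; assumption)+
      have "?\<rho> < spectral_radius_graph n (fan u pss)"
        by (rule spectral_radius_star_increase[where x = x and u = u and E = E and n = n and w = w])
          (rule sE(1) fan_graph u eig x(1) edges small w nw; assumption)+
      then show False using le by simp
    qed
    have "fan u pss i j = E i j" for i j
      unfolding edges using dominating[of i] dominating[of j] sE(1) by (auto simp: simple_graph_def)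
    then have fan_E: "fan u pss = E" by (intro ext)
    obtain q where q: "0 < q" "q < 1" "q \<le> 2 / ?\<rho>" "q + 1 / q = ?\<rho>"
    proof -
      have "2 < ?\<rho>" using r r_big by linarith
      from q_plus_inverse[OF this] show thesis using that by metis
    qed
    have "0 < ?r" using r_big by linarith
    then have "2 / ?\<rho> \<le> 2 / ?r" using r \<rho>0 by (intro divide_left_mono mult_pos_pos) auto
    then have q_le: "q \<le> 2 / ?r" using q(3) by simp
    have "(\<Sum>x\<leftarrow>map length pss. path_gap q x) \<le> (\<Sum>x\<leftarrow>map length (blocks 1 ls). path_gap q x)"
      by (rule fan_path_gap_compare[OF lay X_lay q(1,2)])
        (use q(4) X_le in \<open>simp_all add: fan_E K1_join_paths_fan\<close>)
    then have gaps: "(\<Sum>x\<leftarrow>map length pss. path_gap q x) \<le> (\<Sum>x\<leftarrow>ls. path_gap q x)"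
      unfolding length_blocks .
    have "mset (map length pss) = mset (map length (blocks 1 ls))"
      unfolding length_blocks by (rule best[OF lay fan_free q(1,2) q_le gaps])
    then have "graph_iso n (fan u pss) (fan 0 (blocks 1 ls))" by (rule fan_iso_mset[OF lay X_lay])
    then show ?thesis by (simp only: fan_E K1_join_paths_fan)
  qed
  then show ?thesis unfolding extremal_OP_def using X by blast
qed

text \<open>All but \<open>B\<close> of the \<open>r\<^sup>2\<close> rim vertices lie on paths with
  at most \<open>s\<close> vertices, which makes at least \<open>(r\<^sup>2 - B) / s\<close>
  components. Each of them costs at least \<open>1 - 2 * q\<close>, hence at least
  \<open>1 - 4 / r\<close>, and this correction amounts to at most \<open>4 * r\<close> in
  total.\<close>

lemma path_gap_count_bound:
  fixes r B C :: real
  assumes q: "0 < q" "q < 1" "q \<le> 2 / r" and r: "0 < r" "real (sum_list a) = r\<^sup>2" and s: "1 \<le> s"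
    and B: "real (\<Sum>x\<leftarrow>filter (\<lambda>x. s < x) a. x) \<le> B" "0 \<le> B"
    and C: "(\<Sum>x\<leftarrow>a. path_gap q x) \<le> C" "0 \<le> C"
  shows "r\<^sup>2 - B - 4 * r \<le> real s * C"
proof (cases "r\<^sup>2 \<le> B")
  case True
  then have "r\<^sup>2 - B - 4 * r \<le> 0" using r(1) by simp
  also have "0 \<le> real s * C" using C(2) by simp
  finally show ?thesis .
next
  case False
  let ?g = "path_gap q 1"
  have g0: "0 \<le> ?g" by (rule path_gap_nonneg[OF q(1,2)])
  have g1: "1 - 4 / r \<le> ?g" using path_gap_1_ge[OF q(1,2)] q(3) by simp
  have "r\<^sup>2 - B - 4 * r \<le> (r\<^sup>2 - B) * (1 - 4 / r)"
  proof -
    have "(r\<^sup>2 - B) * (1 - 4 / r) = r\<^sup>2 - B - 4 * r + 4 * B / r"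
      using r(1) by (simp add: field_simps power2_eq_square)
    moreover have "0 \<le> 4 * B / r" using r(1) B(2) by simp
    ultimately show ?thesis by linarith
  qed
  also have "\<dots> \<le> (r\<^sup>2 - B) * ?g" using g1 False by (intro mult_left_mono) auto
  also have "\<dots> \<le> (real (sum_list a) - real (\<Sum>x\<leftarrow>filter (\<lambda>x. s < x) a. x)) * ?g"
    using B(1) r(2) g0 by (intro mult_right_mono) auto
  also have "\<dots> \<le> real s * C"
  proof -
    have "(real (sum_list a) - real (\<Sum>x\<leftarrow>filter (\<lambda>x. s < x) a. x)) * ?g / real s \<le> C"
      using path_gap_count_lower[OF q(1,2) s, of a] C(1) by (rule order_trans)
    then show ?thesis using s by (simp add: pos_divide_le_eq mult.commute)
  qed
  finally show ?thesis .
qed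

section \<open>Optimality of the claimed path sizes\<close>

lemma H_OP_sizes_eq:
  "H_OP_sizes n n1 n2 = [n1] @ replicate ((n - 1 - n1) div n2) n2 @
    (if (n - 1 - n1) mod n2 = 0 then [] else [(n - 1 - n1) mod n2])"
  unfolding H_OP_sizes_def Let_def minus_div_mult_eq_mod ..

lemma sum_list_H_OP_sizes:
  assumes "n1 \<le> n - 1"
  shows "sum_list (H_OP_sizes n n1 n2) = n - 1"
  using assms div_mult_mod_eq[of "n - 1 - n1" n2] unfolding H_OP_sizes_eq
  by (auto simp: sum_list_replicate)

lemma H_OP_sizes_gap:
  assumes "n1 \<le> n - 1" "0 < q"
  shows "(\<Sum>x\<leftarrow>H_OP_sizes n n1 n2. path_gap q x) \<le> real ((n - 1 - n1) div n2) + 2"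
proof -
  have "(\<Sum>x\<leftarrow>xs. path_gap q x) \<le> real (length xs)" for xs
    using path_gap_le_1[OF assms(2)] by (induction xs) (auto intro: add_mono simp: add.commute)
  then have "(\<Sum>x\<leftarrow>H_OP_sizes n n1 n2. path_gap q x) \<le> real (length (H_OP_sizes n n1 n2))" .
  also have "\<dots> \<le> real ((n - 1 - n1) div n2) + 2"
    unfolding H_OP_sizes_eq by simp
  finally show ?thesis .
qed

lemma H_OP_sizes_majorized:
  assumes n: "1 \<le> n1" "1 \<le> n2" "n2 \<le> n1" "n1 \<le> n - 1" and a: "sum_list a = n - 1" "0 \<notin> set a"
    and excess: "\<And>k. n2 \<le> k \<Longrightarrow> (\<Sum>x\<leftarrow>a. x - k) \<le> n1 - k"
    and q: "0 < q" "q < 1" and le: "(\<Sum>x\<leftarrow>a. path_gap q x) \<le> (\<Sum>x\<leftarrow>H_OP_sizes n n1 n2. path_gap q x)"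
  shows "mset a = mset (H_OP_sizes n n1 n2)"
proof (rule path_gap_majorization[OF q _ _ le a(2)])
  let ?c = "(n - 1 - n1) div n2" and ?r = "(n - 1 - n1) mod n2"
  show "sum_list a = sum_list (H_OP_sizes n n1 n2)" using a sum_list_H_OP_sizes n by simp
  show "0 \<notin> set (H_OP_sizes n n1 n2)" using n unfolding H_OP_sizes_eq by auto
  have r: "?r < n2" using n by simp
  have sum: "sum_list a = n1 + ?c * n2 + ?r" using a(1) n(4) div_mult_mod_eq[of "n - 1 - n1" n2] by simp
  show "trunc_sum (H_OP_sizes n n1 n2) k \<le> trunc_sum a k" for k
  proof -
    have "trunc_sum (H_OP_sizes n n1 n2) k = min n1 k + ?c * min n2 k + min ?r k"
      unfolding H_OP_sizes_eq trunc_sum_def by (simp add: sum_list_replicate map_replicate_const)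
    also have "\<dots> \<le> trunc_sum a k" by (rule trunc_sum_ge[OF n(3) r sum excess])
    finally show ?thesis .
  qed
qed

lemma two_of_filter:
  assumes "2 \<le> length (filter P xs)"
  obtains x y rest where "mset xs = mset (x # y # rest)" "P x" "P y"
proof -
  obtain x y ys where f: "filter P xs = x # y # ys"
    using assms by (cases "filter P xs" rule: remdups_adj.cases) auto
  have "mset xs = mset (filter P xs) + mset (filter (\<lambda>x. \<not> P x) xs)" by simp
  then have "mset xs = mset (x # y # (ys @ filter (\<lambda>x. \<not> P x) xs))" unfolding f by simp
  moreover have "x \<in> set (filter P xs)" "y \<in> set (filter P xs)" using f by auto
  then have "P x" "P y" by auto
  ultimately show ?thesis using that by blast
qed

text \<open>Any two sizes add up to at most \<open>l - 2 = n1 + n2\<close>, so all sizes except a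
  largest one, \<open>A\<close>, are at most \<open>n2\<close>. If \<open>n2\<close> occurs among
  them, then \<open>A \<le> n1\<close> and majorisation applies. Otherwise they are at most
  \<open>n2 - 1\<close>, and the number of components exceeds that of the claimed sizes by too
  much.\<close>

lemma best_sizes_one_path:
  fixes a :: "nat list" and r :: real
  assumes l: "4 \<le> l" and a: "sum_list a = n - 1" "0 \<notin> set a" "\<And>x. x \<in> set a \<Longrightarrow> x < l"
    and pair: "\<And>x y rest. mset a = mset (x # y # rest) \<Longrightarrow> x + y + 2 \<le> l"
    and r: "real (n - 1) = r\<^sup>2" "3563 \<le> r" "508 / 100 * real ((l - 2) div 2) \<le> r"
    and q: "0 < q" "q < 1" "q \<le> 2 / r"
    and le: "(\<Sum>x\<leftarrow>a. path_gap q x) \<le> (\<Sum>x\<leftarrow>H_OP_sizes n ((l - 1) div 2) ((l - 2) div 2). path_gap q x)"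
  shows "mset a = mset (H_OP_sizes n ((l - 1) div 2) ((l - 2) div 2))"
proof -
  define n2 where "n2 = (l - 2) div 2"
  define n1 where "n1 = (l - 1) div 2"
  have le': "(\<Sum>x\<leftarrow>a. path_gap q x) \<le> (\<Sum>x\<leftarrow>H_OP_sizes n n1 n2. path_gap q x)"
    using le unfolding n1_def n2_def .
  have nn: "1 \<le> n2" "n2 \<le> n1" "n1 + n2 + 2 = l" "n1 \<le> n2 + 1" using l unfolding n1_def n2_def by linarith+
  have r5: "508 / 100 * real n2 \<le> r" using r(3) by (simp add: n2_def)
  have rr: "3563 * r \<le> r\<^sup>2" using r(2) by (simp add: power2_eq_square)
  have n2_sq: "25 * (real n2)\<^sup>2 \<le> r\<^sup>2"
  proof -
    have "(5 * real n2)\<^sup>2 \<le> r\<^sup>2" using r5 by (intro power_mono) auto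
    then show ?thesis by (simp add: power_mult_distrib)
  qed
  have l_n: "l < n - 1"
  proof -
    have "real l \<le> 2 * r" using r5 nn r(2) by linarith
    then have "real l < r\<^sup>2" using rr r(2) by linarith
    then show ?thesis unfolding r(1)[symmetric] by simp
  qed
  have "a \<noteq> []" using a(1) l_n by auto
  define A where "A = Max (set a)"
  have A: "A \<in> set a" "\<And>x. x \<in> set a \<Longrightarrow> x \<le> A" using \<open>a \<noteq> []\<close> by (auto simp: A_def)
  define b where "b = remove1 A a"
  have ab: "mset a = mset (A # b)" using A(1) by (simp add: b_def)
  have b_pair: "A + x + 2 \<le> l" if "x \<in> set b" for x
    using pair[of A x "remove1 x b"] that ab by simp
  have b_A: "x \<le> A" if "x \<in> set b" for x using A(2) that by (auto simp: b_def dest: notin_set_remove1 set_remove1_subset[THEN subsetD])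
  have b_n2: "x \<le> n2" if "x \<in> set b" for x using b_pair[OF that] b_A[OF that] nn by linarith
  show ?thesis
  proof (cases "n2 \<in> set b")
    case True
    then have "A \<le> n1" using b_pair[OF True] nn by linarith
    have excess: "(\<Sum>x\<leftarrow>a. x - k) \<le> n1 - k" if "n2 \<le> k" for k
    proof -
      have "mset (map (\<lambda>x. x - k) a) = mset (map (\<lambda>x. x - k) (A # b))" unfolding mset_map ab ..
      then have "(\<Sum>x\<leftarrow>a. x - k) = (A - k) + (\<Sum>x\<leftarrow>b. x - k)" by (metis sum_mset_sum_list list.simps(9) sum_list.Cons)
      also have "(\<Sum>x\<leftarrow>b. x - k) = 0" using b_n2 that by (auto simp: sum_list_eq_0_iff intro: order_trans)
      finally show ?thesis using \<open>A \<le> n1\<close> by simp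
    qed
    have n1: "1 \<le> n1" "n1 \<le> n - 1" using nn l_n by linarith+
    have "mset a = mset (H_OP_sizes n n1 n2)"
      by (rule H_OP_sizes_majorized[OF n1(1) nn(1,2) n1(2) a(1,2) excess q(1,2) le'])
    then show ?thesis unfolding n1_def n2_def .
  next
    case False
    have b_s: "x \<le> n2 - 1" if x: "x \<in> set b" for x
    proof -
      have "x \<noteq> n2" using x False by metis
      then show ?thesis using b_n2[OF x] by linarith
    qed
    have sum_ab: "n - 1 = A + sum_list b" using a(1) ab by (metis sum_mset_sum_list sum_list.Cons)
    have A_l: "A < l" using A(1) a(3) by blast
    have s: "1 \<le> n2 - 1"
    proof (rule ccontr)
      assume "\<not> ?thesis"
      then have "\<forall>x\<in>set b. x = 0" using b_s by fastforce
      then have "sum_list b = 0" by simp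
      then show False using sum_ab A_l l_n by linarith
    qed
    let ?c = "(n - 1 - n1) div n2"
    have "mset (filter (\<lambda>x. n2 - 1 < x) a) = mset (filter (\<lambda>x. n2 - 1 < x) (A # b))" unfolding mset_filter ab ..
    then have "(\<Sum>x\<leftarrow>filter (\<lambda>x. n2 - 1 < x) a. x) = (\<Sum>x\<leftarrow>filter (\<lambda>x. n2 - 1 < x) (A # b). x)"
      by (metis list.map_ident sum_mset_sum_list)
    also have "\<dots> \<le> l"
    proof -
      have "filter (\<lambda>x. n2 - 1 < x) b = []" using b_s by (auto simp: filter_empty_conv not_less)
      then show ?thesis using A_l by simp
    qed
    finally have B: "real (\<Sum>x\<leftarrow>filter (\<lambda>x. n2 - 1 < x) a. x) \<le> real l" by (simp only: of_nat_le_iff)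
    have C: "(\<Sum>x\<leftarrow>a. path_gap q x) \<le> real ?c + 2"
      by (rule order_trans[OF le' H_OP_sizes_gap]) (use q(1) nn l_n in linarith)+
    have bound: "r\<^sup>2 - real l - 4 * r \<le> real (n2 - 1) * (real ?c + 2)"
      using path_gap_count_bound[OF q _ _ s B _ C] a(1) r(1,2) by simp
    have c: "real ?c * real n2 \<le> r\<^sup>2"
    proof -
      have "?c * n2 \<le> n - 1" using div_times_less_eq_dividend[of "n - 1 - n1" n2] by linarith
      then show ?thesis unfolding r(1)[symmetric] by (metis of_nat_le_iff of_nat_mult)
    qed
    have s_eq: "real (n2 - 1) = real n2 - 1" using s by (simp add: of_nat_diff)
    have "real n2 * (r\<^sup>2 - real l - 4 * r) \<le> real n2 * ((real n2 - 1) * (real ?c + 2))"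
      using bound unfolding s_eq by (intro mult_left_mono) auto
    also have "\<dots> = (real n2 - 1) * (real ?c * real n2 + 2 * real n2)" by (simp add: algebra_simps)
    also have "\<dots> \<le> (real n2 - 1) * (r\<^sup>2 + 2 * real n2)" using c s nn(1) by (intro mult_left_mono add_right_mono) auto
    also have "\<dots> \<le> real n2 * r\<^sup>2 - r\<^sup>2 + 2 * (real n2)\<^sup>2" by (simp add: algebra_simps power2_eq_square)
    \<comment> \<open>Since \<open>l \<le> 2 * n2 + 3\<close>, the right side is at most
      \<open>4 * (n2)^2 + 3 * n2 + 4 * n2 * r\<close>. With \<open>n2 \<le> r / 5.08\<close> this is
      at most \<open>4/25 + 400/508 + 1/3563\<close> times \<open>r\<^sup>2\<close>, a factor below
      1.\<close>
    finally have "r\<^sup>2 \<le> real n2 * real l + 4 * (real n2 * r) + 2 * (real n2)\<^sup>2" by (simp add: algebra_simps)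
    moreover have "real n2 * real l \<le> real n2 * (2 * real n2 + 3)" using nn by (intro mult_left_mono) auto
    moreover have "real n2 * (2 * real n2 + 3) = 2 * (real n2)\<^sup>2 + 3 * real n2" by (simp add: algebra_simps power2_eq_square)
    moreover have "real n2 * r \<le> 100 / 508 * r\<^sup>2"
    proof -
      have "real n2 * r \<le> (100 / 508 * r) * r" using r5 r(2) by (intro mult_right_mono) auto
      then show ?thesis by (simp add: power2_eq_square)
    qed
    moreover have "3 * real n2 \<le> r" using r5 r(2) by linarith
    ultimately have False using n2_sq rr r(2) by linarith
    then show ?thesis ..
  qed
qed

text \<open>If the quotients \<open>x div l\<close> add up to at most \<open>t - 2\<close>, then
  \<open>excess_le_div\<close> gives the excess bound for majorisation. If they add up to
  \<open>t - 1\<close>, at most one size below \<open>l\<close> exceeds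
  \<open>(l - 2) div 2\<close>, and the sizes from \<open>l\<close> on sum to at most
  \<open>2 * l * (t - 1)\<close>. So most vertices lie on paths with at most half of
  \<open>l - 1\<close> vertices, which makes almost twice as many components as claimed.\<close>

lemma best_sizes_many_paths:
  fixes a :: "nat list" and r :: real
  assumes l: "3 \<le> l" and t: "2 \<le> t" and a: "sum_list a = n - 1" "0 \<notin> set a"
    and div: "(\<Sum>x\<leftarrow>a. x div l) < t"
    and pair: "\<And>x y rest. (\<Sum>x\<leftarrow>a. x div l) = t - 1 \<Longrightarrow> mset a = mset (x # y # rest) \<Longrightarrow> x mod l + y mod l + 2 \<le> l"
    and r: "real (n - 1) = r\<^sup>2" "3563 \<le> r" "65 / 10 * real (t * l) \<le> r\<^sup>2"
    and q: "0 < q" "q < 1" "q \<le> 2 / r"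
    and le: "(\<Sum>x\<leftarrow>a. path_gap q x) \<le> (\<Sum>x\<leftarrow>H_OP_sizes n (t * l - l - 1) (l - 1). path_gap q x)"
  shows "mset a = mset (H_OP_sizes n (t * l - l - 1) (l - 1))"
proof -
  have tl: "2 * l \<le> t * l" using t by (rule mult_le_mono1)
  define n1 where "n1 = t * l - l - 1"
  define n2 where "n2 = l - 1"
  have le': "(\<Sum>x\<leftarrow>a. path_gap q x) \<le> (\<Sum>x\<leftarrow>H_OP_sizes n n1 n2. path_gap q x)"
    using le unfolding n1_def n2_def .
  have nn: "1 \<le> n1" "1 \<le> n2" "n2 \<le> n1" using l tl unfolding n1_def n2_def by linarith+
  have tl_n: "65 * (t * l) \<le> 10 * (n - 1)"
  proof -
    have "65 * real (t * l) \<le> 10 * real (n - 1)" using r(1,3) by linarith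
    then have "real (65 * (t * l)) \<le> real (10 * (n - 1))" by (simp only: of_nat_mult of_nat_numeral)
    then show ?thesis by (simp only: of_nat_le_iff)
  qed
  have n1_n: "n1 \<le> n - 1" unfolding n1_def using tl_n by linarith
  show ?thesis
  proof (cases "(\<Sum>x\<leftarrow>a. x div l) = t - 1")
    case False
    have excess: "(\<Sum>x\<leftarrow>a. x - k) \<le> n1 - k" if "n2 \<le> k" for k
    proof (cases "\<exists>x\<in>set a. k < x")
      case True
      have "(\<Sum>x\<leftarrow>a. x - k) + k \<le> l * (\<Sum>x\<leftarrow>a. x div l) + (l - 1)"
        using excess_le_div[of l k a] that True l by (simp add: n2_def)
      also have "\<dots> \<le> l * (t - 2) + (l - 1)" using False div by (intro add_right_mono mult_le_mono2) simp
      also have "\<dots> = n1" using t l tl by (simp add: n1_def diff_mult_distrib2 mult.commute)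
      finally show ?thesis by simp
    next
      case False
      then have "(\<Sum>x\<leftarrow>a. x - k) = 0" by (auto simp: not_less)
      then show ?thesis by (metis zero_le)
    qed
    have "mset a = mset (H_OP_sizes n n1 n2)"
      by (rule H_OP_sizes_majorized[OF nn n1_n a(1,2) excess q(1,2) le'])
    then show ?thesis unfolding n1_def n2_def .
  next
    case True
    define s where "s = (l - 2) div 2"
    let ?big = "\<lambda>x. s < x \<and> x < l"
    have few: "length (filter ?big a) \<le> 1"
    proof (rule ccontr)
      assume "\<not> ?thesis"
      then have "2 \<le> length (filter ?big a)" by simp
      then obtain x y rest where "mset a = mset (x # y # rest)" "?big x" "?big y" by (rule two_of_filter)
      then show False using pair[OF True, of x y rest] l by (auto simp: s_def)
    qed
    have "(\<Sum>x\<leftarrow>filter (\<lambda>x. s < x) b. x) \<le> 2 * l * (\<Sum>x\<leftarrow>b. x div l) + l * length (filter ?big b)" for b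
    proof (induction b)
      case (Cons x b)
      have "x \<le> 2 * l * (x div l)" if "l \<le> x"
      proof -
        have "1 \<le> x div l" using that l by (simp add: div_greater_zero_iff Suc_le_eq)
        then have "l \<le> l * (x div l)" by simp
        moreover have "x = l * (x div l) + x mod l" "x mod l < l" using l by simp_all
        ultimately show ?thesis by linarith
      qed
      then show ?case using Cons by (auto simp: distrib_left not_less)
    qed simp
    from this[of a] have "(\<Sum>x\<leftarrow>filter (\<lambda>x. s < x) a. x) \<le> 2 * l * (t - 1) + l * 1"
      using few unfolding True by (meson add_left_mono mult_le_mono2 order_trans)
    also have "\<dots> \<le> 2 * (t * l)" using t by (cases t) (auto simp: algebra_simps)
    finally have B: "(\<Sum>x\<leftarrow>filter (\<lambda>x. s < x) a. x) \<le> 2 * (t * l)" .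
    \<comment> \<open>For \<open>l = 3\<close> the threshold is 0 and \<open>B\<close> bounds the
      number of all rim vertices, which is far larger.\<close>
    have s: "1 \<le> s"
    proof (rule ccontr)
      assume "\<not> ?thesis"
      then have "s = 0" by simp
      then have "filter (\<lambda>x. s < x) a = a" using a(2) by (auto simp: filter_id_conv intro: Suc_leI gr0I)
      then have "n - 1 \<le> 2 * (t * l)" using B a(1) by simp
      moreover have "0 < t * l" using t l by simp
      ultimately show False using tl_n by linarith
    qed
    let ?c = "(n - 1 - n1) div n2"
    have C: "(\<Sum>x\<leftarrow>a. path_gap q x) \<le> real ?c + 2"
      by (rule order_trans[OF le' H_OP_sizes_gap[OF n1_n q(1)]])
    have B': "real (\<Sum>x\<leftarrow>filter (\<lambda>x. s < x) a. x) \<le> 2 * real (t * l)" using B by (metis of_nat_le_iff of_nat_mult of_nat_numeral)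
    have bound: "r\<^sup>2 - 2 * real (t * l) - 4 * r \<le> real s * (real ?c + 2)"
      using path_gap_count_bound[OF q _ _ s B' _ C] a(1) r(1,2) by simp
    have s2: "2 * s \<le> n2" using l by (simp add: s_def n2_def)
    have "2 * (s * ?c) \<le> n - 1"
    proof -
      have "2 * s * ?c \<le> n2 * ?c" using s2 by (rule mult_le_mono1)
      also have "\<dots> \<le> n - 1 - n1" by (rule times_div_less_eq_dividend)
      finally show ?thesis by simp
    qed
    then have "2 * (real s * real ?c) \<le> r\<^sup>2" unfolding r(1)[symmetric] by (metis of_nat_le_iff of_nat_mult of_nat_numeral)
    moreover have "real s * (real ?c + 2) = real s * real ?c + 2 * real s" by (simp add: algebra_simps)
    moreover have "2 * real s \<le> real (t * l) / 2"
    proof -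
      have "4 * s \<le> 2 * l" using s2 by (simp add: n2_def)
      then have "real (4 * s) \<le> real (t * l)" using tl by (simp only: of_nat_le_iff)
      moreover have "real (4 * s) = 4 * real s" by simp
      ultimately show ?thesis by linarith
    qed
    moreover have "3563 * r \<le> r\<^sup>2" using r(2) by (simp add: power2_eq_square)
    \<comment> \<open>What remains is \<open>r\<^sup>2 / 2 \<le> 5/2 * (t * l) + 4 * r\<close>,
      which fails because \<open>t * l \<le> r\<^sup>2 / 6.5\<close> and
      \<open>r \<ge> 3563\<close>.\<close>
    ultimately have False using bound r by linarith
    then show ?thesis ..
  qed
qed


section \<open>Freeness of fans as arithmetic of path sizes, and the two cases\<close>

lemma contains_paths_packing:
  assumes "symp G"
  shows "contains_subgraph n G (t * l) (paths_union (replicate t l)) \<longleftrightarrow>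
    (\<exists>qss. path_packing G t l qss \<and> set (concat qss) \<subseteq> {..<n})"
  unfolding contains_paths_iff[OF assms] path_packing_def by blast

text \<open>Each violated inequality produces a packing: pieces of the rim paths alone in the first
  case, \<open>t - 1\<close> such pieces and one path through the hub in the second.\<close>

lemma fan_free_sizes:
  assumes lay: "fan_layout n u pss" and "0 < l"
    and free: "\<not> contains_subgraph n (fan u pss) (t * l) (paths_union (replicate t l))"
  shows "(\<Sum>x\<leftarrow>map length pss. x div l) < t"
    and "t \<le> Suc (\<Sum>x\<leftarrow>map length pss. x div l) \<Longrightarrow> 0 < t \<Longrightarrow>
      mset (map length pss) = mset (x # y # rest) \<Longrightarrow> x mod l + y mod l + 2 \<le> l"
proof -
  note no = free[unfolded contains_paths_packing[OF simple_graph_symp(1)[OF fan_simple_graph[OF lay]]]]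
  have sum_eq: "(\<Sum>x\<leftarrow>map length pss. x div l) = (\<Sum>ps\<leftarrow>pss. length ps div l)" by (simp add: comp_def)
  show "(\<Sum>x\<leftarrow>map length pss. x div l) < t"
  proof (rule ccontr)
    assume "\<not> ?thesis"
    then have "t \<le> (\<Sum>ps\<leftarrow>pss. length ps div l)" unfolding sum_eq by simp
    from fan_packing_paths[OF lay \<open>0 < l\<close> this] show False using no by blast
  qed
  assume t: "t \<le> Suc (\<Sum>x\<leftarrow>map length pss. x div l)" "0 < t"
    and m: "mset (map length pss) = mset (x # y # rest)"
  obtain zs where zs: "mset zs = mset pss" "map length zs = x # y # rest"
    using permute_to_map_eq[OF m] by blast
  then obtain A B rest' where AB: "zs = A # B # rest'" "length A = x" "length B = y"
    by (auto simp: map_eq_Cons_conv)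
  show "x mod l + y mod l + 2 \<le> l"
  proof (rule ccontr)
    assume "\<not> ?thesis"
    then have "l \<le> Suc (length A mod l + length B mod l)" unfolding AB(2,3) by linarith
    moreover have "t - 1 \<le> (\<Sum>ps\<leftarrow>pss. length ps div l)" using t(1) unfolding sum_eq by linarith
    moreover have "mset pss = mset (A # B # rest')" using zs(1) AB(1) by metis
    ultimately obtain qss where "path_packing (fan u pss) (Suc (t - 1)) l qss" "set (concat qss) \<subseteq> {..<n}"
      using fan_packing_hub[OF lay \<open>0 < l\<close>, of "t - 1"] by metis
    then show False using no t(2) by auto
  qed
qed

lemma blocks_H_OP_sizes:
  assumes "0 < n2"
  obtains R where "blocks 1 (H_OP_sizes n n1 n2) = [1..<1 + n1] # R" "\<And>ps. ps \<in> set R \<Longrightarrow> length ps \<le> n2"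
proof -
  let ?ls = "replicate ((n - 1 - n1) div n2) n2 @ (if (n - 1 - n1) mod n2 = 0 then [] else [(n - 1 - n1) mod n2])"
  have "length ps \<le> n2" if "ps \<in> set (blocks (1 + n1) ?ls)" for ps
  proof -
    have "length ps \<in> set (map length (blocks (1 + n1) ?ls))" using that by simp
    then have "length ps \<in> set ?ls" unfolding length_blocks .
    then show ?thesis using assms by (auto split: if_splits intro: less_imp_le)
  qed
  moreover have "blocks 1 (H_OP_sizes n n1 n2) = [1..<1 + n1] # blocks (1 + n1) ?ls"
    unfolding H_OP_sizes_eq by (simp only: append_Cons append_Nil blocks.simps)
  ultimately show ?thesis using that by blast
qed

lemma H_OP_layout:
  assumes "1 \<le> n1" "1 \<le> n2" "n1 \<le> n - 1" "1 \<le> n"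
  shows "0 \<notin> set (H_OP_sizes n n1 n2)" "fan_layout n 0 (blocks 1 (H_OP_sizes n n1 n2))"
proof -
  show nz: "0 \<notin> set (H_OP_sizes n n1 n2)" using assms unfolding H_OP_sizes_eq by auto
  have "Suc (sum_list (H_OP_sizes n n1 n2)) = n" using sum_list_H_OP_sizes[OF assms(3)] assms(4) by simp
  then show "fan_layout n 0 (blocks 1 (H_OP_sizes n n1 n2))" using K1_join_paths_layout[OF nz] by simp
qed

theorem theorem2:
  fixes t l n :: nat
  assumes "let N = max (1.27 * 10^7) (max (6.5025 * 2 ^ (t * l)) ((5.08 * real ((l - 2) div 2))^2 + 1))
           in real n \<ge> N + 3/2 + 3 * sqrt (N - 7/4)"
  shows "(t = 1 \<and> l \<ge> 4 \<longrightarrow>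
            extremal_OP n (t * l) (paths_union (replicate t l))
              (K1_join_paths (H_OP_sizes n ((l - 1) div 2) ((l - 2) div 2))))
       \<and> (t \<ge> 2 \<and> l \<ge> 3 \<longrightarrow>
            extremal_OP n (t * l) (paths_union (replicate t l))
              (K1_join_paths (H_OP_sizes n (t * l - l - 1) (l - 1))))"
proof -
  define N where "N = max (1.27 * 10^7) (max (6.5025 * 2 ^ (t * l)) ((5.08 * real ((l - 2) div 2))^2 + 1))"
  have N: "12700000 \<le> N" "6.5025 * 2 ^ (t * l) \<le> N" "(5.08 * real ((l - 2) div 2))^2 + 1 \<le> N"
    unfolding N_def by (simp_all add: max_def)
  \<comment> \<open>The square root is non-negative as \<open>N\<close> exceeds 7/4, so the
    hypothesis yields \<open>N \<le> n - 1\<close>, the form in which all size bounds are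
    applied.\<close>
  have "0 \<le> sqrt (N - 7/4)" using N(1) by simp
  moreover have "N + 3/2 + 3 * sqrt (N - 7/4) \<le> real n" using assms unfolding N_def Let_def .
  ultimately have nN: "N \<le> real n - 1" by linarith
  have "real 12700000 \<le> real n" using nN N(1) by simp
  then have n: "12700000 \<le> n" by (simp only: of_nat_le_iff)
  define r where "r = sqrt (real n - 1)"
  have real_n: "real (n - 1) = real n - 1" using n by (simp add: of_nat_diff)
  have r2: "real (n - 1) = r\<^sup>2" unfolding real_n r_def using n by simp
  have "3563\<^sup>2 \<le> real n - 1" using nN N(1) by simp
  then have r_big: "3563 \<le> r" unfolding r_def by (rule real_le_rsqrt)
  have "(508 / 100 * real ((l - 2) div 2))\<^sup>2 \<le> real n - 1" using nN N(3) by simp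
  then have r_l: "508 / 100 * real ((l - 2) div 2) \<le> r" unfolding r_def by (rule real_le_rsqrt)
  \<comment> \<open>The exponential term of \<open>N\<close> is turned into a linear bound on
    \<open>t * l\<close>, the order of the forbidden graph.\<close>
  have tl: "65 / 10 * real (t * l) \<le> real n - 1"
  proof -
    have "real (t * l) \<le> 2 ^ (t * l)" by (rule less_imp_le, rule of_nat_less_two_power)
    moreover have "(65 / 10 :: real) * 2 ^ (t * l) \<le> 6.5025 * 2 ^ (t * l)" by simp
    ultimately show ?thesis using N(2) nN by linarith
  qed
  then have tl_r: "65 / 10 * real (t * l) \<le> r\<^sup>2" using r2 real_n by simp
  have "a \<le> 99 / 100 * b" if "65 / 10 * a \<le> b" "0 \<le> b" for a b :: real using that by linarith
  then have m: "real (t * l) \<le> 99 / 100 * (real n - 1)" using tl n by simp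
  have tl_n: "6 * (t * l) \<le> n - 1"
  proof -
    have "6 * a \<le> b" if "65 / 10 * a \<le> b" "0 \<le> a" for a b :: real using that by linarith
    from this[OF tl of_nat_0_le_iff] have "real (6 * (t * l)) \<le> real (n - 1)"
      unfolding real_n by simp
    then show ?thesis by (simp only: of_nat_le_iff)
  qed
  let ?F = "paths_union (replicate t l)"
  have packing: "contains_subgraph n (fan u pss) (t * l) ?F \<longleftrightarrow>
      (\<exists>qss. path_packing (fan u pss) t l qss \<and> set (concat qss) \<subseteq> {..<n})" if "fan_layout n u pss" for u pss
    by (rule contains_paths_packing[OF simple_graph_symp(1)[OF fan_simple_graph[OF that]]])
  show ?thesis
  proof (intro conjI impI)
    assume "t = 1 \<and> 4 \<le> l"
    then have t: "t = 1" and l: "4 \<le> l" by auto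
    \<comment> \<open>These are the ceiling and the floor of \<open>(l - 2) / 2\<close>, so they add
      up to \<open>l - 2\<close>: two pieces and the hub fall one vertex short of
      \<open>l\<close>.\<close>
    let ?n1 = "(l - 1) div 2" and ?n2 = "(l - 2) div 2"
    have l_n: "6 * l \<le> n - 1" using tl_n t by simp
    have nn: "1 \<le> ?n1" "1 \<le> ?n2" "?n2 \<le> ?n1" "?n1 + ?n2 + 1 < l" "?n1 \<le> n - 1"
      using l l_n by linarith+
    note H = H_OP_layout[OF nn(1,2,5)]
    have n1: "1 \<le> n" using n by simp
    show "extremal_OP n (t * l) ?F (K1_join_paths (H_OP_sizes n ?n1 ?n2))"
    proof (rule extremal_fan[OF n m sum_list_H_OP_sizes[OF nn(5)] H(1)[OF n1]])
      have "0 < ?n2" using nn(2) by linarith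
      then obtain R where R: "blocks 1 (H_OP_sizes n ?n1 ?n2) = [1..<1 + ?n1] # R" "\<And>ps. ps \<in> set R \<Longrightarrow> length ps \<le> ?n2"
        using blocks_H_OP_sizes[of ?n2 n ?n1] by metis
      have P: "length [1..<1 + ?n1] = ?n1" by (simp del: upt_Suc)
      show "\<not> contains_subgraph n (K1_join_paths (H_OP_sizes n ?n1 ?n2)) (t * l) ?F"
        unfolding K1_join_paths_fan packing[OF H(2)[OF n1]] unfolding t
        using fan_no_long_path[OF H(2)[OF n1] R(1) P R(2) nn(3,4)] by blast
    next
      fix u pss q
      assume lay: "fan_layout n u pss" and free: "\<not> contains_subgraph n (fan u pss) (t * l) ?F"
        and q: "0 < q" "q < 1" "q \<le> 2 / sqrt (real n - 1)"
        and le: "(\<Sum>x\<leftarrow>map length pss. path_gap q x) \<le> (\<Sum>x\<leftarrow>H_OP_sizes n ?n1 ?n2. path_gap q x)"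
      note sizes = fan_free_sizes[OF lay _ free]
      have l0: "0 < l" using l by simp
      \<comment> \<open>For \<open>t = 1\<close> the sum of the quotients is 0, so all sizes are
        below \<open>l\<close> and coincide with their remainders in the pair condition.\<close>
      have small: "x < l" if "x \<in> set (map length pss)" for x
      proof -
        have "x div l \<in> set (map (\<lambda>x. x div l) (map length pss))" using that by auto
        then have "x div l \<le> (\<Sum>x\<leftarrow>map length pss. x div l)" by (intro member_le_sum_list) simp_all
        also have "\<dots> < 1" using sizes(1)[OF l0] t by simp
        finally show ?thesis using l0 by (simp add: div_eq_0_iff)
      qed
      show "mset (map length pss) = mset (H_OP_sizes n ?n1 ?n2)"
      proof (rule best_sizes_one_path[OF l fan_layout_sum_lengths[OF lay] _ small _ r2 r_big r_l q(1,2) _ le])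
        show "0 \<notin> set (map length pss)" using lay by (auto simp: fan_layout_def)
        show "q \<le> 2 / r" using q(3) by (simp add: r_def)
        fix x y rest assume m: "mset (map length pss) = mset (x # y # rest)"
        have "x mod l + y mod l + 2 \<le> l" using sizes(2)[OF l0 _ _ m] t by simp
        moreover have "x < l" "y < l" using small mset_eq_setD[OF m] by auto
        ultimately show "x + y + 2 \<le> l" by simp
      qed
    qed
  next
    assume "2 \<le> t \<and> 3 \<le> l"
    then have t: "2 \<le> t" and l: "3 \<le> l" by auto
    let ?n1 = "t * l - l - 1" and ?n2 = "l - 1"
    have tl2: "2 * l \<le> t * l" using t by (rule mult_le_mono1)
    have nn: "1 \<le> ?n1" "1 \<le> ?n2" "?n1 \<le> n - 1" using l tl2 tl_n by linarith+
    have n1: "1 \<le> n" using n by simp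
    have l0: "0 < l" using l by simp
    note H = H_OP_layout[OF nn n1]
    show "extremal_OP n (t * l) ?F (K1_join_paths (H_OP_sizes n ?n1 ?n2))"
    proof (rule extremal_fan[OF n m sum_list_H_OP_sizes[OF nn(3)] H(1)])
      have "0 < ?n2" using nn(2) by linarith
      then obtain R where R: "blocks 1 (H_OP_sizes n ?n1 ?n2) = [1..<1 + ?n1] # R" "\<And>ps. ps \<in> set R \<Longrightarrow> length ps \<le> ?n2"
        using blocks_H_OP_sizes[of ?n2 n ?n1] by metis
      \<comment> \<open>The long path is one vertex short of what \<open>t - 1\<close> paths
        avoiding the hub would need.\<close>
      have "(t - 1) * l = t * l - l" by (simp add: diff_mult_distrib)
      then have P: "length [1..<1 + ?n1] < (t - 1) * l" using nn(1) by (simp del: upt_Suc)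
      have R_l: "length ps < l" if "ps \<in> set R" for ps using R(2)[OF that] l by linarith
      show "\<not> contains_subgraph n (K1_join_paths (H_OP_sizes n ?n1 ?n2)) (t * l) ?F"
        unfolding K1_join_paths_fan packing[OF H(2)]
        using fan_no_long_packing[OF H(2) R(1) P R_l] by blast
    next
      fix u pss q
      assume lay: "fan_layout n u pss" and free: "\<not> contains_subgraph n (fan u pss) (t * l) ?F"
        and q: "0 < q" "q < 1" "q \<le> 2 / sqrt (real n - 1)"
        and le: "(\<Sum>x\<leftarrow>map length pss. path_gap q x) \<le> (\<Sum>x\<leftarrow>H_OP_sizes n ?n1 ?n2. path_gap q x)"
      note sizes = fan_free_sizes[OF lay l0 free]
      show "mset (map length pss) = mset (H_OP_sizes n ?n1 ?n2)"
      proof (rule best_sizes_many_paths[OF l t fan_layout_sum_lengths[OF lay] _ sizes(1) _ r2 r_big tl_r q(1,2) _ le])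
        show "0 \<notin> set (map length pss)" using lay by (auto simp: fan_layout_def)
        show "q \<le> 2 / r" using q(3) by (simp add: r_def)
        fix x y rest
        assume "(\<Sum>x\<leftarrow>map length pss. x div l) = t - 1" "mset (map length pss) = mset (x # y # rest)"
        then show "x mod l + y mod l + 2 \<le> l" using sizes(2) t by simp
      qed
    qed
  qed
qed

end
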